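(* Let $p=\frac{(m-1)(m+2)}{2}$. The biharmonic map $\phi=\mathbf{i}\circ\psi:\mathbb{S}^m\big(\sqrt{\tfrac{m+1}{m}}\big)\to\mathbb{S}^{m+p+1}$ derived from the generalised Veronese map $\psi:\mathbb{S}^m\big(\sqrt{\tfrac{m+1}{m}}\big)\to\mathbb{S}^{m+p}(\tfrac1{\sqrt2})$ has index at least equal to $2m+3$.
   Context: $\mathbb{S}^k(r)\subset\mathbb{R}^{k+1}$ is the sphere of radius $r$ with the induced metric, $\mathbb{S}^k=\mathbb{S}^k(1)$. The tropical inclusion $\mathbf{i}$ is the inclusion of $\mathbb{S}^{m+p}(\tfrac1{\sqrt2})\cong\mathbb{S}^{m+p}(\tfrac1{\sqrt2})\times\{\tfrac1{\sqrt2}\}$ in $\mathbb{S}^{m+p+1}$, $x\mapsto(x,\tfrac1{\sqrt2})$. The generalised Veronese map is the standard minimal isometric immersion of $\mathbb{S}^m\big(\sqrt{\tfrac{2(m+1)}{m}}\big)$ into the unit sphere $\mathbb{S}^{m+p}$ given by the quadratic harmonic polynomials; after rescaling radii it is the minimal isometric immersion $\psi:\mathbb{S}^m\big(\sqrt{\tfrac{m+1}{m}}\big)\to\mathbb{S}^{m+p}(\tfrac1{\sqrt2})$, which up to congruence is $\psi(x)=\sqrt{\tfrac{m}{2(m+1)}}\left(xx^{T}-\tfrac{|x|^2}{m+1}\mathrm{Id}\right)$, with values in the Euclidean space (of dimension $m+p+1$) of traceless symmetric $(m+1)\times(m+1)$ matrices with inner product $\langle A,B\rangle=\mathrm{tr}(AB)$.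 Write $M$ for the domain of $\phi$ and $N=m+p+1$. The map $\phi$ is non-harmonic biharmonic, i.e. it is not harmonic and is a critical point of $E^2(\phi)=\tfrac12\int_M|\tau(\phi)|^2v_g$, where $\tau(\phi)=\mathrm{trace}\nabla d\phi$ (harmonic means $\tau(\phi)=0$). $\Delta^\phi=-\mathrm{trace}_g(\nabla^\phi\nabla^\phi-\nabla^\phi_\nabla)$ is the Laplacian on sections of $\phi^{-1}T\mathbb{S}^{N}$. The second variation operator of $E^2$ at $\phi$, on sections $V$ of $\phi^{-1}T\mathbb{S}^{N}$, is (writing $dV=\nabla^\phi V$, $d\tau(\phi)=\nabla^\phi\tau(\phi)$, traces taken over $M$) \begin{align*}I(V)&=\Delta^\phi(\Delta^\phi V)+\Delta^\phi\left(\mathrm{trace}\langle V,d\phi\cdot\rangle d\phi\cdot-|d\phi|^2V\right)+2\langle d\tau(\phi),d\phi\rangle V+|\tau(\phi)|^2V\\&-2\,\mathrm{trace}\langle V,d\tau(\phi)\cdot\rangle d\phi\cdot-2\,\mathrm{trace}\langle\tau(\phi),dV\cdot\rangle d\phi\cdot-\langle\tau(\phi),V\rangle\tau(\phi)+\mathrm{trace}\langle d\phi\cdot,\Delta^\phi V\rangle d\phi\cdot\\&+\mathrm{trace}\langle d\phi\cdot,\mathrm{trace}\langle V,d\phi\cdot\rangle d\phi\cdot\rangle d\phi\cdot-2|d\phi|^2\,\mathrm{trace}\langle d\phi\cdot,V\rangle d\phi\cdot+2\langle dV,d\phi\rangle\tau(\phi)-|d\phi|^2\Delta^\phi V+|d\phi|^4V,\end{align*}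 and $(I(V),W)=\int_M\langle I(V),W\rangle v_g$. The index of $\phi$ is the largest dimension of a vector space of smooth sections $V$ of $\phi^{-1}T\mathbb{S}^{N}$ on which $(I(V),V)<0$ for all $V\neq0$.
   Formalization: The formal statement assumes m ≥ 2; for m = 1 one has p = 0, ψ is the double cover of circles S^1(√2) → S^1(1/√2), and the index of φ is 3, less than 2m+3 = 5, so the claim fails there. *)

theory Defs
  imports "HOL-Analysis.Analysis" "HOL-Library.Function_Algebras" "HOL-Library.Extended_Nat"
begin

section \<open>Smooth maps on a round sphere\<close>

primrec Ck_on :: "nat \<Rightarrow> ('a::euclidean_space \<Rightarrow> 'b::euclidean_space) \<Rightarrow> 'a set \<Rightarrow> bool" where
  "Ck_on 0 f U \<longleftrightarrow> continuous_on U f"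
| "Ck_on (Suc k) f U \<longleftrightarrow> (\<forall>x\<in>U. f differentiable (at x)) \<and>
     (\<forall>v. Ck_on k (\<lambda>x. frechet_derivative f (at x) v) U)"

definition smooth_on_sphere :: "real \<Rightarrow> ('a::euclidean_space \<Rightarrow> 'b::euclidean_space) \<Rightarrow> bool" where
  "smooth_on_sphere R f \<longleftrightarrow>
     (\<exists>U F. open U \<and> sphere 0 R \<subseteq> U \<and> (\<forall>k. Ck_on k F U) \<and> (\<forall>x\<in>sphere 0 R. F x = f x))"


section \<open>Calculus on the sphere of radius R\<close>

definition tangent_space :: "'a::euclidean_space \<Rightarrow> 'a set" where
  "tangent_space x = {v. v \<bullet> x = 0}"

text \<open>The differential at \<open>x\<close> of a map defined on \<open>sphere 0 R\<close>. A derivative within the sphere is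
  determined only on tangent vectors; below it is applied to tangent vectors exclusively.\<close>

definition sdiff ::
    "real \<Rightarrow> ('a::euclidean_space \<Rightarrow> 'b::euclidean_space) \<Rightarrow> 'a \<Rightarrow> 'a \<Rightarrow> 'b" where
  "sdiff R f x = frechet_derivative f (at x within sphere 0 R)"

definition tangent_trace ::
    "'a::euclidean_space \<Rightarrow> ('a \<Rightarrow> 'a \<Rightarrow> 'c::real_vector) \<Rightarrow> 'c" where
  "tangent_trace x h =
     (let B = (SOME B. pairwise orthogonal B \<and> (\<forall>b\<in>B. norm b = 1) \<and> span B = tangent_space x)
      in \<Sum>e\<in>B. h e e)"

definition levi_civita :: "real \<Rightarrow> ('a::euclidean_space \<Rightarrow> 'a) \<Rightarrow> 'a \<Rightarrow> 'a \<Rightarrow> 'a" where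
  "levi_civita R Y x u = sdiff R Y x u - ((sdiff R Y x u \<bullet> x) / R\<^sup>2) *\<^sub>R x"

text \<open>A tangent vector \<open>w\<close> at a point is extended to the vector field on \<open>sphere 0 R\<close> given by the
  tangential part of the constant field \<open>w\<close>. It serves to evaluate second covariant derivatives,
  which are tensorial, so that the choice of the extension is immaterial.\<close>

definition tangent_ext :: "real \<Rightarrow> 'a::euclidean_space \<Rightarrow> 'a \<Rightarrow> 'a" where
  "tangent_ext R w y = w - ((w \<bullet> y) / R\<^sup>2) *\<^sub>R y"

text \<open>The Riemannian measure of \<open>sphere 0 R\<close> with the induced metric, obtained from Lebesgue measure
  in polar coordinates: with \<open>n\<close> the dimension of the ambient space, a Borel set \<open>A\<close> of the sphere
  spans the cone of all \<open>t *\<^sub>R x\<close> with \<open>x \<in> A\<close> and \<open>0 < t \<le> 1\<close>, and the \<open>n\<close>-dimensional volume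
  of this cone is \<open>R / n\<close> times the area of \<open>A\<close>.\<close>

definition sphere_measure :: "real \<Rightarrow> 'a::euclidean_space measure" where
  "sphere_measure R =
     scale_measure (ennreal (DIM('a) / R))
       (distr (restrict_space lborel (cball 0 R - {0})) (restrict_space borel (sphere 0 R))
          (\<lambda>x. (R / norm x) *\<^sub>R x))"


section \<open>Second variation of the bienergy for maps of spheres\<close>

text \<open>\<open>\<phi>\<close> is a map from \<open>sphere 0 R\<close> to the unit sphere \<open>sphere 0 1\<close>; its values elsewhere are
  irrelevant. Sections of the pull-back of the tangent bundle of the unit sphere are maps \<open>V\<close> into
  the ambient space with \<open>V x\<close> orthogonal to \<open>\<phi> x\<close>.\<close>

context
  fixes R :: real and \<phi> :: "'a::euclidean_space \<Rightarrow> 'b::euclidean_space"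
begin

definition pullback_conn :: "('a \<Rightarrow> 'b) \<Rightarrow> 'a \<Rightarrow> 'a \<Rightarrow> 'b" where
  "pullback_conn V x u = sdiff R V x u - (sdiff R V x u \<bullet> \<phi> x) *\<^sub>R \<phi> x"

definition second_cov_deriv :: "('a \<Rightarrow> 'b) \<Rightarrow> 'a \<Rightarrow> 'a \<Rightarrow> 'a \<Rightarrow> 'b" where
  "second_cov_deriv V x u w =
     pullback_conn (\<lambda>y. pullback_conn V y (tangent_ext R w y)) x u
     - pullback_conn V x (levi_civita R (tangent_ext R w) x u)"

definition rough_laplacian :: "('a \<Rightarrow> 'b) \<Rightarrow> 'a \<Rightarrow> 'b" where
  "rough_laplacian V x = - tangent_trace x (second_cov_deriv V x)"

definition second_fundamental_form :: "'a \<Rightarrow> 'a \<Rightarrow> 'a \<Rightarrow> 'b" where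
  "second_fundamental_form x u w =
     pullback_conn (\<lambda>y. sdiff R \<phi> y (tangent_ext R w y)) x u
     - sdiff R \<phi> x (levi_civita R (tangent_ext R w) x u)"

definition tension :: "'a \<Rightarrow> 'b" where
  "tension x = tangent_trace x (second_fundamental_form x)"

definition energy_density2 :: "'a \<Rightarrow> real" where
  \<comment> \<open>\<open>|d\<phi>|\<^sup>2\<close>\<close>
  "energy_density2 x = tangent_trace x (\<lambda>u w. sdiff R \<phi> x u \<bullet> sdiff R \<phi> x w)"

definition tangential_part :: "('a \<Rightarrow> 'b) \<Rightarrow> 'a \<Rightarrow> 'b" where
  \<comment> \<open>\<open>trace \<langle>V, d\<phi>\<cdot>\<rangle> d\<phi>\<cdot>\<close>\<close>
  "tangential_part V x = tangent_trace x (\<lambda>u w. (V x \<bullet> sdiff R \<phi> x u) *\<^sub>R sdiff R \<phi> x w)"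

definition inner_dphi :: "('a \<Rightarrow> 'b) \<Rightarrow> 'a \<Rightarrow> real" where
  \<comment> \<open>\<open>\<langle>dV, d\<phi>\<rangle>\<close>\<close>
  "inner_dphi V x = tangent_trace x (\<lambda>u w. pullback_conn V x u \<bullet> sdiff R \<phi> x w)"

definition second_variation_op :: "('a \<Rightarrow> 'b) \<Rightarrow> 'a \<Rightarrow> 'b" where
  "second_variation_op V x =
     rough_laplacian (rough_laplacian V) x
     + rough_laplacian (\<lambda>y. tangential_part V y - energy_density2 y *\<^sub>R V y) x
     + (2 * inner_dphi tension x) *\<^sub>R V x
     + (norm (tension x))\<^sup>2 *\<^sub>R V x
     - 2 *\<^sub>R tangent_trace x (\<lambda>u w. (V x \<bullet> pullback_conn tension x u) *\<^sub>R sdiff R \<phi> x w)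
     - 2 *\<^sub>R tangent_trace x (\<lambda>u w. (tension x \<bullet> pullback_conn V x u) *\<^sub>R sdiff R \<phi> x w)
     - (tension x \<bullet> V x) *\<^sub>R tension x
     + tangential_part (rough_laplacian V) x
     + tangential_part (tangential_part V) x
     - (2 * energy_density2 x) *\<^sub>R tangential_part V x
     + (2 * inner_dphi V x) *\<^sub>R tension x
     - energy_density2 x *\<^sub>R rough_laplacian V x
     + (energy_density2 x)\<^sup>2 *\<^sub>R V x"

definition second_variation_form :: "('a \<Rightarrow> 'b) \<Rightarrow> ('a \<Rightarrow> 'b) \<Rightarrow> real" where
  "second_variation_form V W = (\<integral>x. second_variation_op V x \<bullet> W x \<partial>sphere_measure R)"

text \<open>A section is normalised to vanish off the sphere, so that equality of sections is equality of
  functions.\<close>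

definition smooth_sections :: "('a \<Rightarrow> 'b) set" where
  "smooth_sections = {V. smooth_on_sphere R V \<and> (\<forall>x\<in>sphere 0 R. V x \<bullet> \<phi> x = 0) \<and>
     (\<forall>x. x \<notin> sphere 0 R \<longrightarrow> V x = 0)}"

end

definition fun_scale :: "real \<Rightarrow> ('a \<Rightarrow> 'b::real_vector) \<Rightarrow> 'a \<Rightarrow> 'b" where
  "fun_scale c f = (\<lambda>x. c *\<^sub>R f x)"

interpretation fun_space: vector_space "fun_scale :: real \<Rightarrow> ('a \<Rightarrow> 'b::real_vector) \<Rightarrow> 'a \<Rightarrow> 'b"
  by unfold_locales (auto simp: fun_scale_def fun_eq_iff algebra_simps)

text \<open>The library's \<open>dim\<close> is \<open>0\<close> for a space of infinite dimension. This does not affect the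
  supremum, because the finite-dimensional subspaces of such a space take part in it as well.\<close>

definition biharmonic_index ::
    "real \<Rightarrow> ('a::euclidean_space \<Rightarrow> 'b::euclidean_space) \<Rightarrow> enat" where
  "biharmonic_index R \<phi> =
     (SUP S \<in> {S. fun_space.subspace S \<and> S \<subseteq> smooth_sections R \<phi> \<and>
                  (\<forall>V\<in>S. V \<noteq> 0 \<longrightarrow> second_variation_form R \<phi> V V < 0)}.
        enat (fun_space.dim S))"


section \<open>The generalised Veronese map and the tropical inclusion\<close>

definition traceless_symmetric :: "(real^'n^'n) set" where
  "traceless_symmetric = {A. transpose A = A \<and> trace A = 0}"

definition veronese_matrix :: "real^'n \<Rightarrow> real^'n^'n" where
  "veronese_matrix x = (let m = real CARD('n) - 1 in
     sqrt (m / (2 * (m + 1))) *\<^sub>R ((\<chi> i j. x $ i * x $ j) - mat ((norm x)\<^sup>2 / (m + 1))))"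

text \<open>The map is determined up to congruence: \<open>L\<close> is an arbitrary linear isometry of the traceless
  symmetric matrices, with inner product \<open>trace (A ** B)\<close>, into Euclidean space (only its values on
  these matrices matter); it is onto when the dimensions agree.\<close>

definition generalised_veronese :: "(real^'n \<Rightarrow> real^'k) \<Rightarrow> bool" where
  "generalised_veronese \<psi> \<longleftrightarrow> (let m = real CARD('n) - 1 in
     \<exists>L. linear L \<and>
       (\<forall>A\<in>traceless_symmetric. \<forall>B\<in>traceless_symmetric. L A \<bullet> L B = trace (A ** B)) \<and>
       (\<forall>x\<in>sphere 0 (sqrt ((m + 1) / m)). \<psi> x = L (veronese_matrix x)))"

definition tropical_inclusion :: "real^'k \<Rightarrow> (real^'k) \<times> real" where
  "tropical_inclusion y = (y, 1 / sqrt 2)"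

end

theory Submission
  imports Defs
begin

text \<open>Write \<open>\<kappa> = 1 / R\<^sup>2 = m / (m + 1)\<close> and \<open>\<psi> x = Q x x\<close> with \<open>Q\<close> symmetric and bilinear, so that
  \<open>\<phi> = (\<psi>, r)\<close> with \<open>r = 1 / sqrt 2\<close>, and let \<open>\<eta> = (\<psi>, - r)\<close>. This is the unit normal of the small sphere
  containing the image of \<open>\<phi>\<close>, and the tension field of \<open>\<phi>\<close> is \<open>- m \<eta>\<close>. For a linear function
  \<open>f x = b \<bullet> x\<close> and a quadratic form \<open>h x = x \<bullet> A x\<close> of trace zero consider the sections

    \<open>V = (\<alpha> + f + h) \<eta> + (R\<^sup>2 / 4) d\<phi>(grad h) = (\<alpha> + f) \<eta> + (R\<^sup>2 Q x (A x), - r h)\<close>.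

  They satisfy, with the eigenvalue \<open>\<lambda> = m \<kappa>\<close> of the linear functions,

    \<open>(I(V), V) = - 4 m\<^sup>2 \<alpha>\<^sup>2 vol + (\<lambda>\<^sup>2 + 4 \<lambda> - 4 m\<^sup>2) \<integral>f\<^sup>2 - (m - 1)\<^sup>2 \<integral>h\<^sup>2\<close>,

  which is negative for \<open>m \<ge> 2\<close> unless \<open>V = 0\<close>: the coefficient of \<open>\<integral>f\<^sup>2\<close> is less than
  \<open>m (4 - 3 m)\<close>, because \<open>\<lambda> < m\<close>. Taking for \<open>A\<close> the trace-free part of \<open>x \<mapsto> (c \<bullet> x) e + (e \<bullet> x) c\<close>
  with a fixed unit vector \<open>e\<close>, the parameters \<open>(b, c, \<alpha>)\<close> range over a space of dimension
  \<open>2 (m + 1) + 1 = 2 m + 3\<close>. The fields \<open>d\<phi>(grad f)\<close> with \<open>f\<close> linear would be the more obvious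
  supplement of the fields \<open>f \<eta>\<close>, but the form is positive on them for \<open>m \<le> 4\<close>; the quadratic
  forms \<open>h\<close> work for all \<open>m \<ge> 2\<close>.\<close>

text \<open>The operator \<open>I\<close> is evaluated pointwise. Everything in sight is the restriction to the sphere of
  a polynomial map, and for such a restriction the rough Laplacian is
  \<open>- (\<Delta>\<^sub>S V)\<^sup>\<top> - trace \<langle>V, d\<phi>\<cdot>\<rangle> d\<phi>\<cdot>\<close>, where \<open>\<Delta>\<^sub>S\<close> is the Laplacian of the sphere acting on
  vector-valued functions and \<open>\<top>\<close> the projection orthogonal to \<open>\<phi>\<close> (\<open>rough_laplacian_eq\<close>).
  For given \<open>b\<close> and \<open>A\<close> there is a space of sections, spanned by six of them, that contains \<open>V\<close> and the
  tension field and is invariant under all the operators in the definition of \<open>I\<close>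
  (\<open>rough_laplacian_field\<close>, \<open>tangential_field\<close>), so that \<open>I(V)\<close> is a computation with coefficients
  (\<open>second_variation_op_field\<close>). It remains to integrate polynomials of degree at most four over the
  sphere, which the orthogonal invariance of the sphere measure does
  (\<open>integral_sphere_second_moment\<close>, \<open>integral_sphere_fourth_moment\<close>).\<close>

section \<open>Traces over tangent spaces and derivatives along the sphere\<close>

lemma bilinear_trace_eq:
  fixes h :: "'a::euclidean_space \<Rightarrow> 'a \<Rightarrow> 'c::real_vector"
  assumes lin: "\<And>v. linear (\<lambda>u. h u v)" "\<And>u. linear (h u)"
    and B: "pairwise orthogonal B" "\<And>b. b \<in> B \<Longrightarrow> norm b = 1" "span B = UNIV"
  shows "(\<Sum>b\<in>B. h b b) = (\<Sum>i\<in>Basis. h i i)"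
proof -
  have finB: "finite B"
    using pairwise_orthogonal_imp_finite[OF B(1)] .
  have exp: "y = (\<Sum>b\<in>B. (y \<bullet> b) *\<^sub>R b)" for y :: 'a
    using orthonormal_basis_expand[OF B(1) B(2) _ finB, of y] B(3) by simp
  have "(\<Sum>i\<in>Basis. h i i) = (\<Sum>i\<in>Basis. \<Sum>b\<in>B. (i \<bullet> b) *\<^sub>R h i b)"
  proof (rule sum.cong[OF refl])
    fix i :: 'a
    show "h i i = (\<Sum>b\<in>B. (i \<bullet> b) *\<^sub>R h i b)"
      using arg_cong[OF exp[of i], of "h i"]
      by (simp add: linear_sum[OF lin(2)] linear_cmul[OF lin(2)])
  qed
  also have "\<dots> = (\<Sum>b\<in>B. \<Sum>i\<in>Basis. (i \<bullet> b) *\<^sub>R h i b)"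
    by (rule sum.swap)
  also have "\<dots> = (\<Sum>b\<in>B. h b b)"
  proof (rule sum.cong[OF refl])
    fix b :: 'a
    have "h b b = h (\<Sum>i\<in>Basis. (b \<bullet> i) *\<^sub>R i) b"
      by (simp add: euclidean_representation)
    also have "\<dots> = (\<Sum>i\<in>Basis. (b \<bullet> i) *\<^sub>R h i b)"
      by (simp add: linear_sum[OF lin(1)] linear_cmul[OF lin(1)])
    finally show "(\<Sum>i\<in>Basis. (i \<bullet> b) *\<^sub>R h i b) = h b b"
      by (simp add: inner_commute)
  qed
  finally show ?thesis by simp
qed

lemma tangent_trace_basis:
  fixes x :: "'a::euclidean_space"
  shows "\<exists>B. pairwise orthogonal B \<and> (\<forall>b\<in>B. norm b = 1) \<and> span B = tangent_space x \<and> (\<forall>b\<in>B. b \<bullet> x = 0) \<and>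
    (\<forall>h :: 'a \<Rightarrow> 'a \<Rightarrow> 'c::real_vector. tangent_trace x h = (\<Sum>b\<in>B. h b b))"
proof -
  let ?P = "\<lambda>B. pairwise orthogonal B \<and> (\<forall>b\<in>B. norm b = 1) \<and> span B = tangent_space x"
  define B where "B = (SOME B. ?P B)"
  have sub: "subspace (tangent_space x)"
    by (auto simp: tangent_space_def subspace_def inner_add_left)
  have "\<exists>B. ?P B"
    by (rule orthonormal_basis_subspace[OF sub]) auto
  then have PB: "?P B"
    unfolding B_def by (rule someI_ex)
  have BT: "b \<bullet> x = 0" if "b \<in> B" for b
    using that PB span_base[of b B] by (auto simp: tangent_space_def)
  have tr: "tangent_trace x h = (\<Sum>b\<in>B. h b b)" for h :: "'a \<Rightarrow> 'a \<Rightarrow> 'c"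
    by (simp add: tangent_trace_def B_def)
  show ?thesis
    using PB BT tr by blast
qed

text \<open>An orthonormal basis of the tangent space at \<open>x\<close> together with \<open>x / |x|\<close> is one of the ambient
  space, so the trace over the tangent space is the full trace minus the radial term.\<close>

lemma tangent_trace_bilinear:
  fixes x :: "'a::euclidean_space" and h h' :: "'a \<Rightarrow> 'a \<Rightarrow> 'c::real_vector"
  assumes x: "x \<noteq> 0"
    and lin: "\<And>v. linear (\<lambda>u. h' u v)" "\<And>u. linear (h' u)"
    and eq: "\<And>u. u \<bullet> x = 0 \<Longrightarrow> h u u = h' u u"
  shows "tangent_trace x h = (\<Sum>i\<in>Basis. h' i i) - (1 / (x \<bullet> x)) *\<^sub>R h' x x"
proof -
  obtain B where PB: "pairwise orthogonal B" "\<forall>b\<in>B. norm b = 1" "span B = tangent_space x"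
    and BT': "\<forall>b\<in>B. b \<bullet> x = 0"
    and tr: "\<forall>h :: 'a \<Rightarrow> 'a \<Rightarrow> 'c. tangent_trace x h = (\<Sum>b\<in>B. h b b)"
    using tangent_trace_basis[of x, where ?'c = 'c] by (elim exE conjE)
  note BT = BT'[rule_format]
  have finB: "finite B"
    using PB pairwise_orthogonal_imp_finite by blast
  define e where "e = (1 / norm x) *\<^sub>R x"
  have ne: "norm e = 1"
    using x by (simp add: e_def)
  have ex: "norm x *\<^sub>R e = x"
    using x by (simp add: e_def)
  have be: "b \<bullet> e = 0" if "b \<in> B" for b
    using BT[OF that] by (simp add: e_def)
  have eB: "e \<notin> B"
    using be ne by (metis norm_eq_zero inner_eq_zero_iff zero_neq_one)
  have span: "span (insert e B) = UNIV"
  proof -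
    have "y \<in> span (insert e B)" for y
    proof -
      have "(y - (y \<bullet> e) *\<^sub>R e) \<bullet> x = 0"
      proof -
        have "(y - (y \<bullet> e) *\<^sub>R e) \<bullet> (norm x *\<^sub>R e) = 0"
          using ne by (simp add: inner_diff_left norm_eq_1)
        then show ?thesis by (simp only: ex)
      qed
      then have "y - (y \<bullet> e) *\<^sub>R e \<in> span B"
        using PB by (simp add: tangent_space_def)
      then show ?thesis
        unfolding span_insert by blast
    qed
    then show ?thesis by auto
  qed
  have orth: "pairwise orthogonal (insert e B)"
    using PB be by (auto simp: pairwise_insert orthogonal_def inner_commute)
  have "(\<Sum>b\<in>insert e B. h' b b) = (\<Sum>i\<in>Basis. h' i i)"
    using PB ne by (intro bilinear_trace_eq lin orth span) auto
  moreover have "(\<Sum>b\<in>insert e B. h' b b) = h' e e + (\<Sum>b\<in>B. h' b b)"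
    using finB eB by simp
  moreover have "h' e e = (1 / (x \<bullet> x)) *\<^sub>R h' x x"
    by (simp add: e_def linear_cmul[OF lin(1)] linear_cmul[OF lin(2)] dot_square_norm power2_eq_square)
  moreover have "tangent_trace x h = (\<Sum>b\<in>B. h' b b)"
    unfolding tr[rule_format] using eq BT by (intro sum.cong) auto
  ultimately show ?thesis by (simp add: algebra_simps)
qed

lemma tangent_trace_cong:
  fixes x :: "'a::euclidean_space" and h h' :: "'a \<Rightarrow> 'a \<Rightarrow> 'c::real_vector"
  assumes "\<And>u. u \<bullet> x = 0 \<Longrightarrow> h u u = h' u u"
  shows "tangent_trace x h = tangent_trace x h'"
proof -
  obtain B where PB: "pairwise orthogonal B" "\<forall>b\<in>B. norm b = 1" "span B = tangent_space x"
    and BT': "\<forall>b\<in>B. b \<bullet> x = 0"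
    and tr: "\<forall>h :: 'a \<Rightarrow> 'a \<Rightarrow> 'c. tangent_trace x h = (\<Sum>b\<in>B. h b b)"
    using tangent_trace_basis[of x, where ?'c = 'c] by (elim exE conjE)
  note BT = BT'[rule_format]
  show ?thesis
    unfolding tr[rule_format] using assms BT by (intro sum.cong) auto
qed

text \<open>Trace terms of the shape \<open>trace \<langle>V, d\<phi>\<cdot>\<rangle> d\<phi>\<cdot>\<close> are evaluated by finding the tangent vector \<open>Z\<close> that
  represents the linear form in the first factor.\<close>

lemma tangent_trace_dual:
  fixes x Z :: "'a::euclidean_space" and k :: "'a \<Rightarrow> 'c::real_vector"
  assumes x: "x \<noteq> 0" and Z: "Z \<bullet> x = 0" and k: "linear k"
    and eq: "\<And>u. u \<bullet> x = 0 \<Longrightarrow> h u u = (Z \<bullet> u) *\<^sub>R k u"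
  shows "tangent_trace x h = k Z"
proof -
  have "tangent_trace x h = (\<Sum>i\<in>Basis. (Z \<bullet> i) *\<^sub>R k i) - (1 / (x \<bullet> x)) *\<^sub>R ((Z \<bullet> x) *\<^sub>R k x)"
    using eq
    by (intro tangent_trace_bilinear x)
      (auto simp: linear_add[OF k] linear_cmul[OF k] inner_add_right algebra_simps intro!: linearI)
  also have "\<dots> = (\<Sum>i\<in>Basis. (Z \<bullet> i) *\<^sub>R k i)"
    using Z by simp
  also have "\<dots> = k (\<Sum>i\<in>Basis. (Z \<bullet> i) *\<^sub>R i)"
    by (simp add: linear_sum[OF k] linear_cmul[OF k])
  also have "\<dots> = k Z"
    by (simp add: euclidean_representation)
  finally show ?thesis .
qed

text \<open>A derivative within the sphere is determined on tangent vectors: both candidates are the velocity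
  of \<open>f\<close> along the radial projection of the line \<open>x + t u\<close>.\<close>

lemma sphere_derivative_unique:
  fixes f :: "'a::euclidean_space \<Rightarrow> 'b::real_normed_vector"
  assumes x: "x \<in> sphere 0 R" and R: "R > 0" and u: "u \<bullet> x = 0"
    and D: "(f has_derivative D) (at x within sphere 0 R)"
    and D': "(f has_derivative D') (at x within sphere 0 R)"
  shows "D u = D' u"
proof -
  \<comment> \<open>A curve on the sphere through \<open>x\<close> with velocity \<open>u\<close>.\<close>
  define g :: "real \<Rightarrow> 'a" where "g t = (R / norm (x + t *\<^sub>R u)) *\<^sub>R (x + t *\<^sub>R u)" for t
  have nx: "norm x = R" using x by simp
  have nz: "x + t *\<^sub>R u \<noteq> 0" for t
  proof
    assume "x + t *\<^sub>R u = 0"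
    then have "(x + t *\<^sub>R u) \<bullet> x = 0" by simp
    then have "x \<bullet> x = 0" using u by (simp add: inner_add_left)
    then show False using nx R by simp
  qed
  have g0: "g 0 = x" using nx R by (simp add: g_def)
  have gs: "g t \<in> sphere 0 R" for t
    using nz[of t] R by (simp add: g_def)
  have ng: "norm (x + t *\<^sub>R u) = sqrt ((x + t *\<^sub>R u) \<bullet> (x + t *\<^sub>R u))" for t
    by (simp add: norm_eq_sqrt_inner)
  have "((\<lambda>t. norm (x + t *\<^sub>R u)) has_real_derivative 0) (at 0)"
  proof -
    have d: "((\<lambda>t. (x + t *\<^sub>R u) \<bullet> (x + t *\<^sub>R u)) has_real_derivative 0) (at 0)"
      unfolding has_field_derivative_def using u
      by (auto intro!: derivative_eq_intros simp: inner_commute)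
    have pos: "0 < (x + 0 *\<^sub>R u) \<bullet> (x + 0 *\<^sub>R u)"
      using nx R by auto
    have "((\<lambda>t. sqrt ((x + t *\<^sub>R u) \<bullet> (x + t *\<^sub>R u))) has_real_derivative 0) (at 0)"
      using DERIV_chain2[where f=sqrt and g="\<lambda>t. (x + t *\<^sub>R u) \<bullet> (x + t *\<^sub>R u)", OF DERIV_real_sqrt[OF pos] d] by simp
    then show ?thesis by (simp only: ng)
  qed
  then have "((\<lambda>t. R / norm (x + t *\<^sub>R u)) has_real_derivative 0) (at 0)"
    using nx R by (auto intro!: derivative_eq_intros)
  then have r: "((\<lambda>t. R / norm (x + t *\<^sub>R u)) has_derivative (\<lambda>t. 0)) (at 0)"
    unfolding has_field_derivative_def by (rule has_derivative_eq_rhs) auto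
  have "((\<lambda>t. x + t *\<^sub>R u) has_derivative (\<lambda>t. t *\<^sub>R u)) (at 0)"
    by (auto intro!: derivative_eq_intros)
  then have "(g has_derivative (\<lambda>t. t *\<^sub>R u)) (at 0)"
    unfolding g_def by (rule has_derivative_eq_rhs[OF has_derivative_scaleR[OF r]]) (use nx R in auto)
  then have "(g has_derivative (\<lambda>t. t *\<^sub>R u)) (at 0 within UNIV)" by simp
  moreover have "g ` UNIV \<subseteq> sphere 0 R" using gs by auto
  ultimately have "((\<lambda>t. f (g t)) has_derivative (\<lambda>t. D (t *\<^sub>R u))) (at 0)"
    "((\<lambda>t. f (g t)) has_derivative (\<lambda>t. D' (t *\<^sub>R u))) (at 0)"
    using has_derivative_in_compose2[of "sphere 0 R" f "\<lambda>_. D" g UNIV 0 "\<lambda>t. t *\<^sub>R u"]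
    using has_derivative_in_compose[of g "\<lambda>t. t *\<^sub>R u" 0 UNIV f D]
     has_derivative_in_compose[of g "\<lambda>t. t *\<^sub>R u" 0 UNIV f D']
     has_derivative_subset[OF D, of "range g"] has_derivative_subset[OF D', of "range g"] g0
    by auto
  then have "(\<lambda>t. D (t *\<^sub>R u)) = (\<lambda>t. D' (t *\<^sub>R u))"
    by (rule has_derivative_unique)
  from fun_cong[OF this, of 1] show ?thesis by simp
qed

lemma sdiff_eq:
  fixes f F :: "'a::euclidean_space \<Rightarrow> 'b::euclidean_space"
  assumes x: "x \<in> sphere 0 R" and R: "R > 0" and u: "u \<bullet> x = 0"
    and eq: "\<And>y. y \<in> sphere 0 R \<Longrightarrow> f y = F y"
    and F: "(F has_derivative F') (at x)"
  shows "sdiff R f x u = F' u"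
proof -
  have f: "(f has_derivative F') (at x within sphere 0 R)"
    using has_derivative_at_withinI[OF F] x
    by (rule has_derivative_transform[rotated 2]) (use eq x in auto)
  then have "(f has_derivative sdiff R f x) (at x within sphere 0 R)"
    unfolding sdiff_def using frechet_derivative_works by (auto simp: differentiable_def)
  from sphere_derivative_unique[OF x R u this f] show ?thesis .
qed

section \<open>The rough Laplacian through an ambient extension\<close>

lemma tangent_trace_add:
  "tangent_trace x (\<lambda>u w. h u w + k u w) = tangent_trace x h + tangent_trace x k"
  by (simp add: tangent_trace_def Let_def sum.distrib)

lemma tangent_trace_linear:
  "linear L \<Longrightarrow> tangent_trace x (\<lambda>u w. L (h u w)) = L (tangent_trace x h)"
  by (simp add: tangent_trace_def Let_def linear_sum)

text \<open>\<open>F'' x v u\<close> is the derivative at \<open>x\<close> in the direction \<open>v\<close> of \<open>y \<mapsto> F' y u\<close>. The derivatives are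
  carried along explicitly because all maps in question are polynomials.\<close>

definition twice_derivable ::
    "('a::euclidean_space \<Rightarrow> 'b::euclidean_space) \<Rightarrow> ('a \<Rightarrow> 'a \<Rightarrow> 'b) \<Rightarrow> ('a \<Rightarrow> 'a \<Rightarrow> 'a \<Rightarrow> 'b) \<Rightarrow> bool" where
  "twice_derivable F F' F'' \<longleftrightarrow>
     (\<forall>x. (F has_derivative F' x) (at x)) \<and>
     (\<forall>x u. ((\<lambda>y. F' y u) has_derivative (\<lambda>v. F'' x v u)) (at x)) \<and>
     (\<forall>x v. linear (F'' x v))"

text \<open>The Laplacian on the sphere of radius \<open>R\<close> of the restriction of \<open>F\<close>, with the sign of the trace of
  the Hessian, expressed by the ambient derivatives of \<open>F\<close>.\<close>

definition sphere_laplacian ::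
    "real \<Rightarrow> ('a::euclidean_space \<Rightarrow> 'a \<Rightarrow> 'b::euclidean_space) \<Rightarrow> ('a \<Rightarrow> 'a \<Rightarrow> 'a \<Rightarrow> 'b) \<Rightarrow> 'a \<Rightarrow> 'b" where
  "sphere_laplacian R F' F'' x =
     (\<Sum>i\<in>Basis. F'' x i i) - (1 / R\<^sup>2) *\<^sub>R F'' x x x - ((real DIM('a) - 1) / R\<^sup>2) *\<^sub>R F' x x"

text \<open>The projection onto the orthogonal complement of a unit vector \<open>n\<close>.\<close>

definition unit_perp :: "'b::real_inner \<Rightarrow> 'b \<Rightarrow> 'b" where
  "unit_perp n v = v - (v \<bullet> n) *\<^sub>R n"

lemma linear_unit_perp: "linear (unit_perp n)"
  by (auto intro!: linearI simp: unit_perp_def inner_add_left algebra_simps)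

lemma twice_derivableD:
  assumes "twice_derivable F F' F''"
  shows "(F has_derivative F' x) (at x)" "((\<lambda>y. F' y u) has_derivative (\<lambda>v. F'' x v u)) (at x)"
    "linear (F' x)" "linear (\<lambda>v. F'' x v u)" "linear (F'' x v)"
proof -
  have *: "\<And>x. (F has_derivative F' x) (at x)"
    "\<And>x u. ((\<lambda>y. F' y u) has_derivative (\<lambda>v. F'' x v u)) (at x)" "\<And>x v. linear (F'' x v)"
    using assms unfolding twice_derivable_def by simp_all
  show "(F has_derivative F' x) (at x)" "((\<lambda>y. F' y u) has_derivative (\<lambda>v. F'' x v u)) (at x)"
    "linear (F'' x v)"
    by (rule *)+
  show "linear (F' x)" "linear (\<lambda>v. F'' x v u)"
    by (rule has_derivative_linear, rule *)+
qed

lemma has_derivative_inner_over: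
  "((\<lambda>y. (w \<bullet> y) / c) has_derivative (\<lambda>v. (w \<bullet> v) / c)) (at x)"
  by (intro bounded_linear_imp_has_derivative bounded_linear_compose[OF bounded_linear_divide bounded_linear_inner_right])

lemma sphere_nonzero: "R > 0 \<Longrightarrow> x \<in> sphere 0 R \<Longrightarrow> x \<noteq> 0"
  by auto

lemma tangent_ext_tangent:
  assumes "x \<in> sphere 0 R" "R > 0"
  shows "tangent_ext R w x \<bullet> x = 0"
  using assms by (auto simp: tangent_ext_def inner_diff_left dot_square_norm)

text \<open>For \<open>x\<close> on the sphere the derivative in tangent directions is the Hessian of \<open>F\<close> on the sphere, whose trace is \<open>\<Delta>\<^sub>S F\<close>.\<close>

lemma has_derivative_along_tangent_ext:
  assumes F: "twice_derivable F F' F''" and w: "w \<bullet> x = 0"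
  shows "((\<lambda>y. F' y (tangent_ext R w y)) has_derivative
           (\<lambda>u. F'' x u w - ((w \<bullet> u) / R\<^sup>2) *\<^sub>R F' x x)) (at x)"
proof -
  note D = twice_derivableD[OF F]
  \<comment> \<open>The derivative of \<open>y \<mapsto> F' y y\<close> is accessible only after expanding the second argument in a basis.\<close>
  have lin: "F' y (tangent_ext R w y) = F' y w - ((w \<bullet> y) / R\<^sup>2) *\<^sub>R (\<Sum>i\<in>Basis. (y \<bullet> i) *\<^sub>R F' y i)" for y
  proof -
    have "(\<Sum>i\<in>Basis. (y \<bullet> i) *\<^sub>R F' y i) = F' y (\<Sum>i\<in>Basis. (y \<bullet> i) *\<^sub>R i)"
      by (simp add: linear_sum[OF D(3)] linear_cmul[OF D(3)])
    then show ?thesis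
      by (simp add: euclidean_representation tangent_ext_def linear_diff[OF D(3)] linear_cmul[OF D(3)])
  qed
  have Fx: "(\<Sum>i\<in>Basis. (x \<bullet> i) *\<^sub>R F' x i) = F' x x"
    using linear_sum[OF D(3)[of x], of "\<lambda>i. (x \<bullet> i) *\<^sub>R i" Basis]
    by (simp add: linear_cmul[OF D(3)] euclidean_representation)
  have d: "((\<lambda>y. \<Sum>i\<in>Basis. (y \<bullet> i) *\<^sub>R F' y i) has_derivative
     (\<lambda>v. \<Sum>i\<in>Basis. (x \<bullet> i) *\<^sub>R F'' x v i + (v \<bullet> i) *\<^sub>R F' x i)) (at x)"
    by (intro has_derivative_sum has_derivative_scaleR D has_derivative_inner_left has_derivative_ident)
  show ?thesis
    unfolding lin
    by (rule has_derivative_eq_rhs[OF has_derivative_diff[OF D(2) has_derivative_scaleR[OF has_derivative_inner_over d]]])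
      (simp add: w Fx)
qed

lemma derivative_zero_on_sphere:
  fixes g :: "'a::euclidean_space \<Rightarrow> 'b::euclidean_space"
  assumes x: "x \<in> sphere 0 R" and R: "R > 0" and u: "u \<bullet> x = 0"
    and g: "(g has_derivative g') (at x)" and "\<And>y. y \<in> sphere 0 R \<Longrightarrow> g y = 0"
  shows "g' u = 0"
proof -
  have "sdiff R g x u = g' u"
    by (rule sdiff_eq[OF x R u refl g])
  moreover have "sdiff R g x u = 0"
    by (rule sdiff_eq[OF x R u assms(5) has_derivative_const])
  ultimately show ?thesis by simp
qed

text \<open>In what follows \<open>\<phi>\<close> is a map into the unit sphere that agrees on the sphere of radius \<open>R\<close> with a map
  \<open>\<Phi>\<close> defined and differentiable on the whole ambient space. Likewise a section \<open>V\<close> comes with an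
  extension \<open>F\<close>.\<close>

context
  fixes R :: real and \<phi> \<Phi> :: "'a::euclidean_space \<Rightarrow> 'b::euclidean_space" and \<Phi>' \<Phi>''
  assumes R: "R > 0"
    and \<Phi>: "twice_derivable \<Phi> \<Phi>' \<Phi>''"
    and \<phi>: "\<And>y. y \<in> sphere 0 R \<Longrightarrow> \<phi> y = \<Phi> y"
    and unit: "\<And>y. y \<in> sphere 0 R \<Longrightarrow> norm (\<Phi> y) = 1"
begin

lemma sdiff_phi:
  assumes x: "x \<in> sphere 0 R" and u: "u \<bullet> x = 0"
  shows "sdiff R \<phi> x u = \<Phi>' x u"
  by (rule sdiff_eq[OF x R u \<phi> twice_derivableD(1)[OF \<Phi>]])

lemma inner_phi_dphi:
  assumes x: "x \<in> sphere 0 R" and u: "u \<bullet> x = 0"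
  shows "\<Phi> x \<bullet> \<Phi>' x u = 0"
proof -
  have "((\<lambda>y. \<Phi> y \<bullet> \<Phi> y - 1) has_derivative (\<lambda>u. \<Phi> x \<bullet> \<Phi>' x u + \<Phi>' x u \<bullet> \<Phi> x)) (at x)"
    by (auto intro!: derivative_eq_intros twice_derivableD(1)[OF \<Phi>])
  from derivative_zero_on_sphere[OF x R u this] show ?thesis
    using unit by (simp add: norm_eq_1 inner_commute)
qed

lemma pullback_conn_eq:
  assumes x: "x \<in> sphere 0 R" and u: "u \<bullet> x = 0"
    and V: "\<And>y. y \<in> sphere 0 R \<Longrightarrow> V y = F y" and F: "(F has_derivative F') (at x)"
  shows "pullback_conn R \<phi> V x u = unit_perp (\<Phi> x) (F' u)"
  using sdiff_eq[OF x R u V F] \<phi>[OF x] by (simp add: pullback_conn_def unit_perp_def)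

lemma levi_civita_tangent_ext:
  assumes x: "x \<in> sphere 0 R" and u: "u \<bullet> x = 0" and w: "w \<bullet> x = 0"
  shows "levi_civita R (tangent_ext R w) x u = 0"
proof -
  have "(tangent_ext R w has_derivative (\<lambda>u. - ((w \<bullet> u) / R\<^sup>2) *\<^sub>R x)) (at x)"
    unfolding tangent_ext_def
    by (rule has_derivative_eq_rhs[OF has_derivative_diff[OF has_derivative_const
          has_derivative_scaleR[OF has_derivative_inner_over has_derivative_ident]]]) (simp add: w)
  then have "sdiff R (tangent_ext R w) x u = - ((w \<bullet> u) / R\<^sup>2) *\<^sub>R x"
    by (rule sdiff_eq[OF x R u refl])
  then show ?thesis using x R by (simp add: levi_civita_def dot_square_norm)
qed

lemma derivative_section_inner_phi:
  assumes x: "x \<in> sphere 0 R" and u: "u \<bullet> x = 0"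
    and F: "(F has_derivative F') (at x)"
    and perp: "\<And>y. y \<in> sphere 0 R \<Longrightarrow> F y \<bullet> \<Phi> y = 0"
  shows "F' u \<bullet> \<Phi> x = - (F x \<bullet> \<Phi>' x u)"
proof -
  have "((\<lambda>y. F y \<bullet> \<Phi> y) has_derivative (\<lambda>u. F x \<bullet> \<Phi>' x u + F' u \<bullet> \<Phi> x)) (at x)"
    by (intro has_derivative_inner F twice_derivableD(1)[OF \<Phi>])
  from derivative_zero_on_sphere[OF x R u this] perp show ?thesis by simp
qed

lemma pullback_conn_along_tangent_ext:
  assumes x: "x \<in> sphere 0 R" and u: "u \<bullet> x = 0" and w: "w \<bullet> x = 0"
    and F: "twice_derivable F F' F''"
    and V: "\<And>y. y \<in> sphere 0 R \<Longrightarrow> V y = F' y (tangent_ext R w y)"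
  shows "pullback_conn R \<phi> V x u = unit_perp (\<Phi> x) (F'' x u w - ((u \<bullet> w) / R\<^sup>2) *\<^sub>R F' x x)"
  using pullback_conn_eq[OF x u V has_derivative_along_tangent_ext[OF F w]]
  by (simp add: inner_commute)

lemma second_cov_deriv_eq:
  assumes x: "x \<in> sphere 0 R" and u: "u \<bullet> x = 0" and w: "w \<bullet> x = 0"
    and V: "\<And>y. y \<in> sphere 0 R \<Longrightarrow> V y = F y" and F: "twice_derivable F F' F''"
    and perp: "\<And>y. y \<in> sphere 0 R \<Longrightarrow> F y \<bullet> \<Phi> y = 0"
  shows "second_cov_deriv R \<phi> V x u w =
    unit_perp (\<Phi> x) (F'' x u w - ((u \<bullet> w) / R\<^sup>2) *\<^sub>R F' x x) + (V x \<bullet> \<Phi>' x w) *\<^sub>R \<Phi>' x u"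
proof -
  define G where "G y = F' y (tangent_ext R w y)" for y
  define G' where "G' u = F'' x u w - ((w \<bullet> u) / R\<^sup>2) *\<^sub>R F' x x" for u
  note D\<Phi> = twice_derivableD[OF \<Phi>]
  have G: "(G has_derivative G') (at x)"
    unfolding G_def[abs_def] G'_def by (rule has_derivative_along_tangent_ext[OF F w])
  have first: "pullback_conn R \<phi> V y (tangent_ext R w y) = G y - (G y \<bullet> \<Phi> y) *\<^sub>R \<Phi> y"
    if y: "y \<in> sphere 0 R" for y
    using pullback_conn_eq[OF y tangent_ext_tangent[OF y R] V twice_derivableD(1)[OF F]]
    by (simp add: unit_perp_def G_def)
  have "((\<lambda>y. G y - (G y \<bullet> \<Phi> y) *\<^sub>R \<Phi> y) has_derivative
      (\<lambda>u. G' u - ((G x \<bullet> \<Phi> x) *\<^sub>R \<Phi>' x u + (G x \<bullet> \<Phi>' x u + G' u \<bullet> \<Phi> x) *\<^sub>R \<Phi> x))) (at x)"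
    by (intro has_derivative_diff has_derivative_scaleR has_derivative_inner G D\<Phi>(1))
  from pullback_conn_eq[OF x u first this]
  have A: "pullback_conn R \<phi> (\<lambda>y. pullback_conn R \<phi> V y (tangent_ext R w y)) x u =
    unit_perp (\<Phi> x) (G' u - ((G x \<bullet> \<Phi> x) *\<^sub>R \<Phi>' x u + (G x \<bullet> \<Phi>' x u + G' u \<bullet> \<Phi> x) *\<^sub>R \<Phi> x))"
    by simp
  have n1: "\<Phi> x \<bullet> \<Phi> x = 1" using unit[OF x] by (simp add: norm_eq_1)
  have n2: "\<Phi>' x u \<bullet> \<Phi> x = 0" using inner_phi_dphi[OF x u] by (simp add: inner_commute)
  have Gx: "G x = F' x w" using w by (simp add: G_def tangent_ext_def)
  have "F' x w \<bullet> \<Phi> x = - (F x \<bullet> \<Phi>' x w)"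
    by (rule derivative_section_inner_phi[OF x w twice_derivableD(1)[OF F] perp])
  then have Gp: "G x \<bullet> \<Phi> x = - (V x \<bullet> \<Phi>' x w)" using Gx V[OF x] by simp
  have B: "pullback_conn R \<phi> V x (levi_civita R (tangent_ext R w) x u) = 0"
    using pullback_conn_eq[OF x _ V twice_derivableD(1)[OF F], of 0] linear_0[OF twice_derivableD(3)[OF F]]
    by (simp add: levi_civita_tangent_ext[OF x u w] unit_perp_def)
  show ?thesis
    unfolding second_cov_deriv_def A B Gp
    by (simp add: unit_perp_def n1 n2 algebra_simps G'_def inner_commute[of w u])
qed

lemma tangent_trace_second_derivative:
  fixes F :: "'a \<Rightarrow> 'c::euclidean_space"
  assumes x: "x \<in> sphere 0 R" and F: "twice_derivable F F' F''"
  shows "tangent_trace x (\<lambda>u w. F'' x u w - ((u \<bullet> w) / R\<^sup>2) *\<^sub>R F' x x) = sphere_laplacian R F' F'' x"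
proof -
  note D = twice_derivableD[OF F]
  have xx: "x \<bullet> x = R\<^sup>2" using x by (auto simp: dot_square_norm)
  have "tangent_trace x (\<lambda>u w. F'' x u w - ((u \<bullet> w) / R\<^sup>2) *\<^sub>R F' x x) =
    (\<Sum>i\<in>Basis. F'' x i i - ((i \<bullet> i) / R\<^sup>2) *\<^sub>R F' x x) - (1 / (x \<bullet> x)) *\<^sub>R (F'' x x x - ((x \<bullet> x) / R\<^sup>2) *\<^sub>R F' x x)"
    by (intro tangent_trace_bilinear sphere_nonzero[OF R x] refl linearI)
     (simp_all add: linear_add[OF D(4)] linear_add[OF D(5)] linear_cmul[OF D(4)] linear_cmul[OF D(5)]
        inner_add_left inner_add_right algebra_simps add_divide_distrib)
  also have "(\<Sum>i\<in>(Basis::'a set). F'' x i i - ((i \<bullet> i) / R\<^sup>2) *\<^sub>R F' x x) =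
    (\<Sum>i\<in>Basis. F'' x i i) - (real DIM('a) / R\<^sup>2) *\<^sub>R F' x x"
  proof -
    have "(\<Sum>i\<in>(Basis::'a set). ((i \<bullet> i) / R\<^sup>2) *\<^sub>R F' x x) = (\<Sum>i\<in>(Basis::'a set). (1 / R\<^sup>2) *\<^sub>R F' x x)"
      by (intro sum.cong) auto
    then show ?thesis by (simp add: sum_subtractf sum_constant_scaleR)
  qed
  finally show ?thesis
    using R by (simp add: sphere_laplacian_def xx algebra_simps diff_divide_distrib)
qed

lemma tangential_part_eq:
  assumes x: "x \<in> sphere 0 R"
  shows "tangential_part R \<phi> V x = tangent_trace x (\<lambda>u w. (V x \<bullet> \<Phi>' x u) *\<^sub>R \<Phi>' x w)"
  unfolding tangential_part_def by (rule tangent_trace_cong) (simp add: sdiff_phi[OF x])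

proposition rough_laplacian_eq:
  assumes x: "x \<in> sphere 0 R"
    and V: "\<And>y. y \<in> sphere 0 R \<Longrightarrow> V y = F y" and F: "twice_derivable F F' F''"
    and perp: "\<And>y. y \<in> sphere 0 R \<Longrightarrow> F y \<bullet> \<Phi> y = 0"
  shows "rough_laplacian R \<phi> V x =
    - unit_perp (\<Phi> x) (sphere_laplacian R F' F'' x) - tangential_part R \<phi> V x"
proof -
  have sc: "second_cov_deriv R \<phi> V x u u = unit_perp (\<Phi> x) (F'' x u u - ((u \<bullet> u) / R\<^sup>2) *\<^sub>R F' x x)
      + (V x \<bullet> \<Phi>' x u) *\<^sub>R \<Phi>' x u" if u: "u \<bullet> x = 0" for u
    by (rule second_cov_deriv_eq[OF x u u V F perp])
  have "tangent_trace x (second_cov_deriv R \<phi> V x) =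
    tangent_trace x (\<lambda>u w. unit_perp (\<Phi> x) (F'' x u w - ((u \<bullet> w) / R\<^sup>2) *\<^sub>R F' x x)
      + (V x \<bullet> \<Phi>' x u) *\<^sub>R \<Phi>' x w)"
    by (rule tangent_trace_cong) (rule sc)
  also have "\<dots> = unit_perp (\<Phi> x) (sphere_laplacian R F' F'' x) + tangential_part R \<phi> V x"
    unfolding tangent_trace_add tangential_part_eq[OF x]
    by (simp add: tangent_trace_linear[OF linear_unit_perp] tangent_trace_second_derivative[OF x F])
  finally show ?thesis by (simp add: rough_laplacian_def)
qed

proposition tension_eq:
  assumes x: "x \<in> sphere 0 R"
  shows "tension R \<phi> x = unit_perp (\<Phi> x) (sphere_laplacian R \<Phi>' \<Phi>'' x)"
proof -
  have sf: "second_fundamental_form R \<phi> x u u =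
      unit_perp (\<Phi> x) (\<Phi>'' x u u - ((u \<bullet> u) / R\<^sup>2) *\<^sub>R \<Phi>' x x)" if u: "u \<bullet> x = 0" for u
  proof -
    have "sdiff R \<phi> x (levi_civita R (tangent_ext R u) x u) = 0"
      using sdiff_phi[OF x, of 0] linear_0[OF twice_derivableD(3)[OF \<Phi>]]
      by (simp add: levi_civita_tangent_ext[OF x u u])
    moreover have "sdiff R \<phi> y (tangent_ext R u y) = \<Phi>' y (tangent_ext R u y)" if y: "y \<in> sphere 0 R" for y
      by (rule sdiff_phi[OF y tangent_ext_tangent[OF y R]])
    ultimately show ?thesis
      unfolding second_fundamental_form_def
      using pullback_conn_along_tangent_ext[OF x u u \<Phi>] by simp
  qed
  have "tension R \<phi> x = tangent_trace x (\<lambda>u w. unit_perp (\<Phi> x) (\<Phi>'' x u w - ((u \<bullet> w) / R\<^sup>2) *\<^sub>R \<Phi>' x x))"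
    unfolding tension_def by (rule tangent_trace_cong) (rule sf)
  then show ?thesis
    by (simp add: tangent_trace_linear[OF linear_unit_perp] tangent_trace_second_derivative[OF x \<Phi>])
qed

text \<open>For a section \<open>V\<close> the function \<open>\<langle>V, \<phi>\<rangle>\<close> vanishes on the sphere, and therefore so does its Laplacian
  \<open>\<langle>\<Delta>\<^sub>S V, \<phi>\<rangle> + 2 \<langle>dV, d\<phi>\<rangle> + \<langle>V, \<Delta>\<^sub>S \<phi>\<rangle>\<close>.\<close>

proposition inner_dphi_eq:
  assumes x: "x \<in> sphere 0 R"
    and V: "\<And>y. y \<in> sphere 0 R \<Longrightarrow> V y = F y" and F: "twice_derivable F F' F''"
    and perp: "\<And>y. y \<in> sphere 0 R \<Longrightarrow> F y \<bullet> \<Phi> y = 0"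
  shows "inner_dphi R \<phi> V x =
    - (sphere_laplacian R F' F'' x \<bullet> \<Phi> x + F x \<bullet> sphere_laplacian R \<Phi>' \<Phi>'' x) / 2"
proof -
  let ?T = "\<lambda>(F' :: 'a \<Rightarrow> 'a \<Rightarrow> 'b) F'' u w. F'' x u w - ((u \<bullet> w) / R\<^sup>2) *\<^sub>R F' x x"
  have "0 = tangent_trace x (\<lambda>u w. (?T F' F'' u w \<bullet> \<Phi> x + F x \<bullet> ?T \<Phi>' \<Phi>'' u w)
          + 2 *\<^sub>R (F' x u \<bullet> \<Phi>' x w))"
  proof -
    have "(?T F' F'' u u \<bullet> \<Phi> x + F x \<bullet> ?T \<Phi>' \<Phi>'' u u) + 2 *\<^sub>R (F' x u \<bullet> \<Phi>' x u) = 0"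
      if u: "u \<bullet> x = 0" for u
    proof -
      \<comment> \<open>This function is the derivative of \<open>\<langle>F, \<Phi>\<rangle>\<close> along the tangent field, hence zero on the sphere.\<close>
      let ?g = "\<lambda>y. F' y (tangent_ext R u y) \<bullet> \<Phi> y + F y \<bullet> \<Phi>' y (tangent_ext R u y)"
      have "(?g has_derivative (\<lambda>v. (F' x (tangent_ext R u x) \<bullet> \<Phi>' x v
            + (F'' x v u - ((u \<bullet> v) / R\<^sup>2) *\<^sub>R F' x x) \<bullet> \<Phi> x)
          + (F x \<bullet> (\<Phi>'' x v u - ((u \<bullet> v) / R\<^sup>2) *\<^sub>R \<Phi>' x x) + F' x v \<bullet> \<Phi>' x (tangent_ext R u x)))) (at x)"
        by (intro has_derivative_add has_derivative_inner has_derivative_along_tangent_ext[OF F u] has_derivative_along_tangent_ext[OF \<Phi> u]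
            twice_derivableD(1)[OF F] twice_derivableD(1)[OF \<Phi>])
      from derivative_zero_on_sphere[OF x R u this] have
        "(F' x (tangent_ext R u x) \<bullet> \<Phi>' x u
            + (F'' x u u - ((u \<bullet> u) / R\<^sup>2) *\<^sub>R F' x x) \<bullet> \<Phi> x)
          + (F x \<bullet> (\<Phi>'' x u u - ((u \<bullet> u) / R\<^sup>2) *\<^sub>R \<Phi>' x x) + F' x u \<bullet> \<Phi>' x (tangent_ext R u x)) = 0"
        using derivative_section_inner_phi[OF _ tangent_ext_tangent[OF _ R] twice_derivableD(1)[OF F] perp]
        by auto
      moreover have "tangent_ext R u x = u" using u by (simp add: tangent_ext_def)
      ultimately show ?thesis by simp
    qed
    then have "tangent_trace x (\<lambda>u w. (?T F' F'' u w \<bullet> \<Phi> x + F x \<bullet> ?T \<Phi>' \<Phi>'' u w)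
          + 2 *\<^sub>R (F' x u \<bullet> \<Phi>' x w)) = tangent_trace x (\<lambda>_ _. 0)"
      by (rule tangent_trace_cong)
    then show ?thesis
      by (simp add: tangent_trace_def)
  qed
  also have "\<dots> = (sphere_laplacian R F' F'' x \<bullet> \<Phi> x + F x \<bullet> sphere_laplacian R \<Phi>' \<Phi>'' x)
      + 2 * tangent_trace x (\<lambda>u w. F' x u \<bullet> \<Phi>' x w)"
    unfolding tangent_trace_add
    by (subst tangent_trace_linear[of "\<lambda>v. v \<bullet> \<Phi> x"] tangent_trace_linear[of "\<lambda>v. F x \<bullet> v"] tangent_trace_linear[of "\<lambda>v. 2 *\<^sub>R v"],
       (auto intro!: linearI simp: inner_add_left inner_add_right algebra_simps)[1])+
      (simp add: tangent_trace_second_derivative[OF x F] tangent_trace_second_derivative[OF x \<Phi>])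
  also have "tangent_trace x (\<lambda>u w. F' x u \<bullet> \<Phi>' x w) = inner_dphi R \<phi> V x"
  proof -
    have "F' x u \<bullet> \<Phi>' x u = pullback_conn R \<phi> V x u \<bullet> sdiff R \<phi> x u" if u: "u \<bullet> x = 0" for u
    proof -
      have "pullback_conn R \<phi> V x u = unit_perp (\<Phi> x) (F' x u)"
        by (rule pullback_conn_eq[OF x u V twice_derivableD(1)[OF F]])
      then show ?thesis
        by (simp add: sdiff_phi[OF x u] unit_perp_def inner_diff_left inner_phi_dphi[OF x u])
    qed
    then show ?thesis
      unfolding inner_dphi_def by (rule tangent_trace_cong)
  qed
  finally show ?thesis by simp
qed

end

section \<open>The polarised Veronese map and a family of sections\<close>

lemma sum_Pair: "(\<Sum>i\<in>I. (g i, k i)) = (sum g I, sum k I)"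
  by (intro prod_eqI) (simp_all add: fst_sum snd_sum)

lemma eq_if_inner_eq: "(\<And>z. v \<bullet> z = w \<bullet> z) \<Longrightarrow> v = w"
  using vector_eq_rdot by blast

lemma lincomb4_eq:
  fixes v1 v2 v3 v4 :: "'a::real_vector"
  shows "a1 = c1 \<Longrightarrow> a2 = c2 \<Longrightarrow> a3 = c3 \<Longrightarrow> a4 = c4 \<Longrightarrow>
    a1 *\<^sub>R v1 + a2 *\<^sub>R v2 + a3 *\<^sub>R v3 + a4 *\<^sub>R v4 = c1 *\<^sub>R v1 + c2 *\<^sub>R v2 + c3 *\<^sub>R v3 + c4 *\<^sub>R v4"
  by simp

text \<open>The polarised Veronese map: up to a linear isometry, \<open>Q x y\<close> is a multiple of the trace-free
  part of the symmetrised product \<open>x y\<^sup>T\<close>. Its inner products (\<open>Q_inner\<close>) and the fact that it is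
  harmonic (\<open>Q_trace\<close>) are all that is needed; \<open>\<kappa>\<close> is the curvature of the domain, and \<open>r\<close> is the last
  coordinate \<open>1 / sqrt 2\<close> of the tropical inclusion.\<close>

locale veronese_form =
  fixes Q :: "'a::euclidean_space \<Rightarrow> 'a \<Rightarrow> 'b::euclidean_space" and m R \<kappa> r :: real
  assumes bilinear_Q: "bounded_bilinear Q"
    and Q_sym: "Q x y = Q y x"
    and Q_inner: "Q x y \<bullet> Q z w = \<kappa> / 2 * (((x \<bullet> z) * (y \<bullet> w) + (x \<bullet> w) * (y \<bullet> z)) / 2 - (x \<bullet> y) * (z \<bullet> w) / (m + 1))"
    and Q_trace: "(\<Sum>i\<in>Basis. Q i i) = 0"
    and dim: "real DIM('a) = m + 1"
    and m_pos: "m > 0" and R_pos: "R > 0"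
    and R_square: "R\<^sup>2 = (m + 1) / m" and kappa: "\<kappa> = m / (m + 1)" and r_square: "r * r = 1 / 2"
begin

sublocale Q: bounded_bilinear Q
  by (rule bilinear_Q)

text \<open>The polynomial extension of \<open>\<phi>\<close> and its derivatives.\<close>

definition \<Phi> :: "'a \<Rightarrow> 'b \<times> real" where "\<Phi> x = (Q x x, r)"
definition \<Phi>' :: "'a \<Rightarrow> 'a \<Rightarrow> 'b \<times> real" where "\<Phi>' x u = (2 *\<^sub>R Q x u, 0)"
definition \<Phi>'' :: "'a \<Rightarrow> 'a \<Rightarrow> 'a \<Rightarrow> 'b \<times> real" where "\<Phi>'' x v u = (2 *\<^sub>R Q v u, 0)"

lemma m_nonzero: "m \<noteq> 0" "m + 1 \<noteq> 0" "1 + m \<noteq> 0"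
  using m_pos by auto

lemma kappa_R_square: "\<kappa> * R\<^sup>2 = 1" "R\<^sup>2 * \<kappa> = 1" "1 / R\<^sup>2 = \<kappa>" "m / R\<^sup>2 = m * \<kappa>"
proof -
  show 1: "\<kappa> * R\<^sup>2 = 1"
    unfolding kappa R_square using m_nonzero by simp
  then show 2: "R\<^sup>2 * \<kappa> = 1"
    by (simp add: mult.commute)
  show 3: "1 / R\<^sup>2 = \<kappa>"
    unfolding kappa R_square by simp
  then show "m / R\<^sup>2 = m * \<kappa>"
    by (metis times_divide_eq_right mult.right_neutral)
qed

lemma kappa_R_cancel: "\<kappa> * (R\<^sup>2 * c) = c" "R\<^sup>2 * (\<kappa> * c) = c"
  using kappa_R_square by (simp_all flip: mult.assoc)

lemma m_kappa: "m * \<kappa> = m - \<kappa>"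
  using m_nonzero by (simp add: kappa field_simps)

lemma sphere_inner: "x \<in> sphere 0 R \<Longrightarrow> x \<bullet> x = R\<^sup>2"
  by (auto simp: dot_square_norm)

lemma linear_Q: "linear (Q x)" "linear (\<lambda>u. Q u y)"
  by (rule bounded_linear.linear, rule Q.bounded_linear_right)
    (rule bounded_linear.linear, rule Q.bounded_linear_left)

lemma linear_Phi': "linear (\<Phi>' x)"
  unfolding \<Phi>'_def by (auto intro!: linearI simp: Q.add_right Q.scaleR_right algebra_simps)

lemma twice_derivable_Phi: "twice_derivable \<Phi> \<Phi>' \<Phi>''"
  unfolding twice_derivable_def
proof (intro conjI allI)
  fix x u v :: 'a
  have "((\<lambda>x. Q x x) has_derivative (\<lambda>u. Q x u + Q u x)) (at x)"
    by (rule Q.FDERIV[OF has_derivative_ident has_derivative_ident])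
  then show "(\<Phi> has_derivative \<Phi>' x) (at x)"
    unfolding \<Phi>_def \<Phi>'_def
    by (intro has_derivative_Pair has_derivative_const) (simp add: Q_sym[of _ x] scaleR_2)
  have "((\<lambda>y. 2 *\<^sub>R Q y u) has_derivative (\<lambda>v. 2 *\<^sub>R Q v u)) (at x)"
    by (intro has_derivative_scaleR_right bounded_linear_imp_has_derivative Q.bounded_linear_left)
  then show "((\<lambda>y. \<Phi>' y u) has_derivative (\<lambda>v. \<Phi>'' x v u)) (at x)"
    unfolding \<Phi>'_def \<Phi>''_def by (intro has_derivative_Pair has_derivative_const)
  show "linear (\<Phi>'' x v)"
    unfolding \<Phi>''_def by (auto intro!: linearI simp: Q.add_right Q.scaleR_right algebra_simps)
qed

lemma inner_Q_sphere:
  assumes x: "x \<in> sphere 0 R"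
  shows "Q x x \<bullet> Q x x = 1 / 2"
    and "Q x y \<bullet> Q x x = \<kappa> / 2 * (x \<bullet> y)" "Q x x \<bullet> Q x y = \<kappa> / 2 * (x \<bullet> y)"
proof -
  have "(m + 1) / m - (m + 1) / m / (m + 1) = (m + 1) / m - 1 / m"
    using m_nonzero by simp
  then have "(m + 1) / m - (m + 1) / m / (m + 1) = 1"
    using m_nonzero by (simp add: add_divide_distrib)
  then have "(x \<bullet> x) - (x \<bullet> x) / (m + 1) = 1"
    by (simp add: sphere_inner[OF x] R_square)
  then have *: "(x \<bullet> x) * (y \<bullet> x) - (x \<bullet> y) * (x \<bullet> x) / (m + 1) = x \<bullet> y" for y
    using distrib_left[of "x \<bullet> y" "x \<bullet> x" "- (x \<bullet> x) / (m + 1)"]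
    by (simp add: inner_commute[of y x] mult.commute)
  have "\<kappa> / 2 * ((x \<bullet> x) * (y \<bullet> x) - (x \<bullet> y) * (x \<bullet> x) / (m + 1)) = \<kappa> / 2 * (x \<bullet> y)" for y
    unfolding * ..
  then show *: "Q x y \<bullet> Q x x = \<kappa> / 2 * (x \<bullet> y)" for y
    by (simp add: Q_inner)
  then show "Q x x \<bullet> Q x y = \<kappa> / 2 * (x \<bullet> y)" by (subst inner_commute)
  show "Q x x \<bullet> Q x x = 1 / 2"
    using kappa_R_square by (simp add: * sphere_inner[OF x])
qed

lemma norm_Phi: "x \<in> sphere 0 R \<Longrightarrow> norm (\<Phi> x) = 1"
  by (simp add: norm_eq_1 \<Phi>_def inner_Pair inner_Q_sphere r_square)

lemma sphere_laplacian_Phi: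
  "sphere_laplacian R \<Phi>' \<Phi>'' x = (- (2 * m) *\<^sub>R Q x x, 0)"
proof -
  have "(\<Sum>i\<in>Basis. \<Phi>'' x i i) = 0"
    by (simp add: \<Phi>''_def sum_Pair sum_distrib_left scaleR_sum_right[symmetric] Q_trace zero_prod_def)
  moreover have "- (\<kappa> * 2) - m * \<kappa> * 2 = - (2 * m)"
    using m_kappa by simp
  ultimately show ?thesis
    by (simp add: sphere_laplacian_def dim kappa_R_square \<Phi>'_def \<Phi>''_def zero_prod_def
        scaleR_left.diff[symmetric] flip: scaleR_minus_left)
qed

end

text \<open>A linear function \<open>f\<close> and a harmonic quadratic form \<open>h\<close> are fixed, given by the vector \<open>b\<close> and the
  self-adjoint operator \<open>A\<close> of trace zero.\<close>

locale veronese_fields = veronese_form Q m R \<kappa> r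
  for Q :: "'a::euclidean_space \<Rightarrow> 'a \<Rightarrow> 'b::euclidean_space" and m R \<kappa> r +
  fixes b :: 'a and A :: "'a \<Rightarrow> 'a"
  assumes linear_A: "linear A"
    and A_self: "A x \<bullet> y = x \<bullet> A y"
    and A_trace: "(\<Sum>i\<in>Basis. i \<bullet> A i) = 0"
begin

definition f :: "'a \<Rightarrow> real" where "f x = b \<bullet> x"
definition h :: "'a \<Rightarrow> real" where "h x = x \<bullet> A x"
text \<open>The vector \<open>K\<close> corresponds to the matrix \<open>A\<close> itself: up to a constant, \<open>h x\<close> is \<open>K \<bullet> Q x x\<close>.\<close>

definition K :: 'b where "K = (\<Sum>i\<in>Basis. Q i (A i))"

text \<open>The six-parameter family of sections. The parameters are the coefficients of \<open>\<eta>\<close>, \<open>f \<eta>\<close>,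
  \<open>d\<phi>(grad f)\<close>, \<open>h \<eta>\<close>, \<open>(R\<^sup>2 / 4) d\<phi>(grad h)\<close> and of the projection of \<open>(K, 0)\<close> to the tangent spaces
  of the small sphere. The last one appears in the Laplacian of \<open>d\<phi>(grad h)\<close>. The definitions of
  \<open>field'\<close> and \<open>field''\<close> give the first two derivatives.\<close>

definition field :: "real \<Rightarrow> real \<Rightarrow> real \<Rightarrow> real \<Rightarrow> real \<Rightarrow> real \<Rightarrow> 'a \<Rightarrow> 'b \<times> real" where
  "field p0 p1 p2 q1 q2 q3 x =
    ((p0 + p1 * f x + q1 * h x) *\<^sub>R Q x x + p2 *\<^sub>R (2 *\<^sub>R Q x b - (2 * \<kappa> * f x) *\<^sub>R Q x x)
       + q2 *\<^sub>R (R\<^sup>2 *\<^sub>R Q x (A x) - h x *\<^sub>R Q x x) + q3 *\<^sub>R (K - (\<kappa> * h x) *\<^sub>R Q x x),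
     - (p0 + p1 * f x + q1 * h x) * r)"

definition field' :: "real \<Rightarrow> real \<Rightarrow> real \<Rightarrow> real \<Rightarrow> real \<Rightarrow> real \<Rightarrow> 'a \<Rightarrow> 'a \<Rightarrow> 'b \<times> real" where
  "field' p0 p1 p2 q1 q2 q3 x u = (let c1 = p1 - 2 * \<kappa> * p2; c2 = q1 - q2 - \<kappa> * q3 in
    ((c1 * (b \<bullet> u) + 2 * c2 * (u \<bullet> A x)) *\<^sub>R Q x x + (p0 + c1 * f x + c2 * h x) *\<^sub>R (Q x u + Q u x)
       + (2 * p2) *\<^sub>R Q u b + (q2 * R\<^sup>2) *\<^sub>R (Q u (A x) + Q x (A u)),
     - (p1 * (b \<bullet> u) + 2 * q1 * (u \<bullet> A x)) * r))"

definition field'' :: "real \<Rightarrow> real \<Rightarrow> real \<Rightarrow> real \<Rightarrow> real \<Rightarrow> real \<Rightarrow> 'a \<Rightarrow> 'a \<Rightarrow> 'a \<Rightarrow> 'b \<times> real" where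
  "field'' p0 p1 p2 q1 q2 q3 x v u = (let c1 = p1 - 2 * \<kappa> * p2; c2 = q1 - q2 - \<kappa> * q3 in
    ((2 * c2 * (u \<bullet> A v)) *\<^sub>R Q x x + (c1 * (b \<bullet> u) + 2 * c2 * (u \<bullet> A x)) *\<^sub>R (Q x v + Q v x)
       + (c1 * (b \<bullet> v) + 2 * c2 * (v \<bullet> A x)) *\<^sub>R (Q x u + Q u x) + (p0 + c1 * f x + c2 * h x) *\<^sub>R (Q v u + Q u v)
       + (q2 * R\<^sup>2) *\<^sub>R (Q u (A v) + Q v (A u)),
     - (2 * q1 * (u \<bullet> A v)) * r))"

lemma bounded_linear_A: "bounded_linear A"
  using linear_A by (rule linear_conv_bounded_linear[THEN iffD1])

lemma A_swap: "x \<bullet> A y = y \<bullet> A x"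
  by (subst A_self[symmetric], subst inner_commute) (rule refl)

lemma A_simps: "A (x + y) = A x + A y" "A (c *\<^sub>R x) = c *\<^sub>R A x"
  by (rule linear_add[OF linear_A], rule linear_cmul[OF linear_A])

text \<open>The same section sorted by the monomials \<open>Q x x\<close>, \<open>Q x b\<close>, \<open>Q x (A x)\<close> and \<open>K\<close>, in which vector
  identities are checked coefficient by coefficient.\<close>

lemma field_expand:
  "field p0 p1 p2 q1 q2 q3 x = (let c1 = p1 - 2 * \<kappa> * p2; c2 = q1 - q2 - \<kappa> * q3 in
    ((p0 + c1 * f x + c2 * h x) *\<^sub>R Q x x + (2 * p2) *\<^sub>R Q x b + (q2 * R\<^sup>2) *\<^sub>R Q x (A x) + q3 *\<^sub>R K,
     - (p0 + p1 * f x + q1 * h x) * r))"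
  unfolding field_def Let_def
  by (rule prod_eqI; simp) (rule eq_if_inner_eq; simp add: inner_add_left inner_diff_left algebra_simps)

lemma twice_derivable_field:
  "twice_derivable (field p0 p1 p2 q1 q2 q3) (field' p0 p1 p2 q1 q2 q3) (field'' p0 p1 p2 q1 q2 q3)"
  unfolding twice_derivable_def
proof (intro conjI allI)
  fix x u v :: 'a
  define c1 where "c1 = p1 - 2 * \<kappa> * p2"
  define c2 where "c2 = q1 - q2 - \<kappa> * q3"
  note df = bounded_linear_imp_has_derivative[OF bounded_linear_inner_right[of b], of "at x"]
  note dA = bounded_linear_imp_has_derivative[OF bounded_linear_A, of "at x"]
  note id = has_derivative_ident[of "at x"]
  have dh: "((\<lambda>x. x \<bullet> A x) has_derivative (\<lambda>u. 2 * (u \<bullet> A x))) (at x)"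
    by (rule has_derivative_eq_rhs[OF has_derivative_inner[OF id dA]])
      (simp add: fun_eq_iff A_swap)
  have dhu: "((\<lambda>x. u \<bullet> A x) has_derivative (\<lambda>v. u \<bullet> A v)) (at x)"
    by (rule has_derivative_inner_right[OF dA])
  define s where "s x = p0 + c1 * (b \<bullet> x) + c2 * (x \<bullet> A x)" for x
  have ds: "(s has_derivative (\<lambda>u. c1 * (b \<bullet> u) + 2 * c2 * (u \<bullet> A x))) (at x)"
    unfolding s_def
    by (rule has_derivative_eq_rhs[OF has_derivative_add[OF has_derivative_add[OF has_derivative_const
          has_derivative_mult_right[OF df]] has_derivative_mult_right[OF dh]]])
      (simp add: fun_eq_iff algebra_simps)
  have dt: "((\<lambda>x. - (p0 + p1 * (b \<bullet> x) + q1 * (x \<bullet> A x)) * r) has_derivative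
      (\<lambda>u. - (p1 * (b \<bullet> u) + 2 * q1 * (u \<bullet> A x)) * r)) (at x)"
    by (rule has_derivative_eq_rhs[OF has_derivative_mult_left[OF has_derivative_minus[OF
          has_derivative_add[OF has_derivative_add[OF has_derivative_const
              has_derivative_mult_right[OF df]] has_derivative_mult_right[OF dh]]]]])
      (simp add: fun_eq_iff algebra_simps)
  have "((\<lambda>x. s x *\<^sub>R Q x x + (2 * p2) *\<^sub>R Q x b + (q2 * R\<^sup>2) *\<^sub>R Q x (A x) + q3 *\<^sub>R K) has_derivative
      (\<lambda>u. (c1 * (b \<bullet> u) + 2 * c2 * (u \<bullet> A x)) *\<^sub>R Q x x + s x *\<^sub>R (Q x u + Q u x)
       + (2 * p2) *\<^sub>R Q u b + (q2 * R\<^sup>2) *\<^sub>R (Q u (A x) + Q x (A u)))) (at x)"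
    by (rule has_derivative_eq_rhs[OF has_derivative_add[OF has_derivative_add[OF has_derivative_add[OF
            has_derivative_scaleR[OF ds Q.FDERIV[OF id id]]
            has_derivative_scaleR_right[OF Q.FDERIV[OF id has_derivative_const]]]
            has_derivative_scaleR_right[OF Q.FDERIV[OF id dA]]] has_derivative_const]])
      (simp add: fun_eq_iff Q.zero_right add_ac)
  from has_derivative_Pair[OF this dt]
  show "(field p0 p1 p2 q1 q2 q3 has_derivative field' p0 p1 p2 q1 q2 q3 x) (at x)"
    unfolding field_expand field'_def Let_def c1_def[symmetric] c2_def[symmetric] f_def h_def s_def .
  have da: "((\<lambda>x. c1 * (b \<bullet> u) + 2 * c2 * (u \<bullet> A x)) has_derivative (\<lambda>v. 2 * c2 * (u \<bullet> A v))) (at x)"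
    by (rule has_derivative_eq_rhs[OF has_derivative_add[OF has_derivative_const has_derivative_mult_right[OF dhu]]])
      (simp add: fun_eq_iff)
  have dq: "((\<lambda>x. Q x u + Q u x) has_derivative (\<lambda>v. Q v u + Q u v)) (at x)"
    by (intro has_derivative_add bounded_linear_imp_has_derivative Q.bounded_linear_left Q.bounded_linear_right)
  have dt': "((\<lambda>x. - (p1 * (b \<bullet> u) + 2 * q1 * (u \<bullet> A x)) * r) has_derivative
      (\<lambda>v. - (2 * q1 * (u \<bullet> A v)) * r)) (at x)"
    by (rule has_derivative_eq_rhs[OF has_derivative_mult_left[OF has_derivative_minus[OF
          has_derivative_add[OF has_derivative_const has_derivative_mult_right[OF dhu]]]]])
      (simp add: fun_eq_iff algebra_simps)
  have "((\<lambda>x. (c1 * (b \<bullet> u) + 2 * c2 * (u \<bullet> A x)) *\<^sub>R Q x x + s x *\<^sub>R (Q x u + Q u x)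
       + (2 * p2) *\<^sub>R Q u b + (q2 * R\<^sup>2) *\<^sub>R (Q u (A x) + Q x (A u))) has_derivative
      (\<lambda>v. (2 * c2 * (u \<bullet> A v)) *\<^sub>R Q x x + (c1 * (b \<bullet> u) + 2 * c2 * (u \<bullet> A x)) *\<^sub>R (Q x v + Q v x)
       + (c1 * (b \<bullet> v) + 2 * c2 * (v \<bullet> A x)) *\<^sub>R (Q x u + Q u x) + s x *\<^sub>R (Q v u + Q u v)
       + (q2 * R\<^sup>2) *\<^sub>R (Q u (A v) + Q v (A u)))) (at x)"
    by (rule has_derivative_eq_rhs[OF has_derivative_add[OF has_derivative_add[OF has_derivative_add[OF
            has_derivative_scaleR[OF da Q.FDERIV[OF id id]]
            has_derivative_scaleR[OF ds dq]] has_derivative_const]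
            has_derivative_scaleR_right[OF has_derivative_add[OF Q.FDERIV[OF has_derivative_const dA] Q.FDERIV[OF id has_derivative_const]]]]])
      (simp add: fun_eq_iff Q.zero_right Q.zero_left add_ac)
  from has_derivative_Pair[OF this dt']
  show "((\<lambda>y. field' p0 p1 p2 q1 q2 q3 y u) has_derivative (\<lambda>v. field'' p0 p1 p2 q1 q2 q3 x v u)) (at x)"
    unfolding field'_def field''_def Let_def c1_def[symmetric] c2_def[symmetric] f_def h_def s_def .
  show "linear (field'' p0 p1 p2 q1 q2 q3 x v)"
    unfolding field''_def Let_def c1_def[symmetric] c2_def[symmetric]
    by (auto intro!: linearI simp: A_simps inner_add_left inner_add_right Q.add_left Q.add_right
        Q.scaleR_left Q.scaleR_right algebra_simps)
qed

lemma sum_Basis_Q: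
  "(\<Sum>i\<in>Basis. (b \<bullet> i) *\<^sub>R Q x i) = Q x b" "(\<Sum>i\<in>Basis. (i \<bullet> A x) *\<^sub>R Q x i) = Q x (A x)"
proof -
  have *: "(\<Sum>i\<in>Basis. (z \<bullet> i) *\<^sub>R Q x i) = Q x z" for z
    using linear_sum[OF linear_Q(1)[of x], of "\<lambda>i. (z \<bullet> i) *\<^sub>R i" Basis]
    by (simp add: Q.scaleR_right euclidean_representation)
  show "(\<Sum>i\<in>Basis. (b \<bullet> i) *\<^sub>R Q x i) = Q x b" by (rule *)
  show "(\<Sum>i\<in>Basis. (i \<bullet> A x) *\<^sub>R Q x i) = Q x (A x)"
    using *[of "A x"] by (simp add: inner_commute)
qed

lemma sphere_laplacian_field:
  fixes p0 p1 p2 q1 q2 q3 x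
  defines "c1 \<equiv> p1 - 2 * \<kappa> * p2" and "c2 \<equiv> q1 - q2 - \<kappa> * q3"
  shows "sphere_laplacian R (field' p0 p1 p2 q1 q2 q3) (field'' p0 p1 p2 q1 q2 q3) x =
    ((- (2 * m * p0 + (6 * \<kappa> + 3 * m * \<kappa>) * c1 * f x + (12 * \<kappa> + 4 * m * \<kappa>) * c2 * h x)) *\<^sub>R Q x x
      + (4 * c1 - 2 * m * \<kappa> * p2) *\<^sub>R Q x b + (8 * c2 - 2 * (m + 1) * q2) *\<^sub>R Q x (A x) + (2 * q2 * R\<^sup>2) *\<^sub>R K,
     (m * \<kappa> * p1 * f x + 2 * m * q1 * h x) * r)"
proof -
  have S1: "(\<Sum>i\<in>Basis. (2 * c2 * (i \<bullet> A i)) *\<^sub>R Q x x) = 0"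
    using A_trace by (simp flip: sum_distrib_left scaleR_sum_left)
  have Qix: "Q x i + Q i x = 2 *\<^sub>R Q x i" for i
    using Q_sym[of i x] by (simp add: scaleR_2)
  have S2: "(\<Sum>i\<in>Basis. (c1 * (b \<bullet> i) + 2 * c2 * (i \<bullet> A x)) *\<^sub>R (Q x i + Q i x)) = (2 * c1) *\<^sub>R Q x b + (4 * c2) *\<^sub>R Q x (A x)"
  proof -
    have "(\<Sum>i\<in>Basis. (c1 * (b \<bullet> i) + 2 * c2 * (i \<bullet> A x)) *\<^sub>R (Q x i + Q i x))
      = (\<Sum>i\<in>Basis. (2 * c1) *\<^sub>R ((b \<bullet> i) *\<^sub>R Q x i) + (4 * c2) *\<^sub>R ((i \<bullet> A x) *\<^sub>R Q x i))"
      unfolding Qix by (simp add: algebra_simps)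
    then show ?thesis
      by (simp add: sum.distrib scaleR_sum_right[symmetric] sum_Basis_Q del: scaleR_scaleR)
  qed
  have S3: "(\<Sum>i\<in>Basis. c *\<^sub>R (Q i i + Q i i)) = 0" for c
    by (simp add: scaleR_sum_right[symmetric] sum.distrib Q_trace)
  have S4: "(\<Sum>i\<in>Basis. (q2 * R\<^sup>2) *\<^sub>R (Q i (A i) + Q i (A i))) = (2 * q2 * R\<^sup>2) *\<^sub>R K"
    by (simp add: K_def scaleR_sum_right[symmetric] sum.distrib scaleR_2[symmetric])
  have S5: "(\<Sum>i\<in>Basis. - (2 * q1 * (i \<bullet> A i)) * r) = 0"
    using A_trace by (simp add: sum_negf flip: sum_distrib_left sum_distrib_right)
  have S: "(\<Sum>i\<in>Basis. field'' p0 p1 p2 q1 q2 q3 x i i) =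
    ((4 * c1) *\<^sub>R Q x b + (8 * c2) *\<^sub>R Q x (A x) + (2 * q2 * R\<^sup>2) *\<^sub>R K, 0)"
    unfolding field''_def Let_def c1_def[symmetric] c2_def[symmetric] sum_Pair sum.distrib S1 S2 S3 S4 S5
    by simp (rule eq_if_inner_eq; simp add: inner_add_left)
  let ?c0 = "- (\<kappa> * (2 * c2 * h x + 4 * (c1 * f x + 2 * c2 * h x) + 2 * (p0 + c1 * f x + c2 * h x)))
    - m * \<kappa> * (c1 * f x + 2 * c2 * h x + 2 * (p0 + c1 * f x + c2 * h x))"
  have "sphere_laplacian R (field' p0 p1 p2 q1 q2 q3) (field'' p0 p1 p2 q1 q2 q3) x =
    (?c0 *\<^sub>R Q x x + (4 * c1 - 2 * (m * \<kappa>) * p2) *\<^sub>R Q x b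
       + (8 * c2 - (2 * q2 * R\<^sup>2 * \<kappa> + 2 * m * q2 * R\<^sup>2 * \<kappa>)) *\<^sub>R Q x (A x) + (2 * q2 * R\<^sup>2) *\<^sub>R K,
     ((2 * \<kappa>) * q1 * h x + m * \<kappa> * (p1 * f x + 2 * q1 * h x)) * r)"
    unfolding sphere_laplacian_def S
    by (simp add: dim kappa_R_square(3,4) field''_def field'_def Let_def c1_def[symmetric] c2_def[symmetric]
        f_def[symmetric] h_def[symmetric])
      (intro conjI, (rule eq_if_inner_eq; simp add: inner_add_left inner_diff_left algebra_simps), simp add: algebra_simps)
  also have "\<dots> = ((- (2 * m * p0 + (6 * \<kappa> + 3 * m * \<kappa>) * c1 * f x + (12 * \<kappa> + 4 * m * \<kappa>) * c2 * h x)) *\<^sub>R Q x x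
      + (4 * c1 - 2 * m * \<kappa> * p2) *\<^sub>R Q x b + (8 * c2 - 2 * (m + 1) * q2) *\<^sub>R Q x (A x) + (2 * q2 * R\<^sup>2) *\<^sub>R K,
     (m * \<kappa> * p1 * f x + 2 * m * q1 * h x) * r)"
    unfolding prod.inject
  proof (intro conjI lincomb4_eq refl)
    show "8 * c2 - (2 * q2 * R\<^sup>2 * \<kappa> + 2 * m * q2 * R\<^sup>2 * \<kappa>) = 8 * c2 - 2 * (m + 1) * q2"
    proof -
      have "2 * q2 * R\<^sup>2 * \<kappa> + 2 * m * q2 * R\<^sup>2 * \<kappa> = 2 * (m + 1) * q2 * (R\<^sup>2 * \<kappa>)"
        by (simp add: algebra_simps)
      then show ?thesis using kappa_R_square(2) by simp
    qed
    have "m = \<kappa> + m * \<kappa>" using m_kappa by simp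
    then have *: "2 * m * t = 2 * (\<kappa> + m * \<kappa>) * t" for t by simp
    show "?c0 = - (2 * m * p0 + (6 * \<kappa> + 3 * m * \<kappa>) * c1 * f x + (12 * \<kappa> + 4 * m * \<kappa>) * c2 * h x)"
      unfolding * by (simp add: algebra_simps)
    have "2 * m * q1 * h x = 2 * (\<kappa> + m * \<kappa>) * (q1 * h x)"
      using *[of "q1 * h x"] by (simp add: mult.assoc)
    then show "((2 * \<kappa>) * q1 * h x + m * \<kappa> * (p1 * f x + 2 * q1 * h x)) * r = (m * \<kappa> * p1 * f x + 2 * m * q1 * h x) * r"
      by (simp add: algebra_simps)
  qed (simp add: algebra_simps)
  finally show ?thesis .
qed

section \<open>The operators of the second variation on the family\<close>

text \<open>The unit normal, in the target sphere, of the small sphere that contains the image of \<open>\<phi>\<close>.\<close>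

definition \<eta> :: "'a \<Rightarrow> 'b \<times> real" where "\<eta> x = (Q x x, - r)"

text \<open>The tangent vector of the domain whose image under \<open>d\<phi>\<close> is the part of \<open>field p0 p1 p2 q1 q2 q3\<close>
  that is tangent to the image of \<open>\<phi>\<close>; \<open>p0\<close>, \<open>p1\<close> and \<open>q1\<close> do not contribute.\<close>

definition Z :: "real \<Rightarrow> real \<Rightarrow> real \<Rightarrow> 'a \<Rightarrow> 'a" where
  "Z p2 q2 q3 x = p2 *\<^sub>R (b - (\<kappa> * f x) *\<^sub>R x) + (q2 * R\<^sup>2 / 2 + q3 * \<kappa>) *\<^sub>R (A x - (\<kappa> * h x) *\<^sub>R x)"

lemma inner_K: "K \<bullet> Q x y = \<kappa> / 2 * (x \<bullet> A y)"
proof -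
  have s: "(\<Sum>i\<in>Basis. (i \<bullet> x) * (A i \<bullet> y)) = x \<bullet> A y" for x y
    unfolding euclidean_inner[of x "A y"]
    by (intro sum.cong) (simp_all add: A_self[of _ y] inner_commute[of "A y"] inner_commute[of x])
  have "K \<bullet> Q x y = (\<Sum>i\<in>Basis. \<kappa> / 2 * (((i \<bullet> x) * (A i \<bullet> y) + (i \<bullet> y) * (A i \<bullet> x)) / 2
      - (i \<bullet> A i) * (x \<bullet> y) / (m + 1)))"
    by (simp add: K_def inner_sum_left Q_inner mult.commute)
  also have "\<dots> = \<kappa> / 2 * ((x \<bullet> A y + y \<bullet> A x) / 2 - (\<Sum>i\<in>Basis. i \<bullet> A i) * (x \<bullet> y) / (m + 1))"
    by (simp add: sum_distrib_left[symmetric] sum_subtractf sum_divide_distrib[symmetric] sum.distrib s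
        sum_distrib_right[symmetric])
  finally show ?thesis
    by (simp add: A_trace A_swap[of y x])
qed

context
  fixes x :: 'a
  assumes x: "x \<in> sphere 0 R"
begin

lemma inner_Psi_values:
  "Q x b \<bullet> Q x x = \<kappa> / 2 * f x" "Q x (A x) \<bullet> Q x x = \<kappa> / 2 * h x" "K \<bullet> Q x x = \<kappa> / 2 * h x"
  by (simp_all add: inner_Q_sphere(2)[OF x] f_def h_def inner_K inner_commute[of x b])

lemma field_perp: "field p0 p1 p2 q1 q2 q3 x \<bullet> \<Phi> x = 0"
  by (simp add: kappa_R_cancel add_divide_distrib diff_divide_distrib field_def \<Phi>_def inner_Pair inner_add_left inner_diff_left inner_Psi_values inner_Q_sphere(1)[OF x] mult.assoc r_square)

lemma field_inner_eta: "field p0 p1 p2 q1 q2 q3 x \<bullet> \<eta> x = p0 + p1 * f x + q1 * h x"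
  by (simp add: kappa_R_cancel add_divide_distrib diff_divide_distrib field_def \<eta>_def inner_Pair inner_add_left inner_diff_left inner_Psi_values inner_Q_sphere(1)[OF x] mult.assoc r_square)

lemma Phi_isometry: "u \<bullet> x = 0 \<Longrightarrow> v \<bullet> x = 0 \<Longrightarrow> \<Phi>' x u \<bullet> \<Phi>' x v = u \<bullet> v"
  using sphere_inner[OF x] kappa_R_square(1)
  by (simp add: \<Phi>'_def inner_Pair Q_inner inner_commute[of x v] flip: mult.assoc)

lemma Z_tangent: "Z p2 q2 q3 x \<bullet> x = 0"
proof -
  have *: "\<kappa> * c * (x \<bullet> x) = c" for c
  proof -
    have "\<kappa> * c * (x \<bullet> x) = c * (\<kappa> * R\<^sup>2)"
      unfolding sphere_inner[OF x] by (simp only: mult_ac)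
    then show ?thesis by (simp only: kappa_R_square(1) mult_1_right)
  qed
  show ?thesis
    unfolding Z_def inner_add_left inner_scaleR_left inner_diff_left f_def h_def A_self * by simp
qed

lemma inner_Q_tangent:
  assumes u: "u \<bullet> x = 0"
  shows "Q x x \<bullet> Q x u = 0" "Q x y \<bullet> Q x u = (y \<bullet> u) / 4 - \<kappa> / 2 * (x \<bullet> y) * (x \<bullet> u) / (m + 1)"
  using sphere_inner[OF x] kappa_R_square(1) u
  by (simp_all add: Q_inner inner_commute[of x u])

lemma field_inner_dphi:
  assumes u: "u \<bullet> x = 0"
  shows "field p0 p1 p2 q1 q2 q3 x \<bullet> \<Phi>' x u = Z p2 q2 q3 x \<bullet> u"
  using u
  by (simp add: field_def \<Phi>'_def Z_def inner_Pair inner_add_left inner_diff_left inner_Q_tangent[OF u] inner_K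
      inner_commute[of x u] A_swap[of u x] A_self algebra_simps)

lemma Phi'_Z: "\<Phi>' x (Z p2 q2 q3 x) = field 0 0 p2 0 (q2 + 2 * \<kappa> * \<kappa> * q3) 0 x"
proof -
  have X: "h x *\<^sub>R Q x x = (R\<^sup>2 * (\<kappa> * h x)) *\<^sub>R Q x x"
    by (simp only: kappa_R_cancel)
  have "(q2 + 2 * \<kappa> * \<kappa> * q3) * R\<^sup>2 = q2 * R\<^sup>2 + 2 * \<kappa> * q3 * (\<kappa> * R\<^sup>2)"
    by (simp add: algebra_simps)
  then have c: "(q2 + 2 * \<kappa> * \<kappa> * q3) * R\<^sup>2 = 2 * (q2 * R\<^sup>2 / 2 + q3 * \<kappa>)"
    by (simp add: kappa_R_square(1))
  have "field 0 0 p2 0 (q2 + 2 * \<kappa> * \<kappa> * q3) 0 x = (p2 *\<^sub>R (2 *\<^sub>R Q x b - (2 * \<kappa> * f x) *\<^sub>R Q x x)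
      + ((q2 + 2 * \<kappa> * \<kappa> * q3) * R\<^sup>2) *\<^sub>R (Q x (A x) - (\<kappa> * h x) *\<^sub>R Q x x), 0)"
    unfolding field_def X by (simp add: scaleR_diff_right)
  then show ?thesis
    unfolding c \<Phi>'_def Z_def
    by (simp add: Q.add_right Q.diff_right Q.scaleR_right)
      (rule eq_if_inner_eq; simp add: inner_add_left inner_diff_left algebra_simps)
qed

end

lemma field_add: "field p0 p1 p2 q1 q2 q3 x + field p0' p1' p2' q1' q2' q3' x =
    field (p0 + p0') (p1 + p1') (p2 + p2') (q1 + q1') (q2 + q2') (q3 + q3') x"
  and field_diff: "field p0 p1 p2 q1 q2 q3 x - field p0' p1' p2' q1' q2' q3' x =
    field (p0 - p0') (p1 - p1') (p2 - p2') (q1 - q1') (q2 - q2') (q3 - q3') x"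
  and field_scale: "c *\<^sub>R field p0 p1 p2 q1 q2 q3 x = field (c * p0) (c * p1) (c * p2) (c * q1) (c * q2) (c * q3) x"
  and field_minus: "- field p0 p1 p2 q1 q2 q3 x = field (- p0) (- p1) (- p2) (- q1) (- q2) (- q3) x"
  unfolding field_def
  by (rule prod_eqI; simp; (rule eq_if_inner_eq)?; simp add: inner_add_left inner_diff_left algebra_simps)+

lemma has_derivative_eta: "(\<eta> has_derivative \<Phi>' x) (at x)"
proof -
  have "((\<lambda>y. \<Phi> y - (0, 2 * r)) has_derivative \<Phi>' x) (at x)"
    by (rule has_derivative_eq_rhs[OF has_derivative_diff[OF twice_derivableD(1)[OF twice_derivable_Phi] has_derivative_const]]) simp
  moreover have "\<eta> = (\<lambda>y. \<Phi> y - (0, 2 * r))"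
    by (auto simp: \<eta>_def \<Phi>_def)
  ultimately show ?thesis by simp
qed

text \<open>Obtained by differentiating \<open>\<langle>V, \<eta>\<rangle> = p0 + p1 f + q1 h\<close> along the sphere, with \<open>d\<eta> = d\<phi>\<close>.\<close>

lemma derivative_field_inner_eta:
  assumes x: "x \<in> sphere 0 R" and u: "u \<bullet> x = 0"
  shows "field' p0 p1 p2 q1 q2 q3 x u \<bullet> \<eta> x = p1 * (b \<bullet> u) + 2 * q1 * (A x \<bullet> u) - Z p2 q2 q3 x \<bullet> u"
proof -
  have dA: "(A has_derivative A) (at x)"
    by (rule bounded_linear_imp_has_derivative[OF bounded_linear_A])
  have "((\<lambda>y. field p0 p1 p2 q1 q2 q3 y \<bullet> \<eta> y - (p0 + p1 * f y + q1 * h y)) has_derivative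
      (\<lambda>u. (field p0 p1 p2 q1 q2 q3 x \<bullet> \<Phi>' x u + field' p0 p1 p2 q1 q2 q3 x u \<bullet> \<eta> x)
        - (0 + p1 * (b \<bullet> u) + q1 * (x \<bullet> A u + u \<bullet> A x)))) (at x)"
    unfolding f_def h_def
    by (intro has_derivative_diff has_derivative_add has_derivative_const has_derivative_mult_right
        has_derivative_inner twice_derivableD(1)[OF twice_derivable_field] has_derivative_eta
        has_derivative_ident dA has_derivative_inner_right)
  from derivative_zero_on_sphere[OF x R_pos u this]
  have "(field p0 p1 p2 q1 q2 q3 x \<bullet> \<Phi>' x u + field' p0 p1 p2 q1 q2 q3 x u \<bullet> \<eta> x)
        - (0 + p1 * (b \<bullet> u) + q1 * (x \<bullet> A u + u \<bullet> A x)) = 0"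
    by (simp add: field_inner_eta)
  then show ?thesis
    by (simp add: field_inner_dphi[OF x u] A_swap[of x u] inner_commute[of "A x" u])
qed

context
  fixes \<phi> :: "'a \<Rightarrow> 'b \<times> real"
  assumes phi: "\<And>y. y \<in> sphere 0 R \<Longrightarrow> \<phi> y = \<Phi> y"
begin

lemma tangential_field:
  assumes x: "x \<in> sphere 0 R" and V: "\<And>y. y \<in> sphere 0 R \<Longrightarrow> V y = field p0 p1 p2 q1 q2 q3 y"
  shows "tangential_part R \<phi> V x = field 0 0 p2 0 (q2 + 2 * \<kappa> * \<kappa> * q3) 0 x"
proof -
  have "tangential_part R \<phi> V x = tangent_trace x (\<lambda>u w. (V x \<bullet> \<Phi>' x u) *\<^sub>R \<Phi>' x w)"
    by (rule tangential_part_eq[OF R_pos twice_derivable_Phi phi norm_Phi x])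
  also have "\<dots> = \<Phi>' x (Z p2 q2 q3 x)"
    by (rule tangent_trace_dual[OF sphere_nonzero[OF R_pos x] Z_tangent[OF x] linear_Phi'])
      (simp add: V[OF x] field_inner_dphi[OF x])
  finally show ?thesis by (simp add: Phi'_Z[OF x])
qed

lemma rough_laplacian_field:
  assumes x: "x \<in> sphere 0 R" and V: "\<And>y. y \<in> sphere 0 R \<Longrightarrow> V y = field p0 p1 p2 q1 q2 q3 y"
  shows "rough_laplacian R \<phi> V x =
    field (m * p0) ((m * \<kappa> + m) * p1 - 2 * m * \<kappa> * p2) (- 2 * p1 + (m * \<kappa> + 4 * \<kappa> - 1) * p2)
      (3 * m * q1 - (m + 1) * q2 - 2 * m * \<kappa> * q3)
      (- 8 * \<kappa> * q1 + (2 * m + 8 * \<kappa> - 1) * q2 + 6 * \<kappa> * \<kappa> * q3) (- 2 * R\<^sup>2 * q2) x"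
proof -
  define c1 where "c1 = p1 - 2 * \<kappa> * p2"
  define c2 where "c2 = q1 - q2 - \<kappa> * q3"
  define s0 where "s0 = - (2 * m * p0 + (6 * \<kappa> + 3 * m * \<kappa>) * c1 * f x + (12 * \<kappa> + 4 * m * \<kappa>) * c2 * h x)"
  define s1 where "s1 = 4 * c1 - 2 * m * \<kappa> * p2"
  define s2 where "s2 = 8 * c2 - 2 * (m + 1) * q2"
  define s3 where "s3 = 2 * q2 * R\<^sup>2"
  define s4 where "s4 = m * \<kappa> * p1 * f x + 2 * m * q1 * h x"
  define t where "t = s0 / 2 + s1 * \<kappa> * f x / 2 + s2 * \<kappa> * h x / 2 + q2 * h x + s4 / 2"
  define q where "q = q2 + 2 * \<kappa> * \<kappa> * q3"
  let ?S = "(s0 *\<^sub>R Q x x + s1 *\<^sub>R Q x b + s2 *\<^sub>R Q x (A x) + s3 *\<^sub>R K, s4 * r)"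
  have s3: "s3 * (\<kappa> * h x) / 2 = q2 * h x"
    by (simp add: s3_def mult.assoc kappa_R_cancel)
  have TV: "tangential_part R \<phi> V x = field 0 0 p2 0 (q2 + 2 * \<kappa> * \<kappa> * q3) 0 x"
    by (rule tangential_field[OF x V])
  have "rough_laplacian R \<phi> V x =
    - unit_perp (\<Phi> x) (sphere_laplacian R (field' p0 p1 p2 q1 q2 q3) (field'' p0 p1 p2 q1 q2 q3) x)
    - tangential_part R \<phi> V x"
    by (rule rough_laplacian_eq[OF R_pos twice_derivable_Phi phi norm_Phi x V twice_derivable_field field_perp])
  also have "\<dots> = - unit_perp (\<Phi> x) ?S - field 0 0 p2 0 q 0 x"
    unfolding sphere_laplacian_field TV s0_def s1_def s2_def s3_def s4_def c1_def c2_def q_def ..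
  also have "unit_perp (\<Phi> x) ?S = ?S - t *\<^sub>R \<Phi> x"
    using s3 unfolding unit_perp_def
    by (simp add: \<Phi>_def inner_Pair inner_add_left inner_Q_sphere(1)[OF x] inner_Psi_values[OF x] t_def mult.assoc r_square)
  also have "- (?S - t *\<^sub>R \<Phi> x) - field 0 0 p2 0 q 0 x =
    ((t - s0 + (2 * \<kappa> * p2) * f x + q * h x) *\<^sub>R Q x x + (- s1 - 2 * p2) *\<^sub>R Q x b
      + (- s2 - q * R\<^sup>2) *\<^sub>R Q x (A x) + (- s3) *\<^sub>R K, (t - s4) * r)"
    unfolding field_expand Let_def \<Phi>_def
    by (rule prod_eqI; simp; (rule eq_if_inner_eq)?; simp add: inner_add_left inner_diff_left algebra_simps)
  also have "\<dots> = field (m * p0) ((m * \<kappa> + m) * p1 - 2 * m * \<kappa> * p2) (- 2 * p1 + (m * \<kappa> + 4 * \<kappa> - 1) * p2)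
      (3 * m * q1 - (m + 1) * q2 - 2 * m * \<kappa> * q3)
      (- 8 * \<kappa> * q1 + (2 * m + 8 * \<kappa> - 1) * q2 + 6 * \<kappa> * \<kappa> * q3) (- 2 * R\<^sup>2 * q2) x"
    unfolding field_expand Let_def prod.inject
  proof (intro conjI lincomb4_eq)
    have R2: "\<kappa> * R\<^sup>2 = 1" "m * \<kappa> + \<kappa> = m" using kappa_R_square m_kappa by auto
    show "- s3 = - 2 * R\<^sup>2 * q2" by (simp add: s3_def)
    show "- s1 - 2 * p2 = 2 * (- 2 * p1 + (m * \<kappa> + 4 * \<kappa> - 1) * p2)"
      by (simp add: s1_def c1_def algebra_simps)
    show "- s2 - q * R\<^sup>2 = (- 8 * \<kappa> * q1 + (2 * m + 8 * \<kappa> - 1) * q2 + 6 * \<kappa> * \<kappa> * q3) * R\<^sup>2"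
      using R2 unfolding s2_def q_def c2_def by algebra
    \<comment> \<open>This is the identity for the last coordinates; it is used again for the coefficient of \<open>Q x x\<close>.\<close>
    define P where "P = m * p0 + ((m * \<kappa> + m) * p1 - 2 * m * \<kappa> * p2) * f x
       + (3 * m * q1 - (m + 1) * q2 - 2 * m * \<kappa> * q3) * h x"
    have ts: "t - s4 = - P"
    proof -
      have "2 * t = s0 + s1 * \<kappa> * f x + s2 * \<kappa> * h x + 2 * q2 * h x + s4"
        by (simp add: t_def)
      then have "2 * t - 2 * s4 + 2 * P = 2 * (m - (m * \<kappa> + \<kappa>)) *
          (p1 * f x + 2 * q1 * h x - q2 * h x - 2 * \<kappa> * p2 * f x - 2 * \<kappa> * q3 * h x)"
        unfolding s4_def s0_def s1_def s2_def c1_def c2_def P_def by (simp add: algebra_simps)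
      then have "2 * t - 2 * s4 + 2 * P = 0" using R2(2) by simp
      then show ?thesis by simp
    qed
    then show "(t - s4) * r = - (m * p0 + ((m * \<kappa> + m) * p1 - 2 * m * \<kappa> * p2) * f x
       + (3 * m * q1 - (m + 1) * q2 - 2 * m * \<kappa> * q3) * h x) * r"
      by (simp add: P_def)
    have e1: "\<kappa> * (s1 + 2 * p2 + 2 * (- 2 * p1 + (m * \<kappa> + 4 * \<kappa> - 1) * p2)) = 0"
      by (simp add: s1_def c1_def algebra_simps)
    have e2: "s2 * \<kappa> + q + (- 8 * \<kappa> * q1 + (2 * m + 8 * \<kappa> - 1) * q2 + 6 * \<kappa> * \<kappa> * q3) = 0"
    proof -
      have "s2 * \<kappa> + q + (- 8 * \<kappa> * q1 + (2 * m + 8 * \<kappa> - 1) * q2 + 6 * \<kappa> * \<kappa> * q3) = 2 * (m - (m * \<kappa> + \<kappa>)) * q2"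
        by (simp add: s2_def q_def c2_def algebra_simps)
      then show ?thesis using R2(2) by simp
    qed
    show "t - s0 + 2 * \<kappa> * p2 * f x + q * h x =
      m * p0 +
      ((m * \<kappa> + m) * p1 - 2 * m * \<kappa> * p2 - 2 * \<kappa> * (- 2 * p1 + (m * \<kappa> + 4 * \<kappa> - 1) * p2)) * f x +
      (3 * m * q1 - (m + 1) * q2 - 2 * m * \<kappa> * q3 -
       (- 8 * \<kappa> * q1 + (2 * m + 8 * \<kappa> - 1) * q2 + 6 * \<kappa> * \<kappa> * q3) - \<kappa> * (- 2 * R\<^sup>2 * q2)) * h x"
    proof -
      have t: "2 * t = s0 + s1 * \<kappa> * f x + s2 * \<kappa> * h x + 2 * q2 * h x + s4"
        by (simp add: t_def)
      define p2' where "p2' = - 2 * p1 + (m * \<kappa> + 4 * \<kappa> - 1) * p2"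
      define q2' where "q2' = - 8 * \<kappa> * q1 + (2 * m + 8 * \<kappa> - 1) * q2 + 6 * \<kappa> * \<kappa> * q3"
      have "(\<kappa> * (s1 + 2 * p2 + 2 * p2')) * f x = 0" "(s2 * \<kappa> + q + q2') * h x = 0"
        using e1 e2 by (simp_all add: p2'_def q2'_def)
      then have "t - s0 + 2 * \<kappa> * p2 * f x + q * h x = P + (- 2 * \<kappa> * p2') * f x + (- q2' - (- 2 * q2)) * h x"
        using ts t by (simp add: algebra_simps)
      moreover have "\<kappa> * (- 2 * R\<^sup>2 * q2) = - 2 * q2"
        using kappa_R_cancel(1)[of q2] by (simp add: mult.assoc mult.left_commute[of \<kappa> 2])
      ultimately show ?thesis
        unfolding P_def p2'_def q2'_def by (simp only:) (simp add: algebra_simps)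
    qed
  qed
  finally show ?thesis .
qed

end

lemma r_nonzero: "r \<noteq> 0"
  using r_square by auto

lemma field_cong:
  "p0 = p0' \<Longrightarrow> p1 = p1' \<Longrightarrow> p2 = p2' \<Longrightarrow> q1 = q1' \<Longrightarrow> q2 = q2' \<Longrightarrow> q3 = q3' \<Longrightarrow>
    field p0 p1 p2 q1 q2 q3 x = field p0' p1' p2' q1' q2' q3' x"
  by simp

lemma field_split: "x \<in> sphere 0 R \<Longrightarrow> field p0 p1 p2 q1 q2 0 x = (p0 + p1 * f x + q1 * h x) *\<^sub>R \<eta> x + \<Phi>' x (Z p2 q2 0 x)"
  by (simp add: Phi'_Z) (simp add: field_def \<eta>_def algebra_simps)

lemma eta_values:
  assumes x: "x \<in> sphere 0 R"
  shows "\<eta> x \<bullet> \<eta> x = 1" "\<eta> x \<bullet> \<Phi> x = 0" "u \<bullet> x = 0 \<Longrightarrow> \<eta> x \<bullet> \<Phi>' x u = 0"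
  by (simp_all add: \<eta>_def \<Phi>_def \<Phi>'_def inner_Pair inner_Q_sphere(1)[OF x] r_square inner_Q_tangent(1)[OF x])

context
  fixes \<phi> :: "'a \<Rightarrow> 'b \<times> real"
  assumes phi: "\<And>y. y \<in> sphere 0 R \<Longrightarrow> \<phi> y = \<Phi> y"
begin

lemma energy_density_phi:
  assumes x: "x \<in> sphere 0 R"
  shows "energy_density2 R \<phi> x = m"
proof -
  have "energy_density2 R \<phi> x = tangent_trace x (\<lambda>u w. u \<bullet> w)"
    unfolding energy_density2_def
  proof (rule tangent_trace_cong)
    fix u assume u: "u \<bullet> x = 0"
    have "sdiff R \<phi> x u = \<Phi>' x u"
      by (rule sdiff_phi[OF R_pos twice_derivable_Phi phi norm_Phi x u])
    then show "sdiff R \<phi> x u \<bullet> sdiff R \<phi> x u = u \<bullet> u"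
      by (simp add: Phi_isometry[OF x u u])
  qed
  also have "\<dots> = (\<Sum>i\<in>Basis. (i::'a) \<bullet> i) - (1 / (x \<bullet> x)) *\<^sub>R (x \<bullet> x)"
    by (rule tangent_trace_bilinear[OF sphere_nonzero[OF R_pos x]])
      (auto intro!: linearI simp: inner_add_left inner_add_right)
  also have "\<dots> = m"
    using sphere_nonzero[OF R_pos x] dim by simp
  finally show ?thesis .
qed

lemma tension_phi:
  assumes x: "x \<in> sphere 0 R"
  shows "tension R \<phi> x = field (- m) 0 0 0 0 0 x"
proof -
  have "tension R \<phi> x = unit_perp (\<Phi> x) (sphere_laplacian R \<Phi>' \<Phi>'' x)"
    by (rule tension_eq[OF R_pos twice_derivable_Phi phi norm_Phi x])
  also have "\<dots> = unit_perp (\<Phi> x) (- (2 * m) *\<^sub>R Q x x, 0)"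
    by (simp only: sphere_laplacian_Phi)
  also have "\<dots> = field (- m) 0 0 0 0 0 x"
    unfolding unit_perp_def field_def
    by (simp add: \<Phi>_def inner_Pair inner_Q_sphere(1)[OF x])
      (rule eq_if_inner_eq; simp add: inner_add_left inner_diff_left algebra_simps)
  finally show ?thesis .
qed

lemma tension_eta: "x \<in> sphere 0 R \<Longrightarrow> tension R \<phi> x = - m *\<^sub>R \<eta> x"
  by (simp add: tension_phi field_def \<eta>_def)

text \<open>The value of \<open>\<langle>\<Delta>\<^sub>S V, \<phi>\<rangle>\<close> needed for \<open>inner_dphi_eq\<close> is read off from the last coordinate of the rough
  Laplacian, which is already known.\<close>

lemma inner_dphi_field:
  assumes x: "x \<in> sphere 0 R" and V: "\<And>y. y \<in> sphere 0 R \<Longrightarrow> V y = field p0 p1 p2 q1 q2 q3 y"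
  shows "inner_dphi R \<phi> V x = m * p0 + (m * p1 - m * \<kappa> * p2) * f x
    + (m * q1 - (m + 1) / 2 * q2 - m * \<kappa> * q3) * h x"
proof -
  let ?L = "sphere_laplacian R (field' p0 p1 p2 q1 q2 q3) (field'' p0 p1 p2 q1 q2 q3) x"
  define s4 where "s4 = m * \<kappa> * p1 * f x + 2 * m * q1 * h x"
  define P where "P = m * p0 + ((m * \<kappa> + m) * p1 - 2 * m * \<kappa> * p2) * f x
       + (3 * m * q1 - (m + 1) * q2 - 2 * m * \<kappa> * q3) * h x"
  have "rough_laplacian R \<phi> V x = - unit_perp (\<Phi> x) ?L - tangential_part R \<phi> V x"
    by (rule rough_laplacian_eq[OF R_pos twice_derivable_Phi phi norm_Phi x V twice_derivable_field field_perp])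
  moreover have "snd (rough_laplacian R \<phi> V x) = - P * r"
  proof -
    have "rough_laplacian R \<phi> V x = field (m * p0) ((m * \<kappa> + m) * p1 - 2 * m * \<kappa> * p2)
      (- 2 * p1 + (m * \<kappa> + 4 * \<kappa> - 1) * p2) (3 * m * q1 - (m + 1) * q2 - 2 * m * \<kappa> * q3)
      (- 8 * \<kappa> * q1 + (2 * m + 8 * \<kappa> - 1) * q2 + 6 * \<kappa> * \<kappa> * q3) (- 2 * R\<^sup>2 * q2) x"
      by (rule rough_laplacian_field[OF phi x V])
    then show ?thesis by (simp add: field_def P_def)
  qed
  moreover have "tangential_part R \<phi> V x = field 0 0 p2 0 (q2 + 2 * \<kappa> * \<kappa> * q3) 0 x"
    by (rule tangential_field[OF phi x V])
  then have "snd (tangential_part R \<phi> V x) = 0"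
    by (simp add: field_def)
  ultimately have "- P * r = - snd (unit_perp (\<Phi> x) ?L)"
    by simp
  also have "snd (unit_perp (\<Phi> x) ?L) = snd ?L - (?L \<bullet> \<Phi> x) * r"
    by (simp add: unit_perp_def \<Phi>_def)
  also have "snd ?L = s4 * r"
    by (simp add: sphere_laplacian_field s4_def)
  finally have "P * r = (s4 - ?L \<bullet> \<Phi> x) * r"
    by (simp add: left_diff_distrib)
  then have L: "?L \<bullet> \<Phi> x = s4 - P"
    using r_nonzero by simp
  have "sphere_laplacian R \<Phi>' \<Phi>'' x = - m *\<^sub>R (\<Phi> x + \<eta> x)"
    by (simp add: sphere_laplacian_Phi \<Phi>_def \<eta>_def scaleR_2[symmetric])
  then have "field p0 p1 p2 q1 q2 q3 x \<bullet> sphere_laplacian R \<Phi>' \<Phi>'' x = - m * (p0 + p1 * f x + q1 * h x)"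
    by (simp add: inner_add_right field_perp[OF x] field_inner_eta[OF x])
  moreover have "inner_dphi R \<phi> V x = - (?L \<bullet> \<Phi> x + field p0 p1 p2 q1 q2 q3 x \<bullet> sphere_laplacian R \<Phi>' \<Phi>'' x) / 2"
    by (rule inner_dphi_eq[OF R_pos twice_derivable_Phi phi norm_Phi x V twice_derivable_field field_perp])
  ultimately have "2 * inner_dphi R \<phi> V x = P - s4 + m * (p0 + p1 * f x + q1 * h x)"
    using L by simp
  moreover have "\<dots> = 2 * (m * p0 + (m * p1 - m * \<kappa> * p2) * f x
    + (m * q1 - (m + 1) / 2 * q2 - m * \<kappa> * q3) * h x)"
    unfolding P_def s4_def by (simp add: field_simps)
  ultimately show ?thesis by simp
qed

lemma pullback_conn_field:
  assumes x: "x \<in> sphere 0 R" and u: "u \<bullet> x = 0"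
    and V: "\<And>y. y \<in> sphere 0 R \<Longrightarrow> V y = field p0 p1 p2 q1 q2 q3 y"
  shows "pullback_conn R \<phi> V x u = unit_perp (\<Phi> x) (field' p0 p1 p2 q1 q2 q3 x u)"
  by (rule pullback_conn_eq[OF R_pos twice_derivable_Phi phi norm_Phi x u V
        twice_derivableD(1)[OF twice_derivable_field]])

lemma trace_inner_dtension:
  assumes x: "x \<in> sphere 0 R" and V: "\<And>y. y \<in> sphere 0 R \<Longrightarrow> V y = field p0 p1 p2 q1 q2 q3 y"
  shows "tangent_trace x (\<lambda>u w. (V x \<bullet> pullback_conn R \<phi> (tension R \<phi>) x u) *\<^sub>R sdiff R \<phi> x w) =
    (- m) *\<^sub>R field 0 0 p2 0 (q2 + 2 * \<kappa> * \<kappa> * q3) 0 x"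
proof -
  have "tangent_trace x (\<lambda>u w. (V x \<bullet> pullback_conn R \<phi> (tension R \<phi>) x u) *\<^sub>R sdiff R \<phi> x w) =
      \<Phi>' x (- m *\<^sub>R Z p2 q2 q3 x)"
  proof (rule tangent_trace_dual[OF sphere_nonzero[OF R_pos x] _ linear_Phi'])
    fix u assume u: "u \<bullet> x = 0"
    have "field' (- m) 0 0 0 0 0 x u = - m *\<^sub>R \<Phi>' x u"
      using Q_sym[of u x] by (simp add: field'_def \<Phi>'_def scaleR_2)
    moreover have "pullback_conn R \<phi> (tension R \<phi>) x u = unit_perp (\<Phi> x) (field' (- m) 0 0 0 0 0 x u)"
      by (rule pullback_conn_field[OF x u tension_phi])
    ultimately have "V x \<bullet> pullback_conn R \<phi> (tension R \<phi>) x u = (- m *\<^sub>R Z p2 q2 q3 x) \<bullet> u"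
      by (simp add: unit_perp_def inner_diff_right V[OF x] field_perp[OF x] field_inner_dphi[OF x u])
    moreover have "sdiff R \<phi> x u = \<Phi>' x u"
      by (rule sdiff_phi[OF R_pos twice_derivable_Phi phi norm_Phi x u])
    ultimately show "(V x \<bullet> pullback_conn R \<phi> (tension R \<phi>) x u) *\<^sub>R sdiff R \<phi> x u =
        ((- m *\<^sub>R Z p2 q2 q3 x) \<bullet> u) *\<^sub>R \<Phi>' x u"
      by simp
  qed (simp add: Z_tangent[OF x])
  then show ?thesis
    by (simp add: linear_cmul[OF linear_Phi'] linear_neg[OF linear_Phi'] Phi'_Z[OF x])
qed

lemma trace_tension_dV:
  assumes x: "x \<in> sphere 0 R" and V: "\<And>y. y \<in> sphere 0 R \<Longrightarrow> V y = field p0 p1 p2 q1 q2 q3 y"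
  shows "tangent_trace x (\<lambda>u w. (tension R \<phi> x \<bullet> pullback_conn R \<phi> V x u) *\<^sub>R sdiff R \<phi> x w) =
    (- m) *\<^sub>R field 0 0 (p1 - p2) 0 (4 * \<kappa> * q1 - q2 - 2 * \<kappa> * \<kappa> * q3) 0 x"
proof -
  have "tangent_trace x (\<lambda>u w. (tension R \<phi> x \<bullet> pullback_conn R \<phi> V x u) *\<^sub>R sdiff R \<phi> x w) =
      \<Phi>' x (- m *\<^sub>R Z (p1 - p2) (4 * \<kappa> * q1 - q2) (- q3) x)"
  proof (rule tangent_trace_dual[OF sphere_nonzero[OF R_pos x] _ linear_Phi'])
    fix u assume u: "u \<bullet> x = 0"
    have "(4 * \<kappa> * q1 - q2) * R\<^sup>2 / 2 = 2 * q1 * (\<kappa> * R\<^sup>2) - q2 * R\<^sup>2 / 2"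
      by (simp add: left_diff_distrib diff_divide_distrib)
    then have Zc: "(4 * \<kappa> * q1 - q2) * R\<^sup>2 / 2 + (- q3) * \<kappa> = 2 * q1 - (q2 * R\<^sup>2 / 2 + q3 * \<kappa>)"
      by (simp add: kappa_R_square(1))
    have "Z (p1 - p2) (4 * \<kappa> * q1 - q2) (- q3) x \<bullet> u = p1 * (b \<bullet> u) + 2 * q1 * (A x \<bullet> u) - Z p2 q2 q3 x \<bullet> u"
      using u unfolding Z_def Zc
      by (simp add: inner_commute[of x u] inner_add_left inner_diff_left algebra_simps)
    moreover have "pullback_conn R \<phi> V x u = unit_perp (\<Phi> x) (field' p0 p1 p2 q1 q2 q3 x u)"
      by (rule pullback_conn_field[OF x u V])
    moreover have Phi_eta: "\<Phi> x \<bullet> \<eta> x = 0"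
      using eta_values(2)[OF x] by (simp add: inner_commute)
    ultimately have "tension R \<phi> x \<bullet> pullback_conn R \<phi> V x u = (- m *\<^sub>R Z (p1 - p2) (4 * \<kappa> * q1 - q2) (- q3) x) \<bullet> u"
      using derivative_field_inner_eta[OF x u, of p0 p1 p2 q1 q2 q3]
      by (simp add: unit_perp_def inner_diff_right tension_eta[OF x] Phi_eta inner_commute[of "\<eta> x"])
    moreover have "sdiff R \<phi> x u = \<Phi>' x u"
      by (rule sdiff_phi[OF R_pos twice_derivable_Phi phi norm_Phi x u])
    ultimately show "(tension R \<phi> x \<bullet> pullback_conn R \<phi> V x u) *\<^sub>R sdiff R \<phi> x u =
        ((- m *\<^sub>R Z (p1 - p2) (4 * \<kappa> * q1 - q2) (- q3) x) \<bullet> u) *\<^sub>R \<Phi>' x u"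
      by simp
  qed (simp add: Z_tangent[OF x])
  then show ?thesis
    by (simp add: linear_cmul[OF linear_Phi'] linear_neg[OF linear_Phi'] Phi'_Z[OF x])
qed

text \<open>The section with coefficients \<open>(\<alpha>, 1, 0, 1, 1, 0)\<close> is \<open>(\<alpha> + f + h) \<eta> + (R\<^sup>2 / 4) d\<phi>(grad h)\<close>. On
  either of \<open>h \<eta>\<close> and \<open>d\<phi>(grad h)\<close> alone the form is positive; with the factor \<open>R\<^sup>2 / 4\<close> their sum is
  a negative direction. The term along the projection of \<open>(K, 0)\<close> cancels in \<open>I(V)\<close>.\<close>

proposition second_variation_op_field:
  assumes x: "x \<in> sphere 0 R" and V: "\<And>y. y \<in> sphere 0 R \<Longrightarrow> V y = field \<alpha> 1 0 1 1 0 y"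
  shows "second_variation_op R \<phi> V x =
    field (- 4 * m\<^sup>2 * \<alpha>) ((m * \<kappa>)\<^sup>2 + 4 * (m * \<kappa>) - 4 * m\<^sup>2) (- 4 * \<kappa>)
      (- 2 * m * (m - 1)) (8 * \<kappa> * (m - 1)) 0 x"
proof -
  let ?JV = "rough_laplacian R \<phi> V"
  have TV: "tangential_part R \<phi> V y = field 0 0 0 0 1 0 y" if y: "y \<in> sphere 0 R" for y
    using tangential_field[OF phi y V] by simp
  have TTV: "tangential_part R \<phi> (tangential_part R \<phi> V) x = field 0 0 0 0 1 0 x"
    using tangential_field[OF phi x TV] by simp
  have JV: "?JV y = field (m * \<alpha>) (m * \<kappa> + m) (- 2) (2 * m - 1) (2 * m - 1) (- 2 * R\<^sup>2) y"
    if y: "y \<in> sphere 0 R" for y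
    using rough_laplacian_field[OF phi y V] by (simp add: algebra_simps)
  have JJV: "rough_laplacian R \<phi> ?JV x = field (m\<^sup>2 * \<alpha>) ((m * \<kappa> + m)\<^sup>2 + 4 * m * \<kappa>)
      (- 4 * m * \<kappa> - 2 * m - 8 * \<kappa> + 2) ((2 * m - 1)\<^sup>2 + 4 * m) ((2 * m - 1)\<^sup>2 - 12 * \<kappa>) (- 2 * R\<^sup>2 * (2 * m - 1)) x"
  proof -
    have "3 * m * (2 * m - 1) - (m + 1) * (2 * m - 1) - 2 * m * \<kappa> * (- 2 * R\<^sup>2) = (2 * m - 1)\<^sup>2 + 4 * m * (\<kappa> * R\<^sup>2)"
      by (simp add: power2_eq_square algebra_simps)
    moreover have "- 8 * \<kappa> * (2 * m - 1) + (2 * m + 8 * \<kappa> - 1) * (2 * m - 1) + 6 * \<kappa> * \<kappa> * (- 2 * R\<^sup>2)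
      = (2 * m - 1)\<^sup>2 - 12 * \<kappa> * (\<kappa> * R\<^sup>2)"
      by (simp add: power2_eq_square algebra_simps)
    moreover have "m * (m * \<alpha>) = m\<^sup>2 * \<alpha>"
      "(m * \<kappa> + m) * (m * \<kappa> + m) - 2 * m * \<kappa> * (- 2) = (m * \<kappa> + m)\<^sup>2 + 4 * m * \<kappa>"
      "- 2 * (m * \<kappa> + m) + (m * \<kappa> + 4 * \<kappa> - 1) * (- 2) = - 4 * m * \<kappa> - 2 * m - 8 * \<kappa> + 2"
      by (simp_all add: power2_eq_square algebra_simps)
    ultimately show ?thesis
      using rough_laplacian_field[OF phi x JV] by (simp only: kappa_R_square(1) mult_1_right)
  qed
  have JT: "rough_laplacian R \<phi> (\<lambda>y. tangential_part R \<phi> V y - energy_density2 R \<phi> y *\<^sub>R V y) x =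
      field (- m\<^sup>2 * \<alpha>) (- m * (m * \<kappa> + m)) (2 * m) (- 2 * m\<^sup>2 - 1) (8 * \<kappa> + 3 * m - 1 - 2 * m\<^sup>2) (- 2 * R\<^sup>2 * (1 - m)) x"
  proof -
    have D: "tangential_part R \<phi> V y - energy_density2 R \<phi> y *\<^sub>R V y = field (- m * \<alpha>) (- m) 0 (- m) (1 - m) 0 y"
      if y: "y \<in> sphere 0 R" for y
      by (simp add: TV[OF y] V[OF y] energy_density_phi[OF y] field_scale field_diff)
    show ?thesis
      using rough_laplacian_field[OF phi x D] by (simp add: power2_eq_square algebra_simps)
  qed
  have TJV: "tangential_part R \<phi> ?JV x = field 0 0 (- 2) 0 (2 * m - 1 - 4 * \<kappa>) 0 x"
  proof -
    have "2 * m - 1 + 2 * \<kappa> * \<kappa> * (- 2 * R\<^sup>2) = 2 * m - 1 - 4 * \<kappa> * (\<kappa> * R\<^sup>2)"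
      by (simp add: algebra_simps)
    then show ?thesis
      using tangential_field[OF phi x JV] by (simp only: kappa_R_square(1) mult_1_right)
  qed
  have dt: "inner_dphi R \<phi> (tension R \<phi>) x = - m\<^sup>2"
    using inner_dphi_field[OF x tension_phi] by (simp add: power2_eq_square)
  have tt: "(norm (tension R \<phi> x))\<^sup>2 = m\<^sup>2"
    by (simp add: tension_eta[OF x] power_mult_distrib power2_norm_eq_inner eta_values[OF x] del: scaleR_minus_left)
  have t5: "tangent_trace x (\<lambda>u w. (V x \<bullet> pullback_conn R \<phi> (tension R \<phi>) x u) *\<^sub>R sdiff R \<phi> x w) =
      field 0 0 0 0 (- m) 0 x"
    using trace_inner_dtension[OF x V] by (simp add: field_scale)
  have t6: "tangent_trace x (\<lambda>u w. (tension R \<phi> x \<bullet> pullback_conn R \<phi> V x u) *\<^sub>R sdiff R \<phi> x w) =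
      field 0 0 (- m) 0 (- m * (4 * \<kappa> - 1)) 0 x"
    using trace_tension_dV[OF x V] by (simp add: field_scale)
  have t7: "(tension R \<phi> x \<bullet> V x) *\<^sub>R tension R \<phi> x = field (m\<^sup>2 * \<alpha>) (m\<^sup>2) 0 (m\<^sup>2) 0 0 x"
    by (simp add: tension_eta[OF x] inner_commute[of "\<eta> x"] V[OF x] field_inner_eta[OF x])
      (simp add: field_def \<eta>_def power2_eq_square algebra_simps)
  have t11: "(2 * inner_dphi R \<phi> V x) *\<^sub>R tension R \<phi> x = field (- 2 * m\<^sup>2 * \<alpha>) (- 2 * m\<^sup>2) 0 (- m * (m - 1)) 0 0 x"
  proof -
    have "inner_dphi R \<phi> V x = m * \<alpha> + (m * 1 - m * \<kappa> * 0) * f x + (m * 1 - (m + 1) / 2 * 1 - m * \<kappa> * 0) * h x"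
      by (rule inner_dphi_field[OF x V])
    then have "2 * inner_dphi R \<phi> V x = 2 * m * \<alpha> + 2 * m * f x + (m - 1) * h x"
      by (simp add: field_simps)
    then show ?thesis
      by (simp add: tension_phi[OF x] field_scale) (simp add: field_def power2_eq_square algebra_simps)
  qed
  have km: "m * \<kappa> = m - \<kappa>" by (rule m_kappa)
  show ?thesis
    unfolding second_variation_op_def JJV JT dt tt t5 t6 t7 TJV TTV TV[OF x] t11 JV[OF x] energy_density_phi[OF x]
    unfolding V[OF x]
    by (simp only: field_scale field_add field_diff, rule field_cong)
      (use km in \<open>simp_all add: power2_eq_square algebra_simps\<close>)
qed

proposition second_variation_integrand:
  assumes x: "x \<in> sphere 0 R" and V: "\<And>y. y \<in> sphere 0 R \<Longrightarrow> V y = field \<alpha> 1 0 1 1 0 y"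
  shows "second_variation_op R \<phi> V x \<bullet> V x =
    (- 4 * m\<^sup>2 * \<alpha> + ((m * \<kappa>)\<^sup>2 + 4 * (m * \<kappa>) - 4 * m\<^sup>2) * f x - 2 * m * (m - 1) * h x) * (\<alpha> + f x + h x)
    - 2 * (b \<bullet> A x - \<kappa> * f x * h x) + 2 * (m - 1) * (R\<^sup>2 * (A x \<bullet> A x) - (h x)\<^sup>2)"
proof -
  have I: "second_variation_op R \<phi> V x =
    field (- 4 * m\<^sup>2 * \<alpha>) ((m * \<kappa>)\<^sup>2 + 4 * (m * \<kappa>) - 4 * m\<^sup>2) (- 4 * \<kappa>)
      (- 2 * m * (m - 1)) (8 * \<kappa> * (m - 1)) 0 x"
    by (rule second_variation_op_field[OF x V])
  let ?Z1 = "Z (- 4 * \<kappa>) (8 * \<kappa> * (m - 1)) 0 x" and ?Z2 = "Z 0 1 0 x"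
  define c where "c = - 4 * m\<^sup>2 * \<alpha> + ((m * \<kappa>)\<^sup>2 + 4 * (m * \<kappa>) - 4 * m\<^sup>2) * f x - 2 * m * (m - 1) * h x"
  have I': "second_variation_op R \<phi> V x = c *\<^sub>R \<eta> x + \<Phi>' x ?Z1"
    unfolding I field_split[OF x] c_def by simp
  have V': "V x = (\<alpha> + f x + h x) *\<^sub>R \<eta> x + \<Phi>' x ?Z2"
    unfolding V[OF x] field_split[OF x] by simp
  have perp: "\<Phi>' x u \<bullet> \<eta> x = 0" if "u \<bullet> x = 0" for u
    using eta_values(3)[OF x that] by (simp add: inner_commute)
  have "second_variation_op R \<phi> V x \<bullet> V x = c * (\<alpha> + f x + h x) + ?Z1 \<bullet> ?Z2"
    unfolding I' V'
    by (simp add: inner_add_left inner_add_right eta_values(1)[OF x] eta_values(3)[OF x Z_tangent[OF x]]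
        Phi_isometry[OF x Z_tangent[OF x] Z_tangent[OF x]] perp[OF Z_tangent[OF x]])
  moreover have "?Z1 \<bullet> ?Z2 = - 2 * (b \<bullet> A x - \<kappa> * f x * h x) + 2 * (m - 1) * (R\<^sup>2 * (A x \<bullet> A x) - (h x)\<^sup>2)"
  proof -
    define w where "w = A x - (\<kappa> * h x) *\<^sub>R x"
    have xx: "\<kappa> * (x \<bullet> x) = 1"
      using kappa_R_square(1) by (simp only: sphere_inner[OF x])
    have wx: "x \<bullet> w = 0"
    proof -
      have "x \<bullet> w = h x - h x * (\<kappa> * (x \<bullet> x))"
        by (simp add: w_def inner_diff_right h_def)
      then show ?thesis by (simp add: xx)
    qed
    have bw: "b \<bullet> w = b \<bullet> A x - \<kappa> * f x * h x"
      by (simp add: w_def inner_diff_right f_def)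
    have "w \<bullet> w = A x \<bullet> w - \<kappa> * h x * (x \<bullet> w)"
      by (subst w_def) (simp add: inner_diff_left)
    also have "\<dots> = A x \<bullet> A x - \<kappa> * (h x)\<^sup>2"
      unfolding wx by (simp add: w_def inner_diff_right h_def A_self power2_eq_square)
    finally have ww: "w \<bullet> w = A x \<bullet> A x - \<kappa> * (h x)\<^sup>2" .
    have "?Z2 = (R\<^sup>2 / 2) *\<^sub>R w"
      by (simp add: Z_def w_def)
    moreover have "?Z1 = (- 4 * \<kappa>) *\<^sub>R (b - (\<kappa> * f x) *\<^sub>R x) + (4 * (m - 1)) *\<^sub>R w"
    proof -
      have "8 * \<kappa> * (m - 1) * R\<^sup>2 / 2 + 0 * \<kappa> = 4 * (m - 1) * (\<kappa> * R\<^sup>2)" by simp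
      then show ?thesis unfolding Z_def w_def kappa_R_square(1) by simp
    qed
    ultimately have "?Z1 \<bullet> ?Z2 = (R\<^sup>2 / 2) * (- 4 * \<kappa> * (b \<bullet> w - \<kappa> * f x * (x \<bullet> w)) + 4 * (m - 1) * (w \<bullet> w))"
      by (simp add: inner_add_left inner_diff_left)
    also have "\<dots> = - 2 * (R\<^sup>2 * \<kappa>) * (b \<bullet> w) + 2 * (m - 1) * (R\<^sup>2 * (w \<bullet> w))"
      unfolding wx by (simp add: field_simps)
    also have "R\<^sup>2 * (w \<bullet> w) = R\<^sup>2 * (A x \<bullet> A x) - (h x)\<^sup>2"
      by (simp add: ww right_diff_distrib kappa_R_cancel)
    finally show ?thesis by (simp add: kappa_R_square(2) bw)
  qed
  ultimately show ?thesis by (simp add: c_def)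
qed

end

end

section \<open>Smoothness\<close>

lemma Ck_on_Suc_D: "Ck_on (Suc k) g U \<Longrightarrow> Ck_on k g U"
proof (induction k arbitrary: g)
  case 0
  then show ?case
    by (auto intro!: continuous_at_imp_continuous_on differentiable_imp_continuous_within)
next
  case (Suc k)
  then show ?case by (metis Ck_on.simps(2))
qed

lemma Ck_on_SucI:
  assumes "\<And>x. (g has_derivative g' x) (at x)" and "\<And>v. Ck_on k (\<lambda>x. g' x v) UNIV"
  shows "Ck_on (Suc k) g UNIV"
proof -
  have "frechet_derivative g (at x) = g' x" for x
    using frechet_derivative_at[OF assms(1)] by simp
  then show ?thesis
    using assms by (auto simp: differentiable_def)
qed

lemma Ck_on_SucE:
  assumes "Ck_on (Suc k) g UNIV"
  obtains g' where "\<And>x. (g has_derivative g' x) (at x)" and "\<And>v. Ck_on k (\<lambda>x. g' x v) UNIV"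
proof
  show "(g has_derivative frechet_derivative g (at x)) (at x)" for x
    using assms frechet_derivative_works by auto
  show "Ck_on k (\<lambda>x. frechet_derivative g (at x) v) UNIV" for v
    using assms by simp
qed

lemma Ck_on_const: "Ck_on k (\<lambda>x. c) UNIV"
proof (induction k arbitrary: c)
  case (Suc k)
  show ?case by (rule Ck_on_SucI[OF has_derivative_const Suc])
qed simp

lemma Ck_on_linear:
  assumes "bounded_linear g"
  shows "Ck_on k g UNIV"
proof (cases k)
  case 0
  then show ?thesis using assms by (simp add: linear_continuous_on)
next
  case (Suc j)
  then show ?thesis
    using Ck_on_SucI[OF bounded_linear_imp_has_derivative[OF assms] Ck_on_const] by simp
qed

lemma Ck_on_add: "Ck_on k g1 UNIV \<Longrightarrow> Ck_on k g2 UNIV \<Longrightarrow> Ck_on k (\<lambda>x. g1 x + g2 x) UNIV"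
proof (induction k arbitrary: g1 g2)
  case 0
  then show ?case by (simp add: continuous_on_add)
next
  case (Suc k)
  obtain g1' where 1: "\<And>x. (g1 has_derivative g1' x) (at x)" "\<And>v. Ck_on k (\<lambda>x. g1' x v) UNIV"
    using Ck_on_SucE[OF Suc.prems(1)] by blast
  obtain g2' where 2: "\<And>x. (g2 has_derivative g2' x) (at x)" "\<And>v. Ck_on k (\<lambda>x. g2' x v) UNIV"
    using Ck_on_SucE[OF Suc.prems(2)] by blast
  show ?case
    by (rule Ck_on_SucI[OF has_derivative_add[OF 1(1) 2(1)]]) (rule Suc.IH[OF 1(2) 2(2)])
qed

lemma Ck_on_bilinear:
  fixes prod :: "'b::euclidean_space \<Rightarrow> 'c::euclidean_space \<Rightarrow> 'd::euclidean_space"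
  assumes "bounded_bilinear prod"
  shows "Ck_on k g1 UNIV \<Longrightarrow> Ck_on k g2 UNIV \<Longrightarrow> Ck_on k (\<lambda>x. prod (g1 x) (g2 x)) UNIV"
proof (induction k arbitrary: g1 g2)
  case 0
  then show ?case using bounded_bilinear.continuous_on[OF assms] by simp
next
  case (Suc k)
  obtain g1' where 1: "\<And>x. (g1 has_derivative g1' x) (at x)" "\<And>v. Ck_on k (\<lambda>x. g1' x v) UNIV"
    using Ck_on_SucE[OF Suc.prems(1)] by blast
  obtain g2' where 2: "\<And>x. (g2 has_derivative g2' x) (at x)" "\<And>v. Ck_on k (\<lambda>x. g2' x v) UNIV"
    using Ck_on_SucE[OF Suc.prems(2)] by blast
  show ?case
    by (rule Ck_on_SucI[OF bounded_bilinear.FDERIV[OF assms 1(1) 2(1)]])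
      (intro Ck_on_add Suc.IH 1(2) 2(2) Ck_on_Suc_D[OF Suc.prems(1)] Ck_on_Suc_D[OF Suc.prems(2)])
qed

lemma Ck_on_bounded_linear_compose:
  fixes L :: "'b::euclidean_space \<Rightarrow> 'c::euclidean_space"
  assumes "bounded_linear L"
  shows "Ck_on k g UNIV \<Longrightarrow> Ck_on k (\<lambda>x. L (g x)) UNIV"
proof (induction k arbitrary: g)
  case 0
  then show ?case using bounded_linear.continuous_on[OF assms] by simp
next
  case (Suc k)
  obtain g' where g: "\<And>x. (g has_derivative g' x) (at x)" "\<And>v. Ck_on k (\<lambda>x. g' x v) UNIV"
    using Ck_on_SucE[OF Suc.prems] by blast
  show ?case
    by (rule Ck_on_SucI[OF bounded_linear.has_derivative[OF assms g(1)]]) (rule Suc.IH[OF g(2)])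
qed

lemma Ck_on_Pair: 
  fixes g1 :: "'a::euclidean_space \<Rightarrow> 'b::euclidean_space" and g2 :: "'a \<Rightarrow> 'c::euclidean_space"
  assumes "Ck_on k g1 UNIV" "Ck_on k g2 UNIV"
  shows "Ck_on k (\<lambda>x. (g1 x, g2 x)) UNIV"
proof -
  have "bounded_linear (\<lambda>v. (v, 0 :: 'c))" "bounded_linear (\<lambda>v. (0 :: 'b, v))"
    by (intro bounded_linear_Pair bounded_linear_ident bounded_linear_zero)+
  from Ck_on_add[OF Ck_on_bounded_linear_compose[OF this(1) assms(1)] Ck_on_bounded_linear_compose[OF this(2) assms(2)]]
  show ?thesis by simp
qed

context veronese_fields
begin

lemma Ck_on_field: "Ck_on k (field p0 p1 p2 q1 q2 q3) UNIV"
proof -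
  have id: "Ck_on k (\<lambda>x::'a. x) UNIV" and f: "Ck_on k (\<lambda>x. b \<bullet> x) UNIV" and A: "Ck_on k A UNIV"
    by (intro Ck_on_linear bounded_linear_ident bounded_linear_inner_right bounded_linear_A)+
  have h: "Ck_on k (\<lambda>x. x \<bullet> A x) UNIV"
    by (rule Ck_on_bilinear[OF bounded_bilinear_inner id A])
  have s: "Ck_on k (\<lambda>x. p0 + c1 * (b \<bullet> x) + c2 * (x \<bullet> A x)) UNIV" for p0 c1 c2
    by (intro Ck_on_add Ck_on_const Ck_on_bilinear[OF bounded_bilinear_mult] f h)
  show ?thesis
    unfolding field_expand[abs_def] Let_def f_def h_def
    by (intro Ck_on_Pair Ck_on_add Ck_on_bilinear[OF bounded_bilinear_scaleR] Ck_on_bilinear[OF bilinear_Q]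
        Ck_on_bilinear[OF bounded_bilinear_mult] Ck_on_bounded_linear_compose[OF bounded_linear_minus[OF bounded_linear_ident]]
        Ck_on_const s id A)
qed

end

section \<open>Orthogonal invariance of the sphere measure\<close>

text \<open>Lebesgue measure is invariant under orthogonal maps. The proof is that of the uniqueness of Haar
  measure: for a Borel set \<open>S\<close> and the unit ball \<open>B\<close>, the integral of the indicator of
  \<open>T x + y \<in> S\<close> and \<open>y \<in> B\<close> is evaluated in both orders, using that translations preserve the measure
  and that \<open>T\<close> preserves the norm.\<close>

lemma lborel_distr_orthogonal:
  fixes T :: "'a::euclidean_space \<Rightarrow> 'a"
  assumes T: "orthogonal_transformation T"
  shows "distr lborel borel T = (lborel :: 'a measure)"
proof (rule measure_eqI)
  have lin: "linear T" and nrm: "norm (T x) = norm x" for x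
    using T by (auto simp: orthogonal_transformation)
  have [measurable]: "T \<in> borel_measurable borel"
    using lin by (intro borel_measurable_continuous_onI linear_continuous_on) (simp add: linear_conv_bounded_linear)
  have surj: "\<exists>c. T c = y" for y
    using orthogonal_transformation_surj[OF T] by (metis surjD)
  have shift: "(\<integral>\<^sup>+x. g x \<partial>lborel) = (\<integral>\<^sup>+x. g (c + x) \<partial>lborel)"
    if [measurable]: "g \<in> borel_measurable borel" for g :: "'a \<Rightarrow> ennreal" and c
  proof -
    have "(\<integral>\<^sup>+x. g x \<partial>lborel) = (\<integral>\<^sup>+x. g x \<partial>distr lborel borel ((+) c))"
      by (simp only: lborel_distr_plus)
    also have "\<dots> = (\<integral>\<^sup>+x. g (c + x) \<partial>lborel)"
      by (rule nn_integral_distr) simp_all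
    finally show ?thesis .
  qed
  fix S assume "S \<in> sets (distr lborel borel T)"
  then have [measurable]: "S \<in> sets borel" by simp
  define B where "B = ball (0::'a) 1"
  have [measurable]: "B \<in> sets borel" by (simp add: B_def)
  have "emeasure (distr lborel borel T) S * emeasure lborel B
      = (\<integral>\<^sup>+y. \<integral>\<^sup>+x. indicator S (T x) * indicator B y \<partial>lborel \<partial>lborel)"
  proof -
    have "emeasure (distr lborel borel T) S = (\<integral>\<^sup>+x. indicator S (T x) \<partial>lborel)"
    proof -
      have "emeasure (distr lborel borel T) S = emeasure lborel (T -` S)"
        by (subst emeasure_distr) auto
      also have "\<dots> = (\<integral>\<^sup>+x. indicator (T -` S) x \<partial>lborel)"
        by (rule nn_integral_indicator[symmetric]) (use measurable_sets[of T borel borel S] in simp)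
      also have "\<dots> = (\<integral>\<^sup>+x. indicator S (T x) \<partial>lborel)"
        by (simp add: indicator_def)
      finally show ?thesis .
    qed
    then show ?thesis
      by (simp add: nn_integral_multc nn_integral_cmult_indicator)
  qed
  also have "\<dots> = (\<integral>\<^sup>+y. \<integral>\<^sup>+x. indicator S (T x + y) * indicator B y \<partial>lborel \<partial>lborel)"
  proof (rule nn_integral_cong)
    fix y :: 'a
    obtain c where c: "T c = y" using surj by blast
    show "(\<integral>\<^sup>+x. indicator S (T x) * indicator B y \<partial>lborel) =
        (\<integral>\<^sup>+x. indicator S (T x + y) * indicator B y \<partial>lborel)"
      using shift[of "\<lambda>x. indicator S (T x) * indicator B y" c]
      by (simp add: linear_add[OF lin] c add.commute)
  qed
  also have "\<dots> = (\<integral>\<^sup>+x. \<integral>\<^sup>+y. indicator S (T x + y) * indicator B y \<partial>lborel \<partial>lborel)"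
    by (rule lborel_pair.Fubini') measurable
  also have "\<dots> = (\<integral>\<^sup>+x. \<integral>\<^sup>+y. indicator S y * indicator B (y - T x) \<partial>lborel \<partial>lborel)"
  proof (rule nn_integral_cong)
    fix x :: 'a
    show "(\<integral>\<^sup>+y. indicator S (T x + y) * indicator B y \<partial>lborel) =
        (\<integral>\<^sup>+y. indicator S y * indicator B (y - T x) \<partial>lborel)"
      using shift[of "\<lambda>y. indicator S y * indicator B (y - T x)" "T x"] by simp
  qed
  also have "\<dots> = (\<integral>\<^sup>+y. \<integral>\<^sup>+x. indicator S y * indicator B (y - T x) \<partial>lborel \<partial>lborel)"
    by (rule lborel_pair.Fubini') measurable
  also have "\<dots> = (\<integral>\<^sup>+y. indicator S y * emeasure lborel B \<partial>lborel)"
  proof (rule nn_integral_cong)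
    fix y :: 'a
    obtain c where c: "T c = y" using surj by blast
    have "indicator B (y - T x) = (indicator B (- c + x) :: ennreal)" for x
    proof -
      have "norm (y - T x) = norm (T (c - x))" by (simp add: linear_diff[OF lin] c)
      also have "\<dots> = norm (- c + x)" by (simp add: nrm norm_minus_commute)
      finally show ?thesis by (simp add: indicator_def B_def)
    qed
    then have "(\<integral>\<^sup>+x. indicator B (y - T x) \<partial>lborel) = (\<integral>\<^sup>+x. indicator B (- c + x) \<partial>lborel)"
      by simp
    also have "\<dots> = emeasure lborel B"
      using shift[of "indicator B" "- c"] by simp
    finally show "(\<integral>\<^sup>+x. indicator S y * indicator B (y - T x) \<partial>lborel) = indicator S y * emeasure lborel B"
      by (simp add: nn_integral_cmult)
  qed
  also have "\<dots> = emeasure lborel S * emeasure lborel B"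
    by (simp add: nn_integral_multc)
  finally have "emeasure (distr lborel borel T) S * emeasure lborel B = emeasure lborel S * emeasure lborel B" .
  moreover have "emeasure lborel B \<noteq> 0"
    using content_ball_pos[of 1 "0::'a"] by (auto simp: measure_def B_def)
  moreover have "emeasure lborel B \<noteq> \<infinity>"
    using emeasure_bounded_finite[of B] by (auto simp: B_def)
  ultimately show "emeasure (distr lborel borel T) S = emeasure lborel S"
    by (simp add: mult.commute[of _ "emeasure lborel B"] ennreal_mult_cancel_left)
qed simp

text \<open>The radial projection that defines the measure of the sphere.\<close>

definition radial :: "real \<Rightarrow> 'a::euclidean_space \<Rightarrow> 'a" where
  "radial R x = (R / norm x) *\<^sub>R x"

context
  fixes R :: real
  assumes R: "R > 0"
begin

lemma radial_measurable:
  "radial R \<in> measurable (restrict_space lborel (cball 0 R - {0})) (restrict_space borel (sphere (0::'a::euclidean_space) R))"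
proof (rule measurable_restrict_space2)
  show "radial R \<in> space (restrict_space lborel (cball 0 R - {0})) \<rightarrow> sphere (0::'a) R"
    using R by (auto simp: radial_def space_restrict_space)
  have "radial R \<in> borel_measurable (borel :: 'a measure)"
    unfolding radial_def by measurable
  then show "radial R \<in> borel_measurable (restrict_space lborel (cball 0 R - {0::'a}))"
    by (intro measurable_restrict_space1) simp
qed

lemma sphere_measure_eq:
  "sphere_measure R = scale_measure (ennreal (DIM('a) / R))
     (distr (restrict_space lborel (cball 0 R - {0})) (restrict_space borel (sphere 0 R)) (radial R :: 'a::euclidean_space \<Rightarrow> 'a))"
  by (simp add: sphere_measure_def radial_def[abs_def])

lemma space_sphere_measure: "space (sphere_measure R) = sphere (0::'a::euclidean_space) R"
  and sets_sphere_measure: "sets (sphere_measure R) = sets (restrict_space borel (sphere (0::'a) R))"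
  by (simp_all add: sphere_measure_eq space_scale_measure space_restrict_space)

lemma emeasure_sphere_measure:
  assumes A: "A \<in> sets (restrict_space borel (sphere (0::'a::euclidean_space) R))"
  shows "emeasure (sphere_measure R) A =
    ennreal (DIM('a) / R) * emeasure lborel (radial R -` A \<inter> (cball 0 R - {0}))"
proof -
  have "radial R -` A \<inter> (cball 0 R - {0}) \<in> sets (restrict_space lborel (cball 0 R - {0}))"
    using measurable_sets[OF radial_measurable A] by (simp add: space_restrict_space)
  then show ?thesis
    unfolding sphere_measure_eq using A
    by (subst emeasure_scale_measure, subst emeasure_distr[OF radial_measurable])
      (auto simp: space_restrict_space emeasure_restrict_space)
qed

lemma finite_sphere_measure: "finite_measure (sphere_measure R :: 'a::euclidean_space measure)"
proof
  have "emeasure lborel (radial R -` sphere (0::'a) R \<inter> (cball 0 R - {0})) \<le> emeasure lborel (cball (0::'a) R)"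
    by (intro emeasure_mono) auto
  also have "\<dots> < \<infinity>"
    using emeasure_bounded_finite[of "cball (0::'a) R"] by auto
  finally show "emeasure (sphere_measure R :: 'a measure) (space (sphere_measure R)) \<noteq> \<infinity>"
    unfolding space_sphere_measure
    by (subst emeasure_sphere_measure) (auto simp: ennreal_mult_eq_top_iff sets_restrict_space_iff)
qed

lemma measure_sphere_pos: "measure (sphere_measure R) (sphere (0::'a::euclidean_space) R) > 0"
proof -
  have "emeasure lborel (ball (0::'a) R) \<le> emeasure lborel (insert 0 (cball (0::'a) R - {0}))"
    by (intro emeasure_mono) auto
  also have "\<dots> \<le> emeasure lborel {0::'a} + emeasure lborel (cball (0::'a) R - {0})"
    by (subst insert_is_Un, intro emeasure_subadditive) auto
  finally have "emeasure lborel (cball (0::'a) R - {0}) \<noteq> 0"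
    using content_ball_pos[OF R, of "0::'a"] by (auto simp: measure_def)
  moreover have "radial R -` sphere 0 R \<inter> (cball 0 R - {0}) = cball (0::'a) R - {0}"
    using R by (auto simp: radial_def)
  ultimately have "emeasure (sphere_measure R) (sphere (0::'a) R) \<noteq> 0"
    using R by (subst emeasure_sphere_measure)
      (auto simp: sets_restrict_space_iff ennreal_eq_0_iff not_le intro!: divide_pos_pos)
  then show ?thesis
    using finite_measure.emeasure_eq_measure[OF finite_sphere_measure, of "sphere (0::'a) R"]
    by (simp add: zero_less_measure_iff)
qed

lemma sphere_measure_orthogonal_invariant:
  fixes T :: "'a::euclidean_space \<Rightarrow> 'a"
  assumes T: "orthogonal_transformation T"
  shows "distr (sphere_measure R) (restrict_space borel (sphere 0 R)) T = sphere_measure R"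
proof (rule measure_eqI)
  show "sets (distr (sphere_measure R) (restrict_space borel (sphere 0 R)) T) = sets (sphere_measure R)"
    by (simp add: sets_sphere_measure)
  have lin: "linear T" and nrm: "norm (T x) = norm x" for x
    using T by (auto simp: orthogonal_transformation)
  have Tb: "T \<in> borel_measurable borel"
    using lin by (intro borel_measurable_continuous_onI linear_continuous_on) (simp add: linear_conv_bounded_linear)
  have Tm: "T \<in> measurable (sphere_measure R) (restrict_space borel (sphere 0 R))"
    unfolding measurable_cong_sets[OF sets_sphere_measure refl]
    by (rule measurable_restrict_space2) (auto simp: space_restrict_space nrm intro: measurable_restrict_space1 Tb)
  fix A assume "A \<in> sets (distr (sphere_measure R) (restrict_space borel (sphere 0 R)) T)"
  then have A: "A \<in> sets (restrict_space borel (sphere 0 R))" by simp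
  let ?C = "cball 0 R - {0::'a}"
  have TA: "T -` A \<inter> sphere 0 R \<in> sets (restrict_space borel (sphere 0 R))"
    using measurable_sets[OF Tm A] by (simp add: space_sphere_measure sets_sphere_measure)
  have rT: "radial R (T x) = T (radial R x)" for x
    by (simp add: radial_def nrm linear_cmul[OF lin])
  have eq: "radial R -` (T -` A \<inter> sphere 0 R) \<inter> ?C = T -` (radial R -` A \<inter> ?C)"
  proof -
    have "T x = 0 \<longleftrightarrow> x = 0" for x using nrm[of x] by auto
    moreover have "radial R x \<in> sphere 0 R" if "x \<noteq> 0" for x
      using that R by (simp add: radial_def)
    ultimately show ?thesis by (auto simp: rT nrm)
  qed
  have rA: "radial R -` A \<inter> ?C \<in> sets borel"
    using measurable_sets[OF radial_measurable A]
    by (simp add: space_restrict_space sets_restrict_space_iff)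
  have "emeasure (distr (sphere_measure R) (restrict_space borel (sphere 0 R)) T) A =
      emeasure (sphere_measure R) (T -` A \<inter> sphere 0 R)"
    by (simp add: emeasure_distr[OF Tm A] space_sphere_measure)
  also have "\<dots> = ennreal (DIM('a) / R) * emeasure lborel (T -` (radial R -` A \<inter> ?C))"
    unfolding emeasure_sphere_measure[OF TA] eq ..
  also have "emeasure lborel (T -` (radial R -` A \<inter> ?C)) = emeasure (distr lborel borel T) (radial R -` A \<inter> ?C)"
    by (subst emeasure_distr) (use Tb rA in auto)
  also have "\<dots> = emeasure lborel (radial R -` A \<inter> ?C)"
    by (simp add: lborel_distr_orthogonal[OF T])
  also have "ennreal (DIM('a) / R) * \<dots> = emeasure (sphere_measure R) A"
    by (simp add: emeasure_sphere_measure[OF A])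
  finally show "emeasure (distr (sphere_measure R) (restrict_space borel (sphere 0 R)) T) A = emeasure (sphere_measure R) A" .
qed

lemma measurable_sphere:
  "continuous_on UNIV g \<Longrightarrow> g \<in> borel_measurable (restrict_space borel (sphere (0::'a::euclidean_space) R))"
  by (intro measurable_restrict_space1 borel_measurable_continuous_onI)

lemma integral_sphere_orthogonal:
  fixes T :: "'a::euclidean_space \<Rightarrow> 'a" and g :: "'a \<Rightarrow> real"
  assumes T: "orthogonal_transformation T" and g: "continuous_on UNIV g"
  shows "(\<integral>x. g (T x) \<partial>sphere_measure R) = (\<integral>x. g x \<partial>sphere_measure R)"
proof -
  have lin: "linear T" and nrm: "norm (T x) = norm x" for x
    using T by (auto simp: orthogonal_transformation)
  have Tb: "T \<in> borel_measurable borel"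
    using lin by (intro borel_measurable_continuous_onI linear_continuous_on) (simp add: linear_conv_bounded_linear)
  have Tm: "T \<in> measurable (sphere_measure R) (restrict_space borel (sphere 0 R))"
    unfolding measurable_cong_sets[OF sets_sphere_measure refl]
    by (rule measurable_restrict_space2) (auto simp: space_restrict_space nrm intro: measurable_restrict_space1 Tb)
  have "(\<integral>x. g x \<partial>sphere_measure R) = (\<integral>x. g x \<partial>distr (sphere_measure R) (restrict_space borel (sphere 0 R)) T)"
    by (simp add: sphere_measure_orthogonal_invariant[OF T])
  also have "\<dots> = (\<integral>x. g (T x) \<partial>sphere_measure R)"
    by (rule integral_distr[OF Tm measurable_sphere[OF g]])
  finally show ?thesis ..
qed

lemma integrable_sphere:
  fixes g :: "'a::euclidean_space \<Rightarrow> real"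
  assumes g: "continuous_on UNIV g"
  shows "integrable (sphere_measure R) g"
proof -
  have "bounded (g ` sphere 0 R)"
    by (intro compact_imp_bounded compact_continuous_image continuous_on_subset[OF g]) auto
  then obtain B where "\<forall>y\<in>g ` sphere 0 R. norm y \<le> B"
    unfolding bounded_iff by (elim exE)
  then have B: "\<And>x. x \<in> sphere 0 R \<Longrightarrow> norm (g x) \<le> B"
    by simp
  have "g \<in> borel_measurable (sphere_measure R)"
    unfolding measurable_cong_sets[OF sets_sphere_measure refl] by (rule measurable_sphere[OF g])
  then show ?thesis
    by (intro finite_measure.integrable_const_bound[OF finite_sphere_measure, of _ B] AE_I2)
      (use B in \<open>simp_all add: space_sphere_measure\<close>)
qed

end

section \<open>Moments of the sphere\<close>

context
  fixes R :: real
  assumes R: "R > 0"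
begin

lemma integral_sphere_odd:
  fixes g :: "'a::euclidean_space \<Rightarrow> real"
  assumes g: "continuous_on UNIV g" and odd: "\<And>x. g (- x) = - g x"
  shows "(\<integral>x. g x \<partial>sphere_measure R) = 0"
proof -
  have "(\<integral>x. g (- x) \<partial>sphere_measure R) = (\<integral>x. g x \<partial>sphere_measure R)"
    by (rule integral_sphere_orthogonal[OF R _ g]) (simp add: orthogonal_transformation_neg)
  then show ?thesis by (simp add: odd)
qed

lemma integral_sphere_cong:
  fixes g g' :: "'a::euclidean_space \<Rightarrow> real"
  assumes "\<And>x. x \<in> sphere 0 R \<Longrightarrow> g x = g' x"
  shows "(\<integral>x. g x \<partial>sphere_measure R) = (\<integral>x. g' x \<partial>sphere_measure R)"
  by (rule Bochner_Integration.integral_cong[OF refl]) (simp add: space_sphere_measure[OF R] assms)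

text \<open>Orthogonal maps act transitively on the vectors of given length, so the integral depends on the
  length of \<open>u\<close> only.\<close>

lemma integral_sphere_power:
  fixes k :: nat
  obtains c where "\<And>u :: real^'n. (\<integral>x. (u \<bullet> x) ^ k \<partial>sphere_measure R) = c * norm u ^ k"
proof -
  have rot: "(\<integral>x. (u \<bullet> x) ^ k \<partial>sphere_measure R) = (\<integral>x. (w \<bullet> x) ^ k \<partial>sphere_measure R)"
    if uw: "norm u = norm w" for u w :: "real^'n"
  proof -
    obtain T where T: "orthogonal_transformation T" and Tu: "T u = w"
      using orthogonal_transformation_exists[OF uw] .
    have "(\<integral>x. (w \<bullet> T x) ^ k \<partial>sphere_measure R) = (\<integral>x. (w \<bullet> x) ^ k \<partial>sphere_measure R)"
      by (rule integral_sphere_orthogonal[OF R T]) (intro continuous_intros)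
    moreover have "w \<bullet> T x = u \<bullet> x" for x
      using T Tu by (auto simp: orthogonal_transformation_def)
    ultimately show ?thesis by simp
  qed
  obtain e :: "real^'n" where e: "norm e = 1"
    using vector_choose_size[of 1] by auto
  show ?thesis
  proof
    fix u :: "real^'n"
    have "(\<integral>x. (u \<bullet> x) ^ k \<partial>sphere_measure R) = (\<integral>x. ((norm u *\<^sub>R e) \<bullet> x) ^ k \<partial>sphere_measure R)"
      by (rule rot) (simp add: e)
    then show "(\<integral>x. (u \<bullet> x) ^ k \<partial>sphere_measure R) = (\<integral>x. (e \<bullet> x) ^ k \<partial>sphere_measure R) * norm u ^ k"
      by (simp add: power_mult_distrib)
  qed
qed

lemma sphere_sum_squares:
  fixes x :: "real^'n"
  shows "x \<in> sphere 0 R \<Longrightarrow> (\<Sum>i\<in>Basis. (i \<bullet> x)\<^sup>2) = R\<^sup>2"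
  using euclidean_inner[of x x] by (auto simp: power2_eq_square inner_commute dot_square_norm)

text \<open>The constant comes from summing the integrals of \<open>(i \<bullet> x)\<^sup>2\<close> over an orthonormal basis; the mixed
  moments follow by polarisation.\<close>

lemma integral_sphere_second_moment:
  fixes u w :: "real^'n"
  shows "(\<integral>x. (u \<bullet> x) * (w \<bullet> x) \<partial>sphere_measure R) =
    R\<^sup>2 * measure (sphere_measure R) (sphere (0::real^'n) R) / CARD('n) * (u \<bullet> w)"
proof -
  obtain c where c: "\<And>u :: real^'n. (\<integral>x. (u \<bullet> x)\<^sup>2 \<partial>sphere_measure R) = c * (norm u)\<^sup>2"
    using integral_sphere_power[of 2] by metis
  have int: "integrable (sphere_measure R) (\<lambda>x. (u \<bullet> x)\<^sup>2)" for u :: "real^'n"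
    by (rule integrable_sphere[OF R]) (intro continuous_intros)
  have int2: "integrable (sphere_measure R) (\<lambda>x. (u \<bullet> x) * (w \<bullet> x))" for u w :: "real^'n"
    by (rule integrable_sphere[OF R]) (intro continuous_intros)
  have "(\<Sum>i\<in>(Basis::(real^'n) set). \<integral>x. (i \<bullet> x)\<^sup>2 \<partial>sphere_measure R) =
      (\<integral>x. (\<Sum>i\<in>Basis. (i \<bullet> (x::real^'n))\<^sup>2) \<partial>sphere_measure R)"
    by (rule Bochner_Integration.integral_sum[symmetric]) (rule int)
  also have "\<dots> = (\<integral>x. R\<^sup>2 \<partial>(sphere_measure R :: (real^'n) measure))"
    by (rule integral_sphere_cong) (rule sphere_sum_squares)
  also have "\<dots> = R\<^sup>2 * measure (sphere_measure R) (sphere (0::real^'n) R)"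
    by (simp add: space_sphere_measure[OF R])
  finally have "CARD('n) * c = R\<^sup>2 * measure (sphere_measure R) (sphere (0::real^'n) R)"
    by (simp add: c)
  then have c': "c = R\<^sup>2 * measure (sphere_measure R) (sphere (0::real^'n) R) / CARD('n)"
    by (simp add: field_simps)
  have "c * (norm (u + w))\<^sup>2 = (\<integral>x. (u \<bullet> x)\<^sup>2 + (w \<bullet> x)\<^sup>2 + 2 * ((u \<bullet> x) * (w \<bullet> x)) \<partial>sphere_measure R)"
    unfolding c[symmetric] by (simp add: inner_add_left power2_eq_square algebra_simps)
  also have "\<dots> = c * (norm u)\<^sup>2 + c * (norm w)\<^sup>2 + 2 * (\<integral>x. (u \<bullet> x) * (w \<bullet> x) \<partial>sphere_measure R)"
    by (simp add: int int2 c)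
  finally show ?thesis
    unfolding c'[symmetric] by (simp add: power2_norm_eq_inner inner_add_left inner_add_right inner_commute algebra_simps)
qed

text \<open>Polarisation of \<open>\<integral>(u \<bullet> x)\<^sup>4 = c |u|\<^sup>4\<close>; the constant \<open>c\<close> is found by summing over an orthonormal basis
  in the place of \<open>w\<close>, which gives a second moment.\<close>

lemma integral_sphere_fourth_moment:
  fixes u w :: "real^'n"
  shows "(\<integral>x. ((u \<bullet> x) * (w \<bullet> x))\<^sup>2 \<partial>sphere_measure R) =
    R ^ 4 * measure (sphere_measure R) (sphere (0::real^'n) R) / (real CARD('n) * (real CARD('n) + 2))
      * ((norm u)\<^sup>2 * (norm w)\<^sup>2 + 2 * (u \<bullet> w)\<^sup>2)"
proof -
  define \<omega> where "\<omega> = measure (sphere_measure R) (sphere (0::real^'n) R)"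
  obtain c where c: "\<And>u :: real^'n. (\<integral>x. (u \<bullet> x) ^ 4 \<partial>sphere_measure R) = c * norm u ^ 4"
    using integral_sphere_power[of 4] by metis
  have int: "integrable (sphere_measure R) (\<lambda>x. (u \<bullet> x) ^ 4)" for u :: "real^'n"
    by (rule integrable_sphere[OF R]) (intro continuous_intros)
  have int2: "integrable (sphere_measure R) (\<lambda>x. ((u \<bullet> x) * (w \<bullet> x))\<^sup>2)" for u w :: "real^'n"
    by (rule integrable_sphere[OF R]) (intro continuous_intros)
  have m: "3 * (\<integral>x. ((u \<bullet> x) * (w \<bullet> x))\<^sup>2 \<partial>sphere_measure R) = c * ((norm u)\<^sup>2 * (norm w)\<^sup>2 + 2 * (u \<bullet> w)\<^sup>2)"
    for u w :: "real^'n"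
  proof -
    have "c * norm (u + w) ^ 4 + c * norm (u - w) ^ 4
        = (\<integral>x. (u \<bullet> x + w \<bullet> x) ^ 4 + (u \<bullet> x - w \<bullet> x) ^ 4 \<partial>sphere_measure R)"
      using int[of "u + w"] int[of "u - w"] unfolding c[symmetric] by (simp add: inner_add_left inner_diff_left)
    also have "\<dots> = (\<integral>x. 2 * (u \<bullet> x) ^ 4 + 2 * (w \<bullet> x) ^ 4 + 12 * ((u \<bullet> x) * (w \<bullet> x))\<^sup>2 \<partial>sphere_measure R)"
      by (intro Bochner_Integration.integral_cong refl) (simp add: power2_eq_square power4_eq_xxxx algebra_simps)
    also have "\<dots> = 2 * (c * norm u ^ 4) + 2 * (c * norm w ^ 4) + 12 * (\<integral>x. ((u \<bullet> x) * (w \<bullet> x))\<^sup>2 \<partial>sphere_measure R)"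
      by (simp add: int int2 c)
    finally have "12 * (\<integral>x. ((u \<bullet> x) * (w \<bullet> x))\<^sup>2 \<partial>sphere_measure R) =
        c * (norm (u + w) ^ 4 + norm (u - w) ^ 4 - 2 * norm u ^ 4 - 2 * norm w ^ 4)"
      by (simp add: algebra_simps)
    also have "norm (u + w) ^ 4 + norm (u - w) ^ 4 - 2 * norm u ^ 4 - 2 * norm w ^ 4
        = 4 * ((norm u)\<^sup>2 * (norm w)\<^sup>2 + 2 * (u \<bullet> w)\<^sup>2)"
    proof -
      have n4: "norm z ^ 4 = (z \<bullet> z) * (z \<bullet> z)" for z :: "real^'n"
        by (simp add: dot_square_norm power2_eq_square power4_eq_xxxx)
      show ?thesis
        unfolding n4 power2_norm_eq_inner
        by (simp add: inner_add_left inner_add_right inner_diff_left inner_diff_right inner_commute[of w u]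
            power2_eq_square algebra_simps)
    qed
    finally show ?thesis by (simp add: algebra_simps)
  qed
  obtain e :: "real^'n" where e: "norm e = 1"
    using vector_choose_size[of 1] by auto
  have "R\<^sup>2 * (R\<^sup>2 * \<omega> / CARD('n)) = (\<integral>x. R\<^sup>2 * ((e \<bullet> x) * (e \<bullet> x)) \<partial>sphere_measure R)"
    by (simp add: integral_sphere_second_moment \<omega>_def dot_square_norm e)
  also have "\<dots> = (\<integral>x. (\<Sum>i\<in>Basis. ((e \<bullet> x) * (i \<bullet> x))\<^sup>2) \<partial>sphere_measure R)"
  proof (rule integral_sphere_cong)
    fix x :: "real^'n" assume x: "x \<in> sphere 0 R"
    have "(\<Sum>i\<in>Basis. ((e \<bullet> x) * (i \<bullet> x))\<^sup>2) = (e \<bullet> x)\<^sup>2 * (\<Sum>i\<in>Basis. (i \<bullet> x)\<^sup>2)"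
      by (simp add: power_mult_distrib sum_distrib_left)
    then show "R\<^sup>2 * ((e \<bullet> x) * (e \<bullet> x)) = (\<Sum>i\<in>Basis. ((e \<bullet> x) * (i \<bullet> x))\<^sup>2)"
      unfolding sphere_sum_squares[OF x] by (simp add: power2_eq_square)
  qed
  also have "\<dots> = (\<Sum>i\<in>Basis. \<integral>x. ((e \<bullet> x) * (i \<bullet> x))\<^sup>2 \<partial>sphere_measure R)"
    by (rule Bochner_Integration.integral_sum) (rule int2)
  also have "3 * \<dots> = (\<Sum>i\<in>Basis. c * ((norm e)\<^sup>2 * (norm i)\<^sup>2 + 2 * (e \<bullet> i)\<^sup>2))"
    unfolding sum_distrib_left m ..
  also have "\<dots> = c * (CARD('n) + 2)"
  proof -
    have "(\<Sum>i\<in>Basis. (e \<bullet> i)\<^sup>2) = e \<bullet> e"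
      by (simp add: euclidean_inner[of e e] power2_eq_square)
    then show ?thesis
      by (simp add: e dot_square_norm sum.distrib flip: sum_distrib_left)
  qed
  finally have "c / 3 * (real CARD('n) + 2) = R ^ 4 * \<omega> / CARD('n)"
    by (simp add: power2_eq_square power4_eq_xxxx mult_ac)
  then have "c / 3 = R ^ 4 * \<omega> / CARD('n) / (real CARD('n) + 2)"
    by (subst eq_divide_eq) simp
  then have c3: "c / 3 = R ^ 4 * \<omega> / (real CARD('n) * (real CARD('n) + 2))"
    by simp
  show ?thesis
    using m[of u w] unfolding c3[symmetric] \<omega>_def[symmetric] by simp
qed

end

section \<open>Integrals of a trace-free quadratic form\<close>

text \<open>The trace-free part of the symmetric operator \<open>x \<mapsto> (c \<bullet> x) e + (e \<bullet> x) c\<close>.\<close>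

definition sym_op :: "'a::euclidean_space \<Rightarrow> 'a \<Rightarrow> 'a \<Rightarrow> 'a" where
  "sym_op e c x = (c \<bullet> x) *\<^sub>R e + (e \<bullet> x) *\<^sub>R c - (2 * (e \<bullet> c) / DIM('a)) *\<^sub>R x"

lemma linear_sym_op: "linear (sym_op e c)"
  by (auto intro!: linearI simp: sym_op_def inner_add_right algebra_simps)

lemma sym_op_self: "sym_op e c x \<bullet> y = x \<bullet> sym_op e c y"
  by (simp add: sym_op_def inner_add_left inner_add_right inner_diff_left inner_diff_right inner_commute[of x e]
      inner_commute[of x c] mult.commute)

lemma sym_op_trace: "(\<Sum>i\<in>Basis. i \<bullet> sym_op e c i) = 0" for e c :: "'a::euclidean_space"
proof -
  have "(\<Sum>i\<in>Basis. i \<bullet> sym_op e c i) = (\<Sum>i\<in>(Basis::'a set). 2 * ((e \<bullet> i) * (c \<bullet> i)) - 2 * (e \<bullet> c) / DIM('a))"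
  proof (rule sum.cong)
    fix i :: 'a assume "i \<in> Basis"
    then show "i \<bullet> sym_op e c i = 2 * ((e \<bullet> i) * (c \<bullet> i)) - 2 * (e \<bullet> c) / DIM('a)"
      by (simp add: sym_op_def inner_add_right inner_diff_right inner_commute[of i e] inner_commute[of i c])
  qed simp
  also have "\<dots> = 0"
    by (simp add: sum_subtractf euclidean_inner[of e c] flip: sum_distrib_left)
  finally show ?thesis .
qed

lemma inner_sym_op: "x \<bullet> sym_op e c x = 2 * ((e \<bullet> x) * (c \<bullet> x)) - 2 * (e \<bullet> c) / DIM('a) * (x \<bullet> x)"
  for x :: "'a::euclidean_space"
  by (simp add: sym_op_def inner_add_right inner_diff_right inner_commute[of x e] inner_commute[of x c])

lemma norm_sym_op: "sym_op e c x \<bullet> sym_op e c x =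
    (e \<bullet> e) * ((c \<bullet> x) * (c \<bullet> x)) + (c \<bullet> c) * ((e \<bullet> x) * (e \<bullet> x))
     + (2 * (e \<bullet> c) - 8 * (e \<bullet> c) / DIM('a)) * ((e \<bullet> x) * (c \<bullet> x)) + (2 * (e \<bullet> c) / DIM('a))\<^sup>2 * (x \<bullet> x)"
  for x :: "'a::euclidean_space"
proof -
  define s where "s = 2 * (e \<bullet> c) / DIM('a)"
  have "sym_op e c x \<bullet> sym_op e c x =
    (e \<bullet> e) * ((c \<bullet> x) * (c \<bullet> x)) + (c \<bullet> c) * ((e \<bullet> x) * (e \<bullet> x))
     + (2 * (e \<bullet> c) - 4 * s) * ((e \<bullet> x) * (c \<bullet> x)) + s\<^sup>2 * (x \<bullet> x)"
    unfolding sym_op_def s_def[symmetric]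
    by (simp add: inner_add_left inner_add_right inner_diff_left inner_diff_right inner_commute[of x e]
        inner_commute[of x c] inner_commute[of c e] power2_eq_square algebra_simps)
  then show ?thesis by (simp add: s_def)
qed

context
  fixes R :: real and e c :: "real^'n" and t \<gamma> c0 :: real
  assumes R: "R > 0" and e: "norm e = 1"
  defines "t \<equiv> e \<bullet> c" and "\<gamma> \<equiv> c \<bullet> c"
    and "c0 \<equiv> R\<^sup>2 * measure (sphere_measure R) (sphere (0::real^'n) R) / CARD('n)"
begin

lemma moment_pos: "c0 > 0"
  using R measure_sphere_pos[OF R, where ?'a = "real^'n"] by (simp add: c0_def)

lemma sphere_inner_self: "x \<in> sphere 0 R \<Longrightarrow> (x::real^'n) \<bullet> x = R\<^sup>2"
  by (auto simp: dot_square_norm)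

lemma second_moment: "(\<integral>x. (u \<bullet> x) * (w \<bullet> x) \<partial>sphere_measure R) = c0 * (u \<bullet> w)" for u w :: "real^'n"
  by (simp add: integral_sphere_second_moment[OF R] c0_def)

lemma integral_const_sphere: "(\<integral>x. a \<partial>(sphere_measure R :: (real^'n) measure)) = a * CARD('n) * c0 / R\<^sup>2" for a :: real
  using R by (simp add: space_sphere_measure[OF R] c0_def)

lemma integrable_products:
  "integrable (sphere_measure R) (\<lambda>x. (u \<bullet> x) * (w \<bullet> x))"
  "integrable (sphere_measure R) (\<lambda>x. ((u \<bullet> x) * (w \<bullet> x))\<^sup>2)"
  "integrable (sphere_measure R) (\<lambda>x::real^'n. a :: real)" for u w :: "real^'n"
  by (rule integrable_sphere[OF R]; intro continuous_intros)+

lemma integral_quadratic: "(\<integral>x. x \<bullet> sym_op e c x \<partial>sphere_measure R) = 0"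
proof -
  have "(\<integral>x. x \<bullet> sym_op e c x \<partial>sphere_measure R) =
      (\<integral>x. 2 * ((e \<bullet> x) * (c \<bullet> x)) - 2 * t / CARD('n) * R\<^sup>2 \<partial>sphere_measure R)"
    by (rule integral_sphere_cong[OF R]) (simp add: inner_sym_op t_def sphere_inner_self)
  also have "\<dots> = 2 * (c0 * t) - 2 * t / CARD('n) * R\<^sup>2 * CARD('n) * c0 / R\<^sup>2"
    unfolding Bochner_Integration.integral_diff[OF integrable_mult_right[OF integrable_products(1)] integrable_products(3)]
      integral_const_sphere by (simp add: second_moment t_def)
  also have "\<dots> = 0" using R by simp
  finally show ?thesis .
qed

lemma integral_quadratic_square: "(\<integral>x. (x \<bullet> sym_op e c x)\<^sup>2 \<partial>sphere_measure R) =
    4 * R\<^sup>2 * c0 * ((\<gamma> + 2 * t\<^sup>2) / (real CARD('n) + 2) - t\<^sup>2 / CARD('n))"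
proof -
  define s where "s = 2 * t / CARD('n) * R\<^sup>2"
  have "(\<integral>x. (x \<bullet> sym_op e c x)\<^sup>2 \<partial>sphere_measure R) =
      (\<integral>x. 4 * ((e \<bullet> x) * (c \<bullet> x))\<^sup>2 - 4 * s * ((e \<bullet> x) * (c \<bullet> x)) + s\<^sup>2 \<partial>sphere_measure R)"
  proof (rule integral_sphere_cong[OF R])
    fix x :: "real^'n" assume x: "x \<in> sphere 0 R"
    have h: "x \<bullet> sym_op e c x = 2 * ((e \<bullet> x) * (c \<bullet> x)) - s"
      by (simp add: inner_sym_op s_def t_def sphere_inner_self[OF x])
    show "(x \<bullet> sym_op e c x)\<^sup>2 = 4 * ((e \<bullet> x) * (c \<bullet> x))\<^sup>2 - 4 * s * ((e \<bullet> x) * (c \<bullet> x)) + s\<^sup>2"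
      unfolding h by (simp add: power2_eq_square algebra_simps)
  qed
  also have "\<dots> = 4 * (R\<^sup>2 * c0 / (real CARD('n) + 2) * (\<gamma> + 2 * t\<^sup>2)) - 4 * s * (c0 * t) + s\<^sup>2 * CARD('n) * c0 / R\<^sup>2"
  proof -
    have "(\<integral>x. ((e \<bullet> x) * (c \<bullet> x))\<^sup>2 \<partial>sphere_measure R) = R\<^sup>2 * c0 / (real CARD('n) + 2) * (\<gamma> + 2 * t\<^sup>2)"
      unfolding integral_sphere_fourth_moment[OF R]
      by (simp add: c0_def e \<gamma>_def t_def dot_square_norm power4_eq_xxxx power2_eq_square)
    then have m4: "has_bochner_integral (sphere_measure R) (\<lambda>x. ((e \<bullet> x) * (c \<bullet> x))\<^sup>2)
        (R\<^sup>2 * c0 / (real CARD('n) + 2) * (\<gamma> + 2 * t\<^sup>2))"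
      using has_bochner_integral_integrable[OF integrable_products(2)[of e c]] by simp
    have m2: "has_bochner_integral (sphere_measure R) (\<lambda>x. (e \<bullet> x) * (c \<bullet> x)) (c0 * t)"
      using has_bochner_integral_integrable[OF integrable_products(1)[of e c]] unfolding second_moment t_def .
    have m0: "has_bochner_integral (sphere_measure R :: (real^'n) measure) (\<lambda>x. s\<^sup>2) (s\<^sup>2 * CARD('n) * c0 / R\<^sup>2)"
      using has_bochner_integral_integrable[OF integrable_products(3)[of "s\<^sup>2"]] unfolding integral_const_sphere .
    show ?thesis
      by (intro has_bochner_integral_integral_eq has_bochner_integral_add has_bochner_integral_diff
          has_bochner_integral_mult_right m0 m2 m4)
  qed
  also have "\<dots> = 4 * R\<^sup>2 * c0 * ((\<gamma> + 2 * t\<^sup>2) / (real CARD('n) + 2) - t\<^sup>2 / CARD('n))"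
  proof -
    have "s\<^sup>2 * CARD('n) * c0 / R\<^sup>2 = 4 * t\<^sup>2 / CARD('n) * R\<^sup>2 * c0"
      using R by (simp add: s_def power2_eq_square field_simps)
    moreover have "4 * s * (c0 * t) = 8 * t\<^sup>2 / CARD('n) * R\<^sup>2 * c0"
      by (simp add: s_def power2_eq_square)
    ultimately show ?thesis by (simp add: algebra_simps)
  qed
  finally show ?thesis .
qed

text \<open>Equivalent to Green's formula \<open>\<integral>|grad h|\<^sup>2 = (2 n / R\<^sup>2) \<integral>h\<^sup>2\<close> for the eigenfunction
  \<open>h x = x \<bullet> sym_op e c x\<close>, where \<open>n\<close> is the dimension of the ambient space; here it follows from
  the moments.\<close>

lemma integral_norm_sym_op: "R\<^sup>2 * (\<integral>x. sym_op e c x \<bullet> sym_op e c x \<partial>sphere_measure R) =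
    (real CARD('n) + 2) / 2 * (\<integral>x. (x \<bullet> sym_op e c x)\<^sup>2 \<partial>sphere_measure R)"
proof -
  define l where "l = 2 * t - 8 * t / CARD('n)"
  define s where "s = (2 * t / CARD('n))\<^sup>2 * R\<^sup>2"
  have n: "real CARD('n) > 0" by simp
  have "(\<integral>x. sym_op e c x \<bullet> sym_op e c x \<partial>sphere_measure R) =
      (\<integral>x. (c \<bullet> x) * (c \<bullet> x) + \<gamma> * ((e \<bullet> x) * (e \<bullet> x)) + l * ((e \<bullet> x) * (c \<bullet> x)) + s \<partial>sphere_measure R)"
    by (rule integral_sphere_cong[OF R])
      (simp add: norm_sym_op t_def[symmetric] \<gamma>_def l_def s_def sphere_inner_self dot_square_norm[of e] e)
  also have "\<dots> = c0 * \<gamma> + \<gamma> * (c0 * (e \<bullet> e)) + l * (c0 * t) + s * CARD('n) * c0 / R\<^sup>2"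
    unfolding \<gamma>_def t_def
    by (simp add: integrable_products second_moment integral_const_sphere del: integral_const lebesgue_integral_const)
  also have "e \<bullet> e = 1" using e by (simp add: dot_square_norm)
  also have "s * CARD('n) * c0 / R\<^sup>2 = 4 * t\<^sup>2 / CARD('n) * c0"
    using R by (simp add: s_def power2_eq_square field_simps)
  finally have 1: "(\<integral>x. sym_op e c x \<bullet> sym_op e c x \<partial>sphere_measure R) = 2 * c0 * (\<gamma> + t\<^sup>2 - 2 * t\<^sup>2 / CARD('n))"
    by (simp add: l_def power2_eq_square algebra_simps)
  have "(real CARD('n) + 2) / 2 * (4 * R\<^sup>2 * c0 * (P - P'))
     = 2 * R\<^sup>2 * c0 * ((real CARD('n) + 2) * P - (real CARD('n) + 2) * P')" for P P'
    by (simp add: field_simps)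
  then have "(real CARD('n) + 2) / 2 * (4 * R\<^sup>2 * c0 * ((\<gamma> + 2 * t\<^sup>2) / (real CARD('n) + 2) - t\<^sup>2 / CARD('n)))
     = 2 * R\<^sup>2 * c0 * ((real CARD('n) + 2) * ((\<gamma> + 2 * t\<^sup>2) / (real CARD('n) + 2)) - (real CARD('n) + 2) * (t\<^sup>2 / CARD('n)))" .
  also have "(real CARD('n) + 2) * ((\<gamma> + 2 * t\<^sup>2) / (real CARD('n) + 2)) = \<gamma> + 2 * t\<^sup>2"
    by simp
  also have "(real CARD('n) + 2) * (t\<^sup>2 / CARD('n)) = t\<^sup>2 + 2 * t\<^sup>2 / CARD('n)"
    using n by (simp add: field_simps)
  finally show ?thesis
    unfolding 1 integral_quadratic_square by (simp add: algebra_simps)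
qed

lemma integral_quadratic_square_pos:
  assumes "CARD('n) \<ge> 2" and "c \<noteq> 0"
  shows "(\<integral>x. (x \<bullet> sym_op e c x)\<^sup>2 \<partial>sphere_measure R) > 0"
proof -
  define n where "n = real CARD('n)"
  have n: "n \<ge> 2" using assms by (simp add: n_def)
  have "(\<gamma> + 2 * t\<^sup>2) / (n + 2) - t\<^sup>2 / n = (n * \<gamma> + (n - 2) * t\<^sup>2) / (n * (n + 2))"
    using n by (simp add: field_simps)
  moreover have "\<gamma> > 0" using assms by (simp add: \<gamma>_def)
  then have "n * \<gamma> + (n - 2) * t\<^sup>2 > 0"
    using n by (intro add_pos_nonneg mult_pos_pos mult_nonneg_nonneg) auto
  ultimately have "(\<gamma> + 2 * t\<^sup>2) / (n + 2) - t\<^sup>2 / n > 0"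
    using n by simp
  then have "4 * R\<^sup>2 * c0 * ((\<gamma> + 2 * t\<^sup>2) / (n + 2) - t\<^sup>2 / n) > 0"
    using moment_pos R by simp
  then show ?thesis
    unfolding integral_quadratic_square by (simp add: n_def)
qed

text \<open>The odd terms integrate to zero, and so does the quadratic form itself. What remains is diagonal with
  respect to \<open>\<alpha>\<close>, \<open>b\<close> and \<open>c\<close>.\<close>

lemma integral_second_variation_integrand:
  fixes b :: "real^'n" and a1 a2 a3 \<alpha> \<kappa> d :: real
  shows "(\<integral>x. (- a1 * \<alpha> + a2 * (b \<bullet> x) - a3 * (x \<bullet> sym_op e c x)) * (\<alpha> + b \<bullet> x + x \<bullet> sym_op e c x)
      - 2 * (b \<bullet> sym_op e c x - \<kappa> * (b \<bullet> x) * (x \<bullet> sym_op e c x))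
      + d * (R\<^sup>2 * (sym_op e c x \<bullet> sym_op e c x) - (x \<bullet> sym_op e c x)\<^sup>2) \<partial>sphere_measure R) =
    - a1 * \<alpha>\<^sup>2 * (CARD('n) * c0 / R\<^sup>2) + a2 * c0 * (b \<bullet> b)
      + (d * CARD('n) / 2 - a3) * (\<integral>x. (x \<bullet> sym_op e c x)\<^sup>2 \<partial>sphere_measure R)"
proof -
  let ?A = "sym_op e c"
  have cA: "continuous_on UNIV ?A"
    using linear_sym_op by (intro linear_continuous_on) (simp add: linear_conv_bounded_linear)
  have A_neg: "?A (- x) = - ?A x" for x by (rule linear_neg[OF linear_sym_op])
  \<comment> \<open>The odd part of the integrand.\<close>
  define g1 where "g1 x = (a2 - a1) * \<alpha> * (b \<bullet> x) + (a2 - a3 + 2 * \<kappa>) * (b \<bullet> x) * (x \<bullet> ?A x) - 2 * (b \<bullet> ?A x)" for x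
  have cg1: "continuous_on UNIV g1"
    unfolding g1_def by (intro continuous_intros cA)
  have g1: "(\<integral>x. g1 x \<partial>sphere_measure R) = 0"
    by (rule integral_sphere_odd[OF R cg1]) (simp add: g1_def A_neg)
  have i1: "integrable (sphere_measure R) g1"
    by (rule integrable_sphere[OF R cg1])
  have ih: "integrable (sphere_measure R) (\<lambda>x. x \<bullet> ?A x)" "integrable (sphere_measure R) (\<lambda>x. (x \<bullet> ?A x)\<^sup>2)"
    "integrable (sphere_measure R) (\<lambda>x. ?A x \<bullet> ?A x)"
    by (rule integrable_sphere[OF R]; intro continuous_intros cA)+
  have "(\<integral>x. (- a1 * \<alpha> + a2 * (b \<bullet> x) - a3 * (x \<bullet> ?A x)) * (\<alpha> + b \<bullet> x + x \<bullet> ?A x)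
      - 2 * (b \<bullet> ?A x - \<kappa> * (b \<bullet> x) * (x \<bullet> ?A x))
      + d * (R\<^sup>2 * (?A x \<bullet> ?A x) - (x \<bullet> ?A x)\<^sup>2) \<partial>sphere_measure R) =
    (\<integral>x. - a1 * \<alpha>\<^sup>2 + (a2 * ((b \<bullet> x) * (b \<bullet> x)) + (g1 x + ((- a1 - a3) * \<alpha> * (x \<bullet> ?A x)
      + (d * R\<^sup>2 * (?A x \<bullet> ?A x) + (- d - a3) * (x \<bullet> ?A x)\<^sup>2)))) \<partial>sphere_measure R)"
    by (rule Bochner_Integration.integral_cong[OF refl]) (simp add: g1_def power2_eq_square algebra_simps)
  also have "\<dots> = - a1 * \<alpha>\<^sup>2 * (CARD('n) * c0 / R\<^sup>2) + (a2 * (c0 * (b \<bullet> b)) + (0 + ((- a1 - a3) * \<alpha> * 0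
      + (d * R\<^sup>2 * (\<integral>x. ?A x \<bullet> ?A x \<partial>sphere_measure R) + (- d - a3) * (\<integral>x. (x \<bullet> ?A x)\<^sup>2 \<partial>sphere_measure R)))))"
  proof (rule has_bochner_integral_integral_eq)
    let ?M = "sphere_measure R :: (real^'n) measure"
    have "has_bochner_integral ?M (\<lambda>x. - a1 * \<alpha>\<^sup>2) (- a1 * \<alpha>\<^sup>2 * (CARD('n) * c0 / R\<^sup>2))"
      using has_bochner_integral_integrable[OF integrable_products(3)[of "- a1 * \<alpha>\<^sup>2"]]
      unfolding integral_const_sphere by (simp add: mult.assoc)
    moreover have "has_bochner_integral ?M (\<lambda>x. (b \<bullet> x) * (b \<bullet> x)) (c0 * (b \<bullet> b))"
      using has_bochner_integral_integrable[OF integrable_products(1)[of b b]] unfolding second_moment .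
    moreover have "has_bochner_integral ?M g1 0"
      using has_bochner_integral_integrable[OF i1] unfolding g1 .
    moreover have "has_bochner_integral ?M (\<lambda>x. x \<bullet> ?A x) 0"
      using has_bochner_integral_integrable[OF ih(1)] unfolding integral_quadratic .
    moreover note has_bochner_integral_integrable[OF ih(2)] has_bochner_integral_integrable[OF ih(3)]
    ultimately show "has_bochner_integral ?M (\<lambda>x. - a1 * \<alpha>\<^sup>2 + (a2 * ((b \<bullet> x) * (b \<bullet> x)) + (g1 x + ((- a1 - a3) * \<alpha> * (x \<bullet> ?A x)
      + (d * R\<^sup>2 * (?A x \<bullet> ?A x) + (- d - a3) * (x \<bullet> ?A x)\<^sup>2)))))
      (- a1 * \<alpha>\<^sup>2 * (CARD('n) * c0 / R\<^sup>2) + (a2 * (c0 * (b \<bullet> b)) + (0 + ((- a1 - a3) * \<alpha> * 0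
      + (d * R\<^sup>2 * (\<integral>x. ?A x \<bullet> ?A x \<partial>?M) + (- d - a3) * (\<integral>x. (x \<bullet> ?A x)\<^sup>2 \<partial>?M))))))"
      by (intro has_bochner_integral_add has_bochner_integral_mult_right)
  qed
  also have "d * R\<^sup>2 * (\<integral>x. ?A x \<bullet> ?A x \<partial>sphere_measure R) = d * ((real CARD('n) + 2) / 2 * (\<integral>x. (x \<bullet> ?A x)\<^sup>2 \<partial>sphere_measure R))"
    by (simp only: integral_norm_sym_op[symmetric] mult.assoc)
  finally show ?thesis by (simp add: algebra_simps add_divide_distrib)
qed

end

section \<open>Negative directions and the index\<close>

lemma veronese_fields_sym_op:
  "veronese_form Q m R \<kappa> r \<Longrightarrow> veronese_fields Q m R \<kappa> r (sym_op e c)"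
  by (intro veronese_fields.intro veronese_fields_axioms.intro linear_sym_op sym_op_self sym_op_trace)

lemma second_variation_negative:
  fixes Q :: "real^'n \<Rightarrow> real^'n \<Rightarrow> 'b::euclidean_space" and b c e :: "real^'n"
  assumes Q: "veronese_form Q m R \<kappa> r" and m: "m \<ge> 2" and e: "norm e = 1"
    and phi: "\<And>y. y \<in> sphere 0 R \<Longrightarrow> \<phi> y = (Q y y, r)"
    and V: "\<And>y. y \<in> sphere 0 R \<Longrightarrow> V y = veronese_fields.field Q R \<kappa> r b (sym_op e c) \<alpha> 1 0 1 1 0 y"
    and nz: "(b, c, \<alpha>) \<noteq> 0"
  shows "second_variation_form R \<phi> V V < 0"
proof -
  interpret veronese_form Q m R \<kappa> r by (rule Q)
  interpret F: veronese_fields Q m R \<kappa> r b "sym_op e c"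
    by (rule veronese_fields_sym_op[OF Q])
  let ?A = "sym_op e c"
  have phi': "\<phi> y = \<Phi> y" if "y \<in> sphere 0 R" for y
    using phi[OF that] by (simp add: \<Phi>_def)
  define a where "a = (m * \<kappa>)\<^sup>2 + 4 * (m * \<kappa>) - 4 * m\<^sup>2"
  define c0 where "c0 = R\<^sup>2 * measure (sphere_measure R) (sphere (0::real^'n) R) / CARD('n)"
  define H2 where "H2 = (\<integral>x. (x \<bullet> ?A x)\<^sup>2 \<partial>sphere_measure R)"
  have n: "real CARD('n) = m + 1" using dim by simp
  have "second_variation_form R \<phi> V V =
    (\<integral>x. (- (4 * m\<^sup>2) * \<alpha> + a * (b \<bullet> x) - (2 * m * (m - 1)) * (x \<bullet> ?A x)) * (\<alpha> + b \<bullet> x + x \<bullet> ?A x)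
      - 2 * (b \<bullet> ?A x - \<kappa> * (b \<bullet> x) * (x \<bullet> ?A x))
      + (2 * (m - 1)) * (R\<^sup>2 * (?A x \<bullet> ?A x) - (x \<bullet> ?A x)\<^sup>2) \<partial>sphere_measure R)"
    unfolding second_variation_form_def
  proof (rule integral_sphere_cong[OF R_pos])
    fix x :: "real^'n" assume x: "x \<in> sphere 0 R"
    have "second_variation_op R \<phi> V x \<bullet> V x =
      (- 4 * m\<^sup>2 * \<alpha> + ((m * \<kappa>)\<^sup>2 + 4 * (m * \<kappa>) - 4 * m\<^sup>2) * F.f x - 2 * m * (m - 1) * F.h x) * (\<alpha> + F.f x + F.h x)
      - 2 * (b \<bullet> ?A x - \<kappa> * F.f x * F.h x) + 2 * (m - 1) * (R\<^sup>2 * (?A x \<bullet> ?A x) - (F.h x)\<^sup>2)"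
      by (rule F.second_variation_integrand[OF phi' x V])
    then show "second_variation_op R \<phi> V x \<bullet> V x =
      (- (4 * m\<^sup>2) * \<alpha> + a * (b \<bullet> x) - (2 * m * (m - 1)) * (x \<bullet> ?A x)) * (\<alpha> + b \<bullet> x + x \<bullet> ?A x)
      - 2 * (b \<bullet> ?A x - \<kappa> * (b \<bullet> x) * (x \<bullet> ?A x))
      + (2 * (m - 1)) * (R\<^sup>2 * (?A x \<bullet> ?A x) - (x \<bullet> ?A x)\<^sup>2)"
      unfolding F.f_def F.h_def a_def by simp
  qed
  also have "\<dots> = - (4 * m\<^sup>2) * \<alpha>\<^sup>2 * (CARD('n) * c0 / R\<^sup>2) + a * c0 * (b \<bullet> b)
      + (2 * (m - 1) * CARD('n) / 2 - 2 * m * (m - 1)) * H2"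
    unfolding integral_second_variation_integrand[OF R_pos e] c0_def H2_def by simp
  also have "2 * (m - 1) * CARD('n) / 2 - 2 * m * (m - 1) = - (m - 1)\<^sup>2"
    unfolding n by (simp add: power2_eq_square field_simps)
  finally have form: "second_variation_form R \<phi> V V =
    - (4 * m\<^sup>2) * \<alpha>\<^sup>2 * (CARD('n) * c0 / R\<^sup>2) + a * c0 * (b \<bullet> b) + - (m - 1)\<^sup>2 * H2" .
  have c0: "c0 > 0"
    unfolding c0_def by (rule moment_pos[OF R_pos e])
  have a: "a < 0"
  proof -
    have "m * \<kappa> \<ge> 0" "m * \<kappa> \<le> m" using m by (simp_all add: kappa field_simps)
    then have "(m * \<kappa>)\<^sup>2 \<le> m\<^sup>2" by (intro power_mono)
    then have "a \<le> m\<^sup>2 + 4 * m - 4 * m\<^sup>2" using \<open>m * \<kappa> \<le> m\<close> by (simp add: a_def)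
    also have "\<dots> = m * (4 - 3 * m)" by (simp add: power2_eq_square algebra_simps)
    also have "\<dots> < 0" using m by (intro mult_pos_neg) auto
    finally show ?thesis .
  qed
  have T1: "- (4 * m\<^sup>2) * \<alpha>\<^sup>2 * (CARD('n) * c0 / R\<^sup>2) \<le> 0"
    and T1': "\<alpha> \<noteq> 0 \<Longrightarrow> - (4 * m\<^sup>2) * \<alpha>\<^sup>2 * (CARD('n) * c0 / R\<^sup>2) < 0"
  proof -
    have "CARD('n) * c0 / R\<^sup>2 > 0" using c0 R_pos by simp
    then show "- (4 * m\<^sup>2) * \<alpha>\<^sup>2 * (CARD('n) * c0 / R\<^sup>2) \<le> 0"
      by (intro mult_nonpos_nonneg) auto
    show "- (4 * m\<^sup>2) * \<alpha>\<^sup>2 * (CARD('n) * c0 / R\<^sup>2) < 0" if "\<alpha> \<noteq> 0"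
      using \<open>CARD('n) * c0 / R\<^sup>2 > 0\<close> that m by (intro mult_neg_pos) auto
  qed
  have T2: "a * c0 * (b \<bullet> b) \<le> 0" "b \<noteq> 0 \<Longrightarrow> a * c0 * (b \<bullet> b) < 0"
    using a c0 by (auto intro!: mult_nonpos_nonneg mult_neg_pos simp: mult_neg_pos less_imp_le)
  have "H2 \<ge> 0" unfolding H2_def by (rule integral_nonneg_AE) simp
  then have T3: "- (m - 1)\<^sup>2 * H2 \<le> 0"
    by (intro mult_nonpos_nonneg) auto
  have T3': "- (m - 1)\<^sup>2 * H2 < 0" if "c \<noteq> 0"
  proof -
    have "real CARD('n) \<ge> 2" using n m by simp
    then have "H2 > 0"
      unfolding H2_def by (intro integral_quadratic_square_pos[OF R_pos e _ that]) simp
    then show ?thesis using m by (intro mult_neg_pos) auto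
  qed
  from nz have "\<alpha> \<noteq> 0 \<or> b \<noteq> 0 \<or> c \<noteq> 0" by (auto simp: zero_prod_def)
  then show ?thesis
    unfolding form using T1 T1' T2 T3 T3' by linarith
qed

text \<open>The sections \<open>V\<close>, linear in the parameters \<open>(b, c, \<alpha>)\<close> and set to zero off the sphere.\<close>

definition variation ::
    "(real^'n \<Rightarrow> real^'n \<Rightarrow> 'b::euclidean_space) \<Rightarrow> real \<Rightarrow> real \<Rightarrow> real^'n \<Rightarrow> ((real^'n) \<times> (real^'n) \<times> real) \<Rightarrow> real^'n \<Rightarrow> 'b \<times> real" where
  "variation Q R r e = (\<lambda>(b, c, \<alpha>) x. if x \<in> sphere 0 R then
      ((\<alpha> + b \<bullet> x) *\<^sub>R Q x x + R\<^sup>2 *\<^sub>R Q x (sym_op e c x), - (\<alpha> + b \<bullet> x + x \<bullet> sym_op e c x) * r) else 0)"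

lemma sym_op_add: "sym_op e (c + c') x = sym_op e c x + sym_op e c' x"
  and sym_op_scale: "sym_op e (t *\<^sub>R c) x = t *\<^sub>R sym_op e c x"
  by (simp_all add: sym_op_def inner_add_left inner_add_right algebra_simps add_divide_distrib)

text \<open>The form being negative on every nonzero parameter, the map \<open>v\<close> is automatically injective.\<close>

lemma biharmonic_index_ge:
  fixes \<phi> :: "'a::euclidean_space \<Rightarrow> 'b::euclidean_space" and v :: "'c::euclidean_space \<Rightarrow> 'a \<Rightarrow> 'b"
  assumes add: "\<And>p q. v (p + q) = v p + v q" and scale: "\<And>t p. v (t *\<^sub>R p) = fun_scale t (v p)"
    and sec: "\<And>p. v p \<in> smooth_sections R \<phi>"
    and neg: "\<And>p. p \<noteq> 0 \<Longrightarrow> second_variation_form R \<phi> (v p) (v p) < 0"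
  shows "biharmonic_index R \<phi> \<ge> enat DIM('c)"
proof -
  have pair: "finite_dimensional_vector_space_pair_1 (scaleR :: real \<Rightarrow> 'c \<Rightarrow> 'c) Basis
      (fun_scale :: real \<Rightarrow> ('a \<Rightarrow> 'b) \<Rightarrow> 'a \<Rightarrow> 'b)"
    by unfold_locales
  have lin: "Vector_Spaces.linear (scaleR :: real \<Rightarrow> 'c \<Rightarrow> 'c) (fun_scale :: real \<Rightarrow> ('a \<Rightarrow> 'b) \<Rightarrow> 'a \<Rightarrow> 'b) v"
    by unfold_locales (simp_all add: add scale)
  have form0: "second_variation_form R \<phi> 0 0 = 0"
    by (simp add: second_variation_form_def)
  have inj: "inj v"
  proof (rule injI)
    fix p q assume "v p = v q"
    then have "v (p - q) = 0"
      using add[of "p - q" q] by simp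
    then show "p = q"
      using neg[of "p - q"] form0 by auto
  qed
  have inj': "inj_on v (module.span (scaleR :: real \<Rightarrow> 'c \<Rightarrow> 'c) UNIV)"
    by (rule inj_on_subset[OF inj subset_UNIV])
  have "fun_space.dim (range v) = vector_space.dim (scaleR :: real \<Rightarrow> 'c \<Rightarrow> 'c) UNIV"
    by (rule finite_dimensional_vector_space_pair_1.dim_image_eq[OF pair, OF lin, of UNIV, OF inj'])
  then have "fun_space.dim (range v) = DIM('c)"
    by (simp add: dim_raw_def[symmetric])
  moreover have "fun_space.subspace (range v)"
  proof (rule fun_space.subspaceI)
    show "0 \<in> range v" using scale[of 0 0] by (auto simp: fun_scale_def fun_eq_iff image_iff intro!: exI[of _ 0])
    show "V + W \<in> range v" if "V \<in> range v" "W \<in> range v" for V W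
      using that by (auto simp flip: add)
    show "fun_scale t V \<in> range v" if "V \<in> range v" for t V
      using that by (auto simp flip: scale)
  qed
  moreover have "range v \<subseteq> smooth_sections R \<phi>" using sec by auto
  moreover have "second_variation_form R \<phi> V V < 0" if V: "V \<in> range v" and nz: "V \<noteq> 0" for V
  proof -
    from V obtain p where p: "V = v p" by auto
    have "v 0 = 0" using scale[of 0 0] by (simp add: fun_scale_def fun_eq_iff)
    then have "p \<noteq> 0" using nz p by auto
    then show ?thesis using neg p by simp
  qed
  ultimately show ?thesis
    unfolding biharmonic_index_def by (intro SUP_upper2[of "range v"]) auto
qed

section \<open>The Veronese matrices\<close>

text \<open>The trace-free part of the symmetrised product of \<open>x\<close> and \<open>y\<close>, as a matrix.\<close>

definition veronese_bilinear :: "real^'n \<Rightarrow> real^'n \<Rightarrow> real^'n^'n" where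
  "veronese_bilinear x y = (\<chi> i j. (x $ i * y $ j + x $ j * y $ i) / 2 - (if i = j then (x \<bullet> y) / CARD('n) else 0))"

lemma veronese_bilinear_commute: "veronese_bilinear x y = veronese_bilinear y x"
  by (simp add: veronese_bilinear_def vec_eq_iff inner_commute add.commute mult.commute)

lemma veronese_bilinear_traceless: "veronese_bilinear x y \<in> traceless_symmetric" for x y :: "real^'n"
proof -
  have "trace (veronese_bilinear x y) = (\<Sum>i\<in>UNIV. x $ i * y $ i) - (\<Sum>i\<in>(UNIV::'n set). (x \<bullet> y) / CARD('n))"
    by (simp add: trace_def veronese_bilinear_def sum_subtractf mult.commute)
  also have "\<dots> = 0"
    by (simp add: inner_vec_def)
  finally show ?thesis
    by (simp add: traceless_symmetric_def transpose_def veronese_bilinear_def vec_eq_iff inner_commute add.commute mult.commute)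
qed

lemma linear_veronese_bilinear: "bilinear (veronese_bilinear :: real^'n \<Rightarrow> real^'n \<Rightarrow> real^'n^'n)"
  unfolding bilinear_def
  by (auto intro!: linearI simp: veronese_bilinear_def vec_eq_iff inner_add_left inner_add_right
      algebra_simps add_divide_distrib)

lemma veronese_bilinear_trace: "(\<Sum>i\<in>Basis. veronese_bilinear i i) = (0 :: real^'n^'n)"
proof -
  have B: "(Basis :: (real^'n) set) = (\<lambda>k. axis k 1) ` UNIV"
    by (auto simp: Basis_vec_def)
  have "(\<Sum>i\<in>Basis. veronese_bilinear i i) = (\<Sum>k\<in>(UNIV::'n set). veronese_bilinear (axis k 1) (axis k 1 :: real^'n))"
    unfolding B by (subst sum.reindex) (auto simp: inj_on_def axis_eq_axis)
  also have "\<dots> = 0"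
  proof -
    have "(axis k 1 $ i * axis k 1 $ j + axis k 1 $ j * axis k 1 $ i) / 2 =
        (if k = i then if i = j then 1 else 0 else (0::real))" for i j k :: 'n
      by (simp add: axis_def)
    then show ?thesis
      by (simp add: vec_eq_iff veronese_bilinear_def inner_axis_axis sum_subtractf)
  qed
  finally show ?thesis .
qed

lemma trace_veronese_bilinear:
  "trace (veronese_bilinear x y ** veronese_bilinear z w) =
    ((x \<bullet> z) * (y \<bullet> w) + (x \<bullet> w) * (y \<bullet> z)) / 2 - (x \<bullet> y) * (z \<bullet> w) / CARD('n)"
  for x y z w :: "real^'n"
proof -
  let ?S = "\<lambda>x y i j. (x $ i * y $ j + x $ j * y $ i) / 2 :: real"
  have prod: "veronese_bilinear x y $ i $ j * veronese_bilinear z w $ j $ i =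
      ?S x y i j * ?S z w j i - (if i = j then ?S x y i i * (z \<bullet> w) / CARD('n) + ?S z w i i * (x \<bullet> y) / CARD('n)
        - (x \<bullet> y) * (z \<bullet> w) / (real CARD('n))\<^sup>2 else 0)" for i j
    by (auto simp: veronese_bilinear_def power2_eq_square algebra_simps)
  have inn: "(\<Sum>i\<in>UNIV. u $ i * v $ i) = u \<bullet> v" for u v :: "real^'n"
    by (simp add: inner_vec_def)
  have pr: "(\<Sum>i\<in>UNIV. \<Sum>j\<in>UNIV. (u $ i * v $ i) * (p $ j * q $ j)) = (u \<bullet> v) * (p \<bullet> q)" for u v p q :: "real^'n"
    by (simp add: sum_product[symmetric] inn)
  have "(\<Sum>i\<in>UNIV. \<Sum>j\<in>UNIV. ?S x y i j * ?S z w j i) =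
    (\<Sum>i\<in>UNIV. \<Sum>j\<in>UNIV. ((x $ i * w $ i) * (y $ j * z $ j) + (x $ i * z $ i) * (y $ j * w $ j)
      + (y $ i * w $ i) * (x $ j * z $ j) + (y $ i * z $ i) * (x $ j * w $ j)) / 4)"
    by (intro sum.cong refl) (simp add: field_simps)
  also have "\<dots> = ((x \<bullet> w) * (y \<bullet> z) + (x \<bullet> z) * (y \<bullet> w) + (y \<bullet> w) * (x \<bullet> z) + (y \<bullet> z) * (x \<bullet> w)) / 4"
    unfolding sum_divide_distrib[symmetric] sum.distrib pr ..
  finally have 1: "(\<Sum>i\<in>UNIV. \<Sum>j\<in>UNIV. ?S x y i j * ?S z w j i) = ((x \<bullet> z) * (y \<bullet> w) + (x \<bullet> w) * (y \<bullet> z)) / 2"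
    by (simp add: algebra_simps)
  have 2: "(\<Sum>i\<in>UNIV. ?S x y i i * (z \<bullet> w) / CARD('n)) = (x \<bullet> y) * (z \<bullet> w) / CARD('n)" for x y z w :: "real^'n"
    by (simp add: mult.commute[of "y $ _"] inn sum_divide_distrib[symmetric] sum_distrib_right[symmetric])
  have "trace (veronese_bilinear x y ** veronese_bilinear z w) =
    (\<Sum>i\<in>UNIV. \<Sum>j\<in>UNIV. veronese_bilinear x y $ i $ j * veronese_bilinear z w $ j $ i)"
    by (simp add: trace_def matrix_matrix_mult_def)
  also have "\<dots> = (\<Sum>i\<in>UNIV. \<Sum>j\<in>UNIV. ?S x y i j * ?S z w j i)
     - (\<Sum>i\<in>UNIV. ?S x y i i * (z \<bullet> w) / CARD('n) + ?S z w i i * (x \<bullet> y) / CARD('n)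
        - (x \<bullet> y) * (z \<bullet> w) / (real CARD('n))\<^sup>2)"
    unfolding prod by (simp add: sum_subtractf)
  also have "\<dots> = ((x \<bullet> z) * (y \<bullet> w) + (x \<bullet> w) * (y \<bullet> z)) / 2 - (x \<bullet> y) * (z \<bullet> w) / CARD('n)"
    unfolding 1 sum_subtractf sum.distrib 2 by (simp add: power2_eq_square mult.commute)
  finally show ?thesis .
qed

lemma veronese_form_of_isometry:
  fixes L :: "real^'n^'n \<Rightarrow> real^'k" and m :: real
  assumes L: "linear L"
    and iso: "\<And>A B. A \<in> traceless_symmetric \<Longrightarrow> B \<in> traceless_symmetric \<Longrightarrow> L A \<bullet> L B = trace (A ** B)"
    and m: "m > 0" and n: "real CARD('n) = m + 1"
  shows "veronese_form (\<lambda>x y. sqrt (m / (2 * (m + 1))) *\<^sub>R L (veronese_bilinear x y)) m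
    (sqrt ((m + 1) / m)) (m / (m + 1)) (1 / sqrt 2)"
proof (rule veronese_form.intro)
  let ?Q = "\<lambda>x y. sqrt (m / (2 * (m + 1))) *\<^sub>R L (veronese_bilinear x y)"
  have bil: "linear (veronese_bilinear x)" "linear (\<lambda>x. veronese_bilinear x y)" for x y :: "real^'n"
    using linear_veronese_bilinear by (auto simp: bilinear_def)
  have "bilinear ?Q"
    unfolding bilinear_def
    by (auto intro!: linear_compose_scale_right linear_compose[OF bil(1) L, unfolded o_def] linear_compose[OF bil(2) L, unfolded o_def])
  then show "bounded_bilinear ?Q"
    using bilinear_conv_bounded_bilinear by blast
  show "?Q x y = ?Q y x" for x y
    by (simp only: veronese_bilinear_commute[of x y])
  show "?Q x y \<bullet> ?Q z w = m / (m + 1) / 2 *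
      (((x \<bullet> z) * (y \<bullet> w) + (x \<bullet> w) * (y \<bullet> z)) / 2 - (x \<bullet> y) * (z \<bullet> w) / (m + 1))" for x y z w
  proof -
    have "sqrt (m / (2 * (m + 1))) * sqrt (m / (2 * (m + 1))) = m / (m + 1) / 2"
      using m by simp
    then show ?thesis
      using iso[OF veronese_bilinear_traceless veronese_bilinear_traceless, of x y z w]
      by (simp add: trace_veronese_bilinear n flip: mult.assoc)
  qed
  have "(\<Sum>i\<in>Basis. ?Q i i) = sqrt (m / (2 * (m + 1))) *\<^sub>R L (\<Sum>i\<in>Basis. veronese_bilinear i i)"
    by (simp add: linear_sum[OF L] scaleR_sum_right)
  then show "(\<Sum>i\<in>Basis. ?Q i i) = 0"
    by (simp add: veronese_bilinear_trace linear_0[OF L])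
  show "real DIM(real^'n) = m + 1" using n by simp
qed (use m in auto)

section \<open>The index of the biharmonic Veronese map\<close>

theorem proposition5p3:
  fixes m p :: nat and \<psi> :: "real^'n \<Rightarrow> real^'k"
  assumes "m \<ge> 2"
    and "real p = (real m - 1) * (real m + 2) / 2"
    and "CARD('n) = m + 1"
    and "CARD('k) = m + p + 1"
    and "generalised_veronese \<psi>"
  shows "biharmonic_index (sqrt ((real m + 1) / real m)) (tropical_inclusion \<circ> \<psi>) \<ge> enat (2 * m + 3)"
proof -
  define R where "R = sqrt ((real m + 1) / real m)"
  define \<kappa> where "\<kappa> = real m / (real m + 1)"
  define r :: real where "r = 1 / sqrt 2"
  define \<phi> where "\<phi> = tropical_inclusion \<circ> \<psi>"
  have n: "real CARD('n) = real m + 1" using assms(3) by simp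
  obtain L where L: "linear L"
    and iso: "\<And>A B. A \<in> traceless_symmetric \<Longrightarrow> B \<in> traceless_symmetric \<Longrightarrow> L A \<bullet> L B = trace (A ** B)"
    and psi: "\<And>x. x \<in> sphere 0 R \<Longrightarrow> \<psi> x = L (veronese_matrix x)"
    using assms(5) n unfolding generalised_veronese_def Let_def R_def by auto
  define Q where "Q x y = sqrt (real m / (2 * (real m + 1))) *\<^sub>R L (veronese_bilinear x y)" for x y
  have Q: "veronese_form Q (real m) R \<kappa> r"
    unfolding Q_def[abs_def] R_def \<kappa>_def r_def
    by (rule veronese_form_of_isometry[OF L iso]) (use assms(1) n in auto)
  interpret veronese_form Q "real m" R \<kappa> r by (rule Q)
  have VM: "veronese_matrix x = sqrt (real m / (2 * (real m + 1))) *\<^sub>R veronese_bilinear x x" for x :: "real^'n"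
    unfolding veronese_matrix_def Let_def n
    by (simp add: vec_eq_iff veronese_bilinear_def mat_def n power2_norm_eq_inner)
  have phi: "\<phi> y = (Q y y, r)" if "y \<in> sphere 0 R" for y
    using psi[OF that] by (simp add: \<phi>_def tropical_inclusion_def r_def Q_def VM linear_cmul[OF L])
  obtain e :: "real^'n" where e: "norm e = 1"
    using vector_choose_size[of 1] by auto
  define v where "v = variation Q R r e"
  have v: "v (b, c, \<alpha>) y = veronese_fields.field Q R \<kappa> r b (sym_op e c) \<alpha> 1 0 1 1 0 y"
    if "y \<in> sphere 0 R" for b c \<alpha> y
  proof -
    interpret F: veronese_fields Q "real m" R \<kappa> r b "sym_op e c"
      by (rule veronese_fields_sym_op[OF Q])
    show ?thesis
      using that by (simp add: v_def variation_def F.field_def F.f_def F.h_def algebra_simps)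
  qed
  have "biharmonic_index R \<phi> \<ge> enat DIM((real^'n) \<times> (real^'n) \<times> real)"
  proof (rule biharmonic_index_ge)
    fix p q :: "(real^'n) \<times> (real^'n) \<times> real" and t :: real
    obtain b c \<alpha> where p: "p = (b, c, \<alpha>)" by (cases p)
    obtain b' c' \<alpha>' where q: "q = (b', c', \<alpha>')" by (cases q)
    show "v (p + q) = v p + v q"
      unfolding p q v_def variation_def
      by (auto simp: fun_eq_iff sym_op_add inner_add_left inner_add_right Q.add_right algebra_simps)
    show "v (t *\<^sub>R p) = fun_scale t (v p)"
      unfolding p v_def variation_def fun_scale_def
      by (auto simp: fun_eq_iff sym_op_scale Q.scaleR_right algebra_simps)
    interpret F: veronese_fields Q "real m" R \<kappa> r b "sym_op e c"
      by (rule veronese_fields_sym_op[OF Q])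
    show "v p \<in> smooth_sections R \<phi>"
      unfolding smooth_sections_def smooth_on_sphere_def p mem_Collect_eq
    proof (intro conjI ballI allI impI exI)
      show "open UNIV" "sphere 0 R \<subseteq> UNIV" by auto
      show "Ck_on k (F.field \<alpha> 1 0 1 1 0) UNIV" for k by (rule F.Ck_on_field)
      show "F.field \<alpha> 1 0 1 1 0 x = v (b, c, \<alpha>) x" if "x \<in> sphere 0 R" for x
        by (rule v[OF that, symmetric])
      show "v (b, c, \<alpha>) x \<bullet> \<phi> x = 0" if x: "x \<in> sphere 0 R" for x
        using F.field_perp[OF x] unfolding v[OF x] phi[OF x] \<Phi>_def by simp
      show "v (b, c, \<alpha>) x = 0" if "x \<notin> sphere 0 R" for x
        using that by (simp add: v_def variation_def)
    qed
    show "second_variation_form R \<phi> (v p) (v p) < 0" if "p \<noteq> 0"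
      by (rule second_variation_negative[OF Q _ e phi]) (use assms(1) that p v in auto)
  qed
  moreover have "DIM((real^'n) \<times> (real^'n) \<times> real) = 2 * m + 3"
    using assms(3) by simp
  ultimately show ?thesis
    unfolding R_def \<phi>_def by (simp only:)
qed

end
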